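(* For every constant $c_0>0$ there exist constants $0<a\le b$ and $C>0$, depending only on $c_0$, such that the following holds. Let $\mathcal{F}$ be the class of homogeneous halfspaces in $\mathbb{R}^d$, consider the binary loss, and let $P$ be a distribution of $(X,Y)$ on $\mathbb{R}^d\times\{1,-1\}$ whose marginal $P_X$ is a zero mean isotropic log-concave distribution. Assume that the excess loss class $\mathcal{L}_{\mathcal{Y}}$ satisfies the $L_1$-Bernstein condition with parameters $\beta\in[0,1]$, $B>1$. Let $n\ge1$, $\delta\in(0,1)$, put $Q=\gamma^*_{L_1}(\mathcal{G}_{\mathcal{Y}},\frac Bn,\beta,B)+\frac{B\log(\frac1\delta)}{n}$, and let $\eta\in[0,1]$ satisfy $aBQ^{\frac{\beta}{2-\beta}}\le\eta\le bBQ^{\frac{\beta}{2-\beta}}$. Let $f_1,\dots,f_{N_\eta}\in\mathcal{F}$ be such that the functions $(x,y)\mapsto\mathbf{1}[f_j(x)\ne y]$, $j=1,\dots,N_\eta$, form a minimal $L_1(P)$ $\eta$-covering of $\mathcal{G}_{\mathcal{Y}}$, and let $\hat f_\eta=\mathrm{argmin}_{f\in\{f_1,\dots,f_{N_\eta}\}}R_n(f)$. If there is $f_\eta\in\{f_1,\dots,f_{N_\eta}\}$ such that $g_\eta(x,y)=\mathbf{1}[f_\eta(x)\ne y]-\mathbf{1}[f^*(x)\ne y]$ satisfies $P|g_\eta|\le\eta$ and $P|g_\eta|\ge c_0B(Pg_\eta)^\beta$, then with probability at least $1-\delta$, $$R(\hat f_\eta)-R(f^* )\le C\left(\frac{Bd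}{n}+\frac{B\log(\frac1\delta)}{n}\right)^{\frac1{2-\beta}}.$$
   Context: A homogeneous halfspace classifier is a $\{1,-1\}$-valued linear threshold classifier whose hyperplane passes through the origin. The sample $(X_i,Y_i)_{i=1}^n$ is i.i.d. from $P$; $P$ also denotes expectation. Risk: $R(f)=P(f(X)\ne Y)$; empirical risk: $R_n(f)=\frac1n\sum_{i=1}^n\mathbf{1}[f(X_i)\ne Y_i]$; $f^*\in\mathcal{F}$ is a minimizer of $R$ over $\mathcal{F}$. Loss class: $\mathcal{G}_{\mathcal{Y}}=\{(x,y)\mapsto\mathbf{1}[f(x)\ne y]:f\in\mathcal{F}\}$. Excess loss class: $\mathcal{L}_{\mathcal{Y}}=\{(x,y)\mapsto\mathbf{1}[f(x)\ne y]-\mathbf{1}[f^*(x)\ne y]:f\in\mathcal{F}\}$. A class $\mathcal{G}$ satisfies the $L_1$-Bernstein condition with parameters $\beta,B$ if $P|g|\le B(Pg)^\beta$ for all $g\in\mathcal{G}$. $\log(x)$ denotes the truncated logarithm $\ln(\max(x,e))$. For $\mathcal{H}\subset L_1(P)$, $\mathcal{N}(\mathcal{H},\varepsilon)$ is the minimal number $N$ of functions $h_1,\dots,h_N\in\mathcal{H}$ such that each $h\in\mathcal{H}$ has some $j$ with $\|h-h_j\|_{L_1(P)}\le\varepsilon$; a minimal $\varepsilon$-covering attains this number. With $\mathcal{B}_{L_1}(g,\rho)$ the $L_1(P)$ ball of radius $\rho$ centered at $g$, for $\beta\in[0,1]$ and $B\ge1$, $$\mathcal{D}^{\mathrm{loc}}_{L_1}(\mathcal{G},\varepsilon,\beta,B)=\sup_{\gamma\ge\varepsilon}\sup_{g\in\mathcal{G}}\log\left(\mathcal{N}(\mathcal{G}\cap\mathcal{B}_{L_1}(g,2B\gamma^\beta),\gamma)\right),$$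 $$\gamma^*_{L_1}(\mathcal{G},k,\beta,B)=\inf\left\{\varepsilon>0:\ k\,\mathcal{D}^{\mathrm{loc}}_{L_1}\left(\mathcal{G},B\varepsilon^{\frac{\beta}{2-\beta}},1,1\right)\le\varepsilon\right\}.$$ *)

theory Defs
  imports "HOL-Probability.Probability"
begin

section \<open>Powers and logarithms\<close>

text \<open>\<open>powr\<close> has \<open>0 powr 0 = 0\<close>; here \<open>rpow 0 0 = 1\<close>, so that the Bernstein
  condition with exponent 0 reads \<open>P|g| \<le> B\<close> also for functions of mean zero.\<close>

definition rpow :: "real \<Rightarrow> real \<Rightarrow> real" where
  "rpow x p = (if p = 0 then 1 else x powr p)"

definition tlog :: "real \<Rightarrow> real" where
  "tlog x = ln (max x (exp 1))"

definition tlog_enat :: "enat \<Rightarrow> ereal" where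
  "tlog_enat N = (case N of enat m \<Rightarrow> ereal (tlog (real m)) | \<infinity> \<Rightarrow> \<infinity>)"


section \<open>Covering numbers and local entropy in \<open>L\<^sub>1(P)\<close>\<close>

text \<open>All classes of functions below are meant to consist of \<open>P\<close>-integrable functions.\<close>

definition L1_dist :: "'z measure \<Rightarrow> ('z \<Rightarrow> real) \<Rightarrow> ('z \<Rightarrow> real) \<Rightarrow> real" where
  "L1_dist P g h = (\<integral>z. \<bar>g z - h z\<bar> \<partial>P)"

definition L1_ball :: "'z measure \<Rightarrow> ('z \<Rightarrow> real) \<Rightarrow> real \<Rightarrow> ('z \<Rightarrow> real) set" where
  "L1_ball P g r = {h. L1_dist P g h \<le> r}"

definition is_covering ::
  "'z measure \<Rightarrow> ('z \<Rightarrow> real) set \<Rightarrow> real \<Rightarrow> nat \<Rightarrow> (nat \<Rightarrow> 'z \<Rightarrow> real) \<Rightarrow> bool" where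
  "is_covering P H \<epsilon> N h \<longleftrightarrow>
     (\<forall>j\<in>{1..N}. h j \<in> H) \<and> (\<forall>g\<in>H. \<exists>j\<in>{1..N}. L1_dist P g (h j) \<le> \<epsilon>)"

text \<open>The value is \<open>\<infinity>\<close> if there is no finite covering.\<close>

definition covering_number :: "'z measure \<Rightarrow> ('z \<Rightarrow> real) set \<Rightarrow> real \<Rightarrow> enat" where
  "covering_number P H \<epsilon> = Inf {enat N | N. \<exists>h. is_covering P H \<epsilon> N h}"

definition is_minimal_covering ::
  "'z measure \<Rightarrow> ('z \<Rightarrow> real) set \<Rightarrow> real \<Rightarrow> nat \<Rightarrow> (nat \<Rightarrow> 'z \<Rightarrow> real) \<Rightarrow> bool" where
  "is_minimal_covering P H \<epsilon> N h \<longleftrightarrow>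
     is_covering P H \<epsilon> N h \<and> enat N = covering_number P H \<epsilon>"

definition local_entropy ::
  "'z measure \<Rightarrow> ('z \<Rightarrow> real) set \<Rightarrow> real \<Rightarrow> real \<Rightarrow> real \<Rightarrow> ereal" where
  "local_entropy P G \<epsilon> \<beta> B =
     (SUP \<gamma>\<in>{\<epsilon>..}. SUP g\<in>G.
        tlog_enat (covering_number P (G \<inter> L1_ball P g (2 * B * rpow \<gamma> \<beta>)) \<gamma>))"

text \<open>For a totally bounded class the infimum is over a nonempty set of positive reals.\<close>

definition gamma_star ::
  "'z measure \<Rightarrow> ('z \<Rightarrow> real) set \<Rightarrow> real \<Rightarrow> real \<Rightarrow> real \<Rightarrow> real" where
  "gamma_star P G k \<beta> B =
     Inf {\<epsilon>. 0 < \<epsilon> \<and>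
       ereal k * local_entropy P G (B * rpow \<epsilon> (\<beta> / (2 - \<beta>))) 1 1 \<le> ereal \<epsilon>}"

definition L1_Bernstein :: "'z measure \<Rightarrow> ('z \<Rightarrow> real) set \<Rightarrow> real \<Rightarrow> real \<Rightarrow> bool" where
  "L1_Bernstein P G \<beta> B \<longleftrightarrow>
     (\<forall>g\<in>G. (\<integral>z. \<bar>g z\<bar> \<partial>P) \<le> B * rpow (\<integral>z. g z \<partial>P) \<beta>)"


section \<open>Distributions on \<open>\<real>\<^sup>d\<close>\<close>

text \<open>The dimension has to be quantified inside the main statement, since its constants do
  not depend on it. Points of \<open>\<real>\<^sup>d\<close> are therefore the elements of
  \<open>{..<d} \<rightarrow>\<^sub>E UNIV\<close>, and Lebesgue measure is a finite product.\<close>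

definition lebesgue_R :: "nat \<Rightarrow> (nat \<Rightarrow> real) measure" where
  "lebesgue_R d = Pi\<^sub>M {..<d} (\<lambda>_. lborel)"

definition log_concave_fun :: "nat \<Rightarrow> ((nat \<Rightarrow> real) \<Rightarrow> real) \<Rightarrow> bool" where
  "log_concave_fun d p \<longleftrightarrow>
     (\<forall>x\<in>space (lebesgue_R d). 0 \<le> p x) \<and>
     (\<forall>x\<in>space (lebesgue_R d). \<forall>y\<in>space (lebesgue_R d). \<forall>t\<in>{0<..<1}.
        p x powr (1 - t) * p y powr t \<le> p (\<lambda>i\<in>{..<d}. (1 - t) * x i + t * y i))"

definition log_concave_distribution :: "nat \<Rightarrow> (nat \<Rightarrow> real) measure \<Rightarrow> bool" where
  "log_concave_distribution d M \<longleftrightarrow>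
     prob_space M \<and>
     (\<exists>p \<in> borel_measurable (lebesgue_R d).
        log_concave_fun d p \<and> M = density (lebesgue_R d) (\<lambda>x. ennreal (p x)))"

definition zero_mean :: "nat \<Rightarrow> (nat \<Rightarrow> real) measure \<Rightarrow> bool" where
  "zero_mean d M \<longleftrightarrow> (\<forall>i<d. integrable M (\<lambda>x. x i) \<and> (\<integral>x. x i \<partial>M) = 0)"

text \<open>Identity second-moment matrix, which is the covariance matrix under \<open>zero_mean\<close>.\<close>

definition isotropic :: "nat \<Rightarrow> (nat \<Rightarrow> real) measure \<Rightarrow> bool" where
  "isotropic d M \<longleftrightarrow>
     (\<forall>i<d. \<forall>j<d. integrable M (\<lambda>x. x i * x j) \<and>
        (\<integral>x. x i * x j \<partial>M) = (if i = j then 1 else 0))"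


section \<open>Binary classification\<close>

type_synonym point = "nat \<Rightarrow> real"
type_synonym classifier = "point \<Rightarrow> int"
type_synonym labelled = "point \<times> int"

definition data_space :: "nat \<Rightarrow> labelled measure" where
  "data_space d = lebesgue_R d \<Otimes>\<^sub>M count_space {1, -1}"

definition marginal_X :: "nat \<Rightarrow> labelled measure \<Rightarrow> point measure" where
  "marginal_X d P = distr P (lebesgue_R d) fst"

definition halfspace :: "nat \<Rightarrow> (nat \<Rightarrow> real) \<Rightarrow> classifier" where
  "halfspace d w = (\<lambda>x. if 0 \<le> (\<Sum>i<d. w i * x i) then 1 else -1)"

definition homogeneous_halfspaces :: "nat \<Rightarrow> classifier set" where
  "homogeneous_halfspaces d = {halfspace d w | w. \<exists>i<d. w i \<noteq> 0}"

definition loss :: "classifier \<Rightarrow> labelled \<Rightarrow> real" where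
  "loss f = (\<lambda>(x, y). of_bool (f x \<noteq> y))"

definition excess_loss :: "classifier \<Rightarrow> classifier \<Rightarrow> labelled \<Rightarrow> real" where
  "excess_loss fstar f = (\<lambda>z. loss f z - loss fstar z)"

definition loss_class :: "classifier set \<Rightarrow> (labelled \<Rightarrow> real) set" where
  "loss_class F = loss ` F"

definition excess_loss_class :: "classifier set \<Rightarrow> classifier \<Rightarrow> (labelled \<Rightarrow> real) set" where
  "excess_loss_class F fstar = excess_loss fstar ` F"

definition risk :: "labelled measure \<Rightarrow> classifier \<Rightarrow> real" where
  "risk P f = measure P {z \<in> space P. f (fst z) \<noteq> snd z}"

definition iid_sample :: "nat \<Rightarrow> labelled measure \<Rightarrow> (nat \<Rightarrow> labelled) measure" where
  "iid_sample n P = Pi\<^sub>M {..<n} (\<lambda>_. P)"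

definition emp_risk :: "nat \<Rightarrow> (nat \<Rightarrow> labelled) \<Rightarrow> classifier \<Rightarrow> real" where
  "emp_risk n s f = (\<Sum>i<n. loss f (s i)) / real n"

end

theory Submission
  imports Defs
begin

text \<open>For an isotropic log-concave marginal the disagreement of two halfspaces is comparable, with absolute
  constants, to the distance of their unit normals. Only two-dimensional marginals matter: by
  Prekopa--Leindler they satisfy a Brunn--Minkowski inequality, the superlevel sets of the mass of a
  translated small rectangle are convex and meet every half plane at a fixed distance from the origin
  (because a standardised log-concave variable exceeds a constant with constant probability), so the
  rectangle mass is bounded below near the origin; averaging midpoints of the origin's neighbourhood with
  a far point then bounds it above by the inverse fourth power of the distance. Double cones of opening
  \<open>s\<close> hence have mass of order \<open>s\<close>.

  Local covering numbers are therefore \<open>e\<^sup>O\<^sup>(\<^sup>d\<^sup>)\<close>, which bounds \<open>\<gamma>\<^sup>*\<close> by a multiple of \<open>Bd/n\<close>. Minimality of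
  the net bounds the number of its points in a ball by a local covering number. Above the scale
  \<open>BQ\<close> to the power \<open>\<beta>/(2-\<beta>)\<close> that number is controlled by the defining inequality of \<open>\<gamma>\<^sup>*\<close>, not by \<open>d\<close>; this is what
  avoids a factor \<open>log d\<close>. The rest is a Chernoff bound on shells of excess risk around \<open>f\<^sub>\<eta>\<close>.
  Taking \<open>a = b \<le> c\<^sub>0/2\<close> makes the excess risk of \<open>f\<^sub>\<eta>\<close> small uniformly in \<open>\<beta>\<close>, and rules out \<open>\<beta> = 0\<close>.\<close>

section \<open>The Prekopa--Leindler inequality\<close>

text \<open>Rectangle masses stand in for densities because log-concavity of a planar marginal is
  used only as an inequality between masses of sets. The bounds must be uniform in the ratio of the
  sides: a cone of opening \<open>s\<close> is exhausted by rectangles of width proportional to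
  \<open>s\<close> and fixed height. How log d disappears: put
  \<open>Q' = B d / n + B log(1/\<delta>) / n\<close>. Since \<open>Q\<close> may be far below
  \<open>Q'\<close>, the ball around the first shell may exceed the scale of \<open>Q\<close> by a
  factor of order \<open>Q' / Q\<close>. Each halving of the radius down to that scale costs
  \<open>n Q / B\<close> in the log-count, and \<open>Q' / Q + 1\<close> extra halvings suffice, so
  they cost about \<open>n Q' / B = d + log(1/\<delta>)\<close>, the order of the Chernoff exponent.
  Charging a multiple of d per halving would leave the logarithm. Only the last step, from that
  scale to \<open>\<eta>\<close>, is charged to d, and its ratio \<open>1 / a\<close> is constant.
  The estimator sees only the net, so it is compared with \<open>f_\<eta>\<close>, not with
  \<open>f*\<close>. The Bernstein condition bounds excess risk only from below; the reverse
  inequality gives the upper bound \<open>(a / c0)^(1/\<beta>) Q^(1/(2-\<beta>))\<close> for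
  \<open>f_\<eta>\<close>, whose factor blows up as \<beta> tends to 0 when
  \<open>a > c0\<close>.\<close>

lemma brunn_minkowski_line_bounded:
  fixes A B C :: "real set"
  assumes t: "0 < t" "t < 1"
    and A: "A \<in> sets borel" "A \<noteq> {}" "A \<subseteq> {-n..n}"
    and B: "B \<in> sets borel" "B \<noteq> {}" "B \<subseteq> {-n..n}"
    and C: "C \<in> sets borel" "\<And>x y. x \<in> A \<Longrightarrow> y \<in> B \<Longrightarrow> (1 - t) * x + t * y \<in> C"
  shows "(1 - t) * measure lborel A + t * measure lborel B \<le> emeasure lborel C"
proof (rule ennreal_le_epsilon)
  fix e :: real assume e: "e > 0"
  have bA: "bdd_above A" using A(3) by (meson bdd_above_Icc bdd_above_mono)
  have bB: "bdd_below B" using B(3) by (meson bdd_below_Icc bdd_below_mono)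
  obtain a0 where a0: "a0 \<in> A" "Sup A - e < a0"
    using less_cSupD[of A "Sup A - e"] A(2) e by auto
  obtain b0 where b0: "b0 \<in> B" "b0 < Inf B + e"
    using cInf_lessD[of B "Inf B + e"] B(2) e by auto
  have Asup: "x \<le> Sup A" if "x \<in> A" for x using cSup_upper[OF that bA] .
  have Binf: "Inf B \<le> x" if "x \<in> B" for x using cInf_lower[OF that bB] .
  \<comment> \<open>Were \<open>a0 = Sup A\<close> and \<open>b0 = Inf B\<close>, the sets
    \<open>(1 - t) A + t b0\<close> and \<open>(1 - t) a0 + t B\<close> would lie in
    \<open>C\<close> on the two sides of \<open>(1 - t) a0 + t b0\<close>, so their lengths would
    add. The extremes need not be attained, hence the trimming, at a cost of \<open>e\<close> per
    set; \<open>B'\<close> omits \<open>b0\<close> to make the pieces disjoint.\<close>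
  define A' where "A' = A \<inter> {..a0}"
  define B' where "B' = B \<inter> {b0<..}"
  have fin[simp]: "X \<in> sets borel \<Longrightarrow> X \<subseteq> {-n..n} \<Longrightarrow> X \<in> fmeasurable lborel" for X
    by (rule fmeasurableI2[of "{-n..n}"]) (auto simp: fmeasurable_def emeasure_lborel_Icc_eq)
  have mA': "A' \<in> sets borel" "A' \<subseteq> {-n..n}" using A by (auto simp: A'_def)
  have mB': "B' \<in> sets borel" "B' \<subseteq> {-n..n}" using B by (auto simp: B'_def)
  have "measure lborel A \<le> measure lborel (A' \<union> {a0..a0+e})"
    using A a0 Asup mA' by (intro measure_mono_fmeasurable fmeasurable.Un fmeasurable_cbox[of a0 "a0+e", simplified])
      (fastforce simp: A'_def)+
  also have "\<dots> \<le> measure lborel A' + measure lborel {a0..a0+e}"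
    using mA' by (intro measure_Un_le) auto
  finally have lA: "measure lborel A \<le> measure lborel A' + e" using e by simp
  have "measure lborel B \<le> measure lborel (B' \<union> {b0-e..b0})"
    using B b0 Binf mB' by (intro measure_mono_fmeasurable fmeasurable.Un fmeasurable_cbox[of "b0-e" "b0", simplified])
      (fastforce simp: B'_def)+
  also have "\<dots> \<le> measure lborel B' + measure lborel {b0-e..b0}"
    using mB' by (intro measure_Un_le) auto
  finally have lB: "measure lborel B \<le> measure lborel B' + e" using e by simp
  \<comment> \<open>\<open>f\<close> and \<open>g\<close> invert the two affine maps, so the
    translated pieces appear as preimages and are measurable at once.\<close>
  define f where "f = (\<lambda>x. (x - t * b0) / (1 - t))"
  define g where "g = (\<lambda>y. (y - (1 - t) * a0) / t)"
  have fg[measurable]: "f \<in> borel_measurable borel" "g \<in> borel_measurable borel"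
    unfolding f_def g_def by measurable
  have eA: "emeasure lborel (f -` A') = ennreal ((1 - t) * measure lborel A')"
  proof -
    have "emeasure lborel (f -` A') = ennreal \<bar>1 - t\<bar> * emeasure lborel A'"
    proof -
      have "lborel = density (distr lborel borel (\<lambda>x. t * b0 + (1 - t) * x)) (\<lambda>_. \<bar>1 - t\<bar>)"
        using lborel_real_affine[of "1 - t" "t * b0"] t by (simp add: abs_mult)
      then have "emeasure lborel (f -` A') = emeasure (density (distr lborel borel (\<lambda>x. t * b0 + (1 - t) * x)) (\<lambda>_. \<bar>1 - t\<bar>)) (f -` A')" by simp
      also have "\<dots> = \<bar>1 - t\<bar> * emeasure (distr lborel borel (\<lambda>x. t * b0 + (1 - t) * x)) (f -` A')"
        using measurable_sets[OF fg(1) mA'(1)] by (subst emeasure_density_const) auto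
      also have "emeasure (distr lborel borel (\<lambda>x. t * b0 + (1 - t) * x)) (f -` A') = emeasure lborel ((\<lambda>x. t * b0 + (1 - t) * x) -` f -` A')"
        using measurable_sets[OF fg(1) mA'(1)] by (subst emeasure_distr) auto
      also have "(\<lambda>x. t * b0 + (1 - t) * x) -` f -` A' = A'" using t by (auto simp: f_def)
      finally show ?thesis .
    qed
    then show ?thesis using t emeasure_eq_measure2[OF fin[OF mA']] by (simp only: ennreal_mult abs_of_pos diff_gt_0_iff_gt measure_nonneg less_imp_le)
  qed
  have eB: "emeasure lborel (g -` B') = ennreal (t * measure lborel B')"
  proof -
    have "emeasure lborel (g -` B') = ennreal \<bar>t\<bar> * emeasure lborel B'"
    proof -
      have "lborel = density (distr lborel borel (\<lambda>x. (1 - t) * a0 + t * x)) (\<lambda>_. \<bar>t\<bar>)"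
        using lborel_real_affine[of "t" "(1 - t) * a0"] t by (simp add: abs_mult)
      then have "emeasure lborel (g -` B') = emeasure (density (distr lborel borel (\<lambda>x. (1 - t) * a0 + t * x)) (\<lambda>_. \<bar>t\<bar>)) (g -` B')" by simp
      also have "\<dots> = \<bar>t\<bar> * emeasure (distr lborel borel (\<lambda>x. (1 - t) * a0 + t * x)) (g -` B')"
        using measurable_sets[OF fg(2) mB'(1)] by (subst emeasure_density_const) auto
      also have "emeasure (distr lborel borel (\<lambda>x. (1 - t) * a0 + t * x)) (g -` B') = emeasure lborel ((\<lambda>x. (1 - t) * a0 + t * x) -` g -` B')"
        using measurable_sets[OF fg(2) mB'(1)] by (subst emeasure_distr) auto
      also have "(\<lambda>x. (1 - t) * a0 + t * x) -` g -` B' = B'" using t by (auto simp: g_def)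
      finally show ?thesis .
    qed
    then show ?thesis using t emeasure_eq_measure2[OF fin[OF mB']] by (simp only: ennreal_mult abs_of_pos measure_nonneg less_imp_le)
  qed
  have sA: "f -` A' \<in> sets borel" using measurable_sets[OF fg(1) mA'(1)] by simp
  have sB: "g -` B' \<in> sets borel" using measurable_sets[OF fg(2) mB'(1)] by simp
  have sub: "f -` A' \<subseteq> C" "g -` B' \<subseteq> C"
  proof -
    show "f -` A' \<subseteq> C" using C(2)[OF _ b0(1), of "f x" for x] t by (auto simp: A'_def f_def)
    show "g -` B' \<subseteq> C" using C(2)[OF a0(1), of "g x" for x] t by (auto simp: B'_def g_def)
  qed
  have disj: "f -` A' \<inter> g -` B' = {}"
    using t by (auto simp: A'_def B'_def f_def g_def field_simps)
  have "ennreal ((1 - t) * measure lborel A' + t * measure lborel B') = emeasure lborel (f -` A' \<union> g -` B')"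
    using sA sB disj t eA eB by (subst plus_emeasure[symmetric]) (auto simp: ennreal_plus)
  also have "\<dots> \<le> emeasure lborel C" using sub C by (intro emeasure_mono) auto
  finally have *: "ennreal ((1 - t) * measure lborel A' + t * measure lborel B') \<le> emeasure lborel C" .
  have "(1 - t) * measure lborel A + t * measure lborel B \<le> (1 - t) * (measure lborel A' + e) + t * (measure lborel B' + e)"
    using t lA lB by (intro add_mono mult_left_mono) auto
  also have "\<dots> = ((1 - t) * measure lborel A' + t * measure lborel B') + e" by (simp add: algebra_simps)
  finally have "ennreal ((1 - t) * measure lborel A + t * measure lborel B)
      \<le> ennreal (((1 - t) * measure lborel A' + t * measure lborel B') + e)" by (rule ennreal_leI)
  also have "\<dots> = ennreal ((1 - t) * measure lborel A' + t * measure lborel B') + ennreal e"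
    using t e by (intro ennreal_plus) auto
  also have "\<dots> \<le> emeasure lborel C + e" using * by (intro add_mono) auto
  finally show "ennreal ((1 - t) * measure lborel A + t * measure lborel B) \<le> emeasure lborel C + ennreal e" .
qed

lemma brunn_minkowski_line:
  fixes A B C :: "real set"
  assumes t: "0 < t" "t < 1"
    and A: "A \<in> sets borel" "A \<noteq> {}"
    and B: "B \<in> sets borel" "B \<noteq> {}"
    and C: "C \<in> sets borel" "\<And>x y. x \<in> A \<Longrightarrow> y \<in> B \<Longrightarrow> (1 - t) * x + t * y \<in> C"
  shows "ennreal (1 - t) * emeasure lborel A + ennreal t * emeasure lborel B \<le> emeasure lborel C"
proof -
  obtain x y where xy: "x \<in> A" "y \<in> B" using A B by blast
  have lim: "(\<lambda>n. emeasure lborel (X \<inter> {-real n..real n})) \<longlonglongrightarrow> emeasure lborel X" if "X \<in> sets borel" for X :: "real set"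
  proof -
    have "(\<Union>n. X \<inter> {-real n..real n}) = X"
    proof -
      have "\<exists>n. - real n \<le> x \<and> x \<le> real n" for x
        using real_arch_simple[of "\<bar>x\<bar>"] by (metis abs_le_D1 abs_le_D2 minus_le_iff)
      then show ?thesis by fastforce
    qed
    moreover have "(\<lambda>n. emeasure lborel (X \<inter> {-real n..real n})) \<longlonglongrightarrow> emeasure lborel (\<Union>n. X \<inter> {-real n..real n})"
      using that by (intro Lim_emeasure_incseq) (auto simp: incseq_def)
    ultimately show ?thesis by simp
  qed
  have l: "(\<lambda>n. ennreal (1 - t) * emeasure lborel (A \<inter> {-real n..real n}) + ennreal t * emeasure lborel (B \<inter> {-real n..real n}))
     \<longlonglongrightarrow> ennreal (1 - t) * emeasure lborel A + ennreal t * emeasure lborel B"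
    using A B by (intro tendsto_add ennreal_tendsto_cmult lim) auto
  \<comment> \<open>The bounded case needs both truncated sets nonempty, which holds once the
    interval contains \<open>x\<close> and \<open>y\<close>.\<close>
  obtain n0 where n0: "\<bar>x\<bar> + \<bar>y\<bar> \<le> real n0" using real_arch_simple by blast
  show ?thesis
  proof (rule LIMSEQ_le_const2[OF l], intro exI[of _ n0] allI impI)
    fix n assume n: "n \<ge> n0"
    have fin: "emeasure lborel (X \<inter> {-real n..real n}) = ennreal (measure lborel (X \<inter> {-real n..real n}))" if "X \<in> sets borel" for X
    proof -
      have "emeasure lborel (X \<inter> {-real n..real n}) \<le> emeasure lborel {-real n..real n}" using that by (intro emeasure_mono) auto
      also have "\<dots> < \<infinity>" by (auto simp: emeasure_lborel_Icc_eq)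
      finally show ?thesis by (simp add: emeasure_eq_ennreal_measure)
    qed
    have "(1 - t) * measure lborel (A \<inter> {-real n..real n}) + t * measure lborel (B \<inter> {-real n..real n}) \<le> emeasure lborel C"
    proof (rule brunn_minkowski_line_bounded[where n="real n"])
      have "x \<in> A \<inter> {-real n..real n}" "y \<in> B \<inter> {-real n..real n}" using xy n0 n by auto
      then show "A \<inter> {-real n..real n} \<noteq> {}" "B \<inter> {-real n..real n} \<noteq> {}" by auto
    qed (use A B C t in auto)
    then show "ennreal (1 - t) * emeasure lborel (A \<inter> {-real n..real n}) + ennreal t * emeasure lborel (B \<inter> {-real n..real n}) \<le> emeasure lborel C"
      using t by (simp add: fin A B ennreal_mult ennreal_plus)
  qed
qed

section \<open>From level sets to the functional inequality\<close>

lemma nn_integral_layer_cake: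
  fixes f :: "'a \<Rightarrow> real"
  assumes M: "sigma_finite_measure M" and f[measurable]: "f \<in> borel_measurable M" and "\<And>x. x \<in> space M \<Longrightarrow> 0 \<le> f x"
  shows "(\<integral>\<^sup>+x. ennreal (f x) \<partial>M) = (\<integral>\<^sup>+s. indicator {0<..} s * emeasure M {x \<in> space M. s < f x} \<partial>lborel)"
proof -
  interpret M: sigma_finite_measure M by fact
  interpret pair_sigma_finite lborel M ..
  have "(\<integral>\<^sup>+x. ennreal (f x) \<partial>M) = (\<integral>\<^sup>+x. (\<integral>\<^sup>+s. indicator {0<..<f x} s \<partial>lborel) \<partial>M)"
    using assms(3) by (intro nn_integral_cong) (simp)
  also have "\<dots> = (\<integral>\<^sup>+s. (\<integral>\<^sup>+x. indicator {0<..<f x} s \<partial>M) \<partial>lborel)"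
    by (rule Fubini'[of "\<lambda>s x. indicator {0<..<f x} s"]) (simp add: indicator_def, measurable)
  also have "\<dots> = (\<integral>\<^sup>+s. indicator {0<..} s * emeasure M {x \<in> space M. s < f x} \<partial>lborel)"
  proof (intro nn_integral_cong)
    fix s :: real
    have "(\<integral>\<^sup>+x. indicator {0<..<f x} s \<partial>M) = (\<integral>\<^sup>+x. indicator {0<..} s * indicator {x \<in> space M. s < f x} x \<partial>M)"
      by (intro nn_integral_cong) (auto simp: indicator_def)
    also have "\<dots> = indicator {0<..} s * emeasure M {x \<in> space M. s < f x}"
      by (subst nn_integral_cmult) auto
    finally show "(\<integral>\<^sup>+x. indicator {0<..<f x} s \<partial>M) = indicator {0<..} s * emeasure M {x \<in> space M. s < f x}" .
  qed
  finally show ?thesis .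
qed

lemma weighted_am_gm:
  fixes u v t :: real
  assumes "0 < t" "t < 1" "0 < u" "0 < v"
  shows "u powr (1 - t) * v powr t \<le> (1 - t) * u + t * v"
  using Youngs_inequality_0[of "1 - t" t u v] assms by simp

text \<open>The relation \<open>w \<ge> u\<^sup>1\<^sup>-\<^sup>t v\<^sup>t\<close> on extended reals, in a form that avoids powers of \<open>\<infinity>\<close>.\<close>

definition dominates_geo_mean :: "real \<Rightarrow> ennreal \<Rightarrow> ennreal \<Rightarrow> ennreal \<Rightarrow> bool" where
  "dominates_geo_mean t u v w \<longleftrightarrow>
    (\<forall>a>0. \<forall>b>0. ennreal a \<le> u \<longrightarrow> ennreal b \<le> v \<longrightarrow> ennreal (a powr (1 - t) * b powr t) \<le> w)"

text \<open>Truncating an unbounded integrand needs a number strictly below the integral. Shrinking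
  \<open>a\<close> and \<open>b\<close> by a factor \<open>c\<close> and letting \<open>c\<close>
  tend to 1 from the left recovers the non-strict relation.\<close>

lemma dominates_geo_mean_strict:
  assumes t: "0 < t" "t < 1"
    and "\<And>a b. 0 < a \<Longrightarrow> 0 < b \<Longrightarrow> ennreal a < u \<Longrightarrow> ennreal b < v \<Longrightarrow> ennreal (a powr (1 - t) * b powr t) \<le> w"
  shows "dominates_geo_mean t u v w"
  unfolding dominates_geo_mean_def
proof (intro allI impI)
  fix a b :: real assume ab: "a > 0" "b > 0" "ennreal a \<le> u" "ennreal b \<le> v"
  have "((\<lambda>c. ennreal ((c * a) powr (1 - t) * (c * b) powr t)) \<longlongrightarrow> ennreal ((1 * a) powr (1 - t) * (1 * b) powr t)) (at_left 1)"
    using ab by (intro tendsto_intros) auto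
  then have "ennreal ((1 * a) powr (1 - t) * (1 * b) powr t) \<le> w"
  proof (rule tendsto_upperbound)
    show "\<forall>\<^sub>F c in at_left 1. ennreal ((c * a) powr (1 - t) * (c * b) powr t) \<le> w"
      unfolding eventually_at_left[OF zero_less_one]
    proof (intro exI[of _ 0] conjI allI impI)
      fix c :: real assume c: "0 < c" "c < 1"
      have "ennreal (c * a) < u" using ab c by (intro less_le_trans[OF _ ab(3)]) (simp add: ennreal_lessI)
      moreover have "ennreal (c * b) < v" using ab c by (intro less_le_trans[OF _ ab(4)]) (simp add: ennreal_lessI)
      ultimately show "ennreal ((c * a) powr (1 - t) * (c * b) powr t) \<le> w" using ab c by (intro assms(3)) auto
    qed simp
  qed simp
  then show "ennreal (a powr (1 - t) * b powr t) \<le> w" by simp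
qed

lemma nn_integral_less_truncate:
  fixes f :: "'a \<Rightarrow> ennreal"
  assumes [measurable]: "f \<in> borel_measurable M" and "c < (\<integral>\<^sup>+x. f x \<partial>M)"
  shows "\<exists>n::nat. c < (\<integral>\<^sup>+x. min (f x) (of_nat n) \<partial>M)"
proof -
  have "(SUP n::nat. min (f x) (of_nat n)) = f x" for x
  proof -
    have "(SUP n::nat. min (f x) (of_nat n)) = min (f x) (SUP n::nat. of_nat n)"
      by (simp add: inf_min[symmetric] inf_SUP)
    then show ?thesis by (simp add: ennreal_SUP_of_nat_eq_top)
  qed
  then have "(\<integral>\<^sup>+x. f x \<partial>M) = (\<integral>\<^sup>+x. (SUP n::nat. min (f x) (of_nat n)) \<partial>M)" by simp
  also have "\<dots> = (SUP n::nat. \<integral>\<^sup>+x. min (f x) (of_nat n) \<partial>M)"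
    by (intro nn_integral_monotone_convergence_SUP) (auto simp: incseq_def le_fun_def min_le_iff_disj intro: order_trans)
  finally show ?thesis using assms(2) by (auto simp: less_SUP_iff)
qed

text \<open>Brunn--Minkowski applies to level sets only if both are nonempty. Truncating
  \<open>f\<close> and \<open>g\<close> and dividing by the suprema \<open>F\<close> and
  \<open>G\<close> ensures this for every level in (0,1). Integrating over the level gives an
  arithmetic mean, which AM-GM turns into the geometric mean after rescaling.\<close>

lemma prekopa_leindler_line:
  fixes f g h :: "real \<Rightarrow> ennreal"
  assumes t: "0 < t" "t < 1"
    and [measurable]: "f \<in> borel_measurable borel" "g \<in> borel_measurable borel" "h \<in> borel_measurable borel"
    and dom: "\<And>x y. dominates_geo_mean t (f x) (g y) (h ((1 - t) * x + t * y))"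
  shows "dominates_geo_mean t (\<integral>\<^sup>+x. f x \<partial>lborel) (\<integral>\<^sup>+x. g x \<partial>lborel) (\<integral>\<^sup>+x. h x \<partial>lborel)"
proof (rule dominates_geo_mean_strict[OF t])
  fix a b :: real
  assume ab: "0 < a" "0 < b" "ennreal a < (\<integral>\<^sup>+x. f x \<partial>lborel)" "ennreal b < (\<integral>\<^sup>+x. g x \<partial>lborel)"
  have norm: "\<exists>u F. F > 0 \<and> u \<in> borel_measurable borel \<and> (\<forall>x. 0 \<le> u x \<and> u x \<le> 1 \<and> ennreal (F * u x) \<le> k x)
      \<and> (\<forall>s<1. \<exists>x. s < u x) \<and> ennreal (c / F) \<le> (\<integral>\<^sup>+x. ennreal (u x) \<partial>lborel)"
    if [measurable]: "k \<in> borel_measurable borel" and c: "0 < c" "ennreal c < (\<integral>\<^sup>+x. k x \<partial>lborel)" for k :: "real \<Rightarrow> ennreal" and c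
  proof -
    obtain n :: nat where n: "ennreal c < (\<integral>\<^sup>+x. min (k x) (of_nat n) \<partial>lborel)"
      using nn_integral_less_truncate[of k lborel "ennreal c"] c by auto
    define v where "v = (\<lambda>x. enn2real (min (k x) (of_nat n)))"
    have v: "ennreal (v x) = min (k x) (of_nat n)" for x
      unfolding v_def by (rule ennreal_enn2real) (simp add: min_less_iff_disj of_nat_less_top)
    have [measurable]: "v \<in> borel_measurable borel" unfolding v_def by measurable
    have v0: "0 \<le> v x" for x by (simp add: v_def)
    have vn: "v x \<le> real n" for x
    proof -
      have "ennreal (v x) \<le> ennreal (real n)" unfolding v by (simp add: ennreal_of_nat_eq_real_of_nat)
      then show ?thesis by (simp add: ennreal_le_iff)
    qed
    have bdd: "bdd_above (range v)" using vn by (auto intro!: bdd_aboveI)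
    define F where "F = Sup (range v)"
    have vF: "v x \<le> F" for x unfolding F_def using bdd by (intro cSup_upper) auto
    have "F > 0"
    proof (rule ccontr)
      assume "\<not> F > 0"
      then have "v x = 0" for x using v0[of x] vF[of x] by linarith
      then have "min (k x) (of_nat n) = 0" for x using v[of x] by simp
      then show False using n by simp
    qed
    show ?thesis
    proof (rule exI[of _ "\<lambda>x. v x / F"], rule exI[of _ F], intro conjI allI impI)
      show "ennreal (F * (v x / F)) \<le> k x" for x using \<open>F > 0\<close> v[of x] by simp
      show "\<exists>x. s < v x / F" if "s < 1" for s
      proof -
        have "s * F < F" using that \<open>F > 0\<close> by simp
        then have "\<exists>y\<in>range v. s * F < y" unfolding F_def by (intro less_cSupD) (auto simp: F_def)
        then show ?thesis using \<open>F > 0\<close> by (auto simp: field_simps)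
      qed
      have "ennreal (c / F) \<le> ennreal (1 / F) * ennreal c"
        using c \<open>F > 0\<close> by (simp add: ennreal_mult[symmetric])
      also have "\<dots> \<le> ennreal (1 / F) * (\<integral>\<^sup>+x. ennreal (v x) \<partial>lborel)"
        using n by (intro mult_left_mono) (auto simp: v)
      also have "\<dots> = (\<integral>\<^sup>+x. ennreal (1 / F) * ennreal (v x) \<partial>lborel)" by (subst nn_integral_cmult) auto
      also have "\<dots> = (\<integral>\<^sup>+x. ennreal (v x / F) \<partial>lborel)"
        using \<open>F > 0\<close> v0 by (intro nn_integral_cong) (simp add: ennreal_mult[symmetric])
      finally show "ennreal (c / F) \<le> (\<integral>\<^sup>+x. ennreal (v x / F) \<partial>lborel)" .
    qed (use \<open>F > 0\<close> v0 vF in auto)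
  qed
  obtain u F where F: "F > 0" and [measurable]: "u \<in> borel_measurable borel"
    and u: "\<And>x. 0 \<le> u x" "\<And>x. u x \<le> 1" "\<And>x. ennreal (F * u x) \<le> f x"
      "\<And>s. s < 1 \<Longrightarrow> \<exists>x. s < u x" "ennreal (a / F) \<le> (\<integral>\<^sup>+x. ennreal (u x) \<partial>lborel)"
    using norm[of f a] ab by auto
  obtain v G where G: "G > 0" and [measurable]: "v \<in> borel_measurable borel"
    and v: "\<And>x. 0 \<le> v x" "\<And>x. v x \<le> 1" "\<And>x. ennreal (G * v x) \<le> g x"
      "\<And>s. s < 1 \<Longrightarrow> \<exists>x. s < v x" "ennreal (b / G) \<le> (\<integral>\<^sup>+x. ennreal (v x) \<partial>lborel)"
    using norm[of g b] ab by auto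
  \<comment> \<open>If \<open>u\<close> and \<open>v\<close> exceed the level \<open>s\<close>, then
    \<open>h\<close> reaches \<open>H * s\<close>: the exponents \<open>1 - t\<close> and
    \<open>t\<close> of \<open>s\<close> add up to 1.\<close>
  define H where "H = F powr (1 - t) * G powr t"
  have H: "H > 0" using F G by (simp add: H_def)
  define C where "C = (\<lambda>s. {z. ennreal (H * s) \<le> h z})"
  have layer: "(\<integral>\<^sup>+x. ennreal (w x) \<partial>lborel) = (\<integral>\<^sup>+s. indicator {0<..<1} s * emeasure lborel {x. s < w x} \<partial>lborel)"
    if [measurable]: "w \<in> borel_measurable borel" and w: "\<And>x. 0 \<le> w x" "\<And>x. w x \<le> 1" for w :: "real \<Rightarrow> real"
  proof -
    have "{x. s < w x} = {}" if "s \<ge> 1" for s using that w(2) by (auto simp: not_less intro: order_trans)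
    then show ?thesis
      using w by (subst nn_integral_layer_cake) (auto intro!: nn_integral_cong lborel.sigma_finite_measure_axioms simp: indicator_def)
  qed
  have bm: "ennreal (1 - t) * emeasure lborel {x. s < u x} + ennreal t * emeasure lborel {x. s < v x} \<le> emeasure lborel (C s)"
    if s: "0 < s" "s < 1" for s
  proof (rule brunn_minkowski_line[OF t])
    show "{x. s < u x} \<in> sets borel" "{x. s < v x} \<in> sets borel" "C s \<in> sets borel" unfolding C_def by measurable
    show "{x. s < u x} \<noteq> {}" "{x. s < v x} \<noteq> {}" using u(4) v(4) s by auto
    fix x y assume "x \<in> {x. s < u x}" "y \<in> {x. s < v x}"
    then have xy: "s < u x" "s < v y" by auto
    have 1: "ennreal (F * s) \<le> f x" by (rule order_trans[OF _ u(3)]) (use F xy in \<open>auto intro!: ennreal_leI\<close>)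
    have 2: "ennreal (G * s) \<le> g y" by (rule order_trans[OF _ v(3)]) (use G xy in \<open>auto intro!: ennreal_leI\<close>)
    have "ennreal ((F * s) powr (1 - t) * (G * s) powr t) \<le> h ((1 - t) * x + t * y)"
      using dom[of x y] 1 2 F G s unfolding dominates_geo_mean_def by simp
    moreover have "(F * s) powr (1 - t) * (G * s) powr t = H * s"
      using F G s by (simp add: H_def powr_mult powr_add[symmetric] mult_ac)
    ultimately show "(1 - t) * x + t * y \<in> C s" by (simp add: C_def)
  qed
  have "ennreal ((1 - t) * (a / F) + t * (b / G)) = ennreal (1 - t) * ennreal (a / F) + ennreal t * ennreal (b / G)"
    using t ab F G by (simp add: ennreal_mult[symmetric])
  also have "\<dots> \<le> ennreal (1 - t) * (\<integral>\<^sup>+x. ennreal (u x) \<partial>lborel) + ennreal t * (\<integral>\<^sup>+x. ennreal (v x) \<partial>lborel)"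
    using u(5) v(5) by (intro add_mono mult_left_mono) auto
  also have "\<dots> = (\<integral>\<^sup>+s. ennreal (1 - t) * (indicator {0<..<1} s * emeasure lborel {x. s < u x})
      + ennreal t * (indicator {0<..<1} s * emeasure lborel {x. s < v x}) \<partial>lborel)"
    using u v by (simp add: layer nn_integral_add nn_integral_cmult)
  also have "\<dots> \<le> (\<integral>\<^sup>+s. indicator {0<..<1} s * emeasure lborel (C s) \<partial>lborel)"
    using bm by (intro nn_integral_mono) (auto simp: indicator_def)
  also have "\<dots> = (\<integral>\<^sup>+s. (\<integral>\<^sup>+z. indicator {0<..<1} s * indicator (C s) z \<partial>lborel) \<partial>lborel)"
    by (intro nn_integral_cong, subst nn_integral_cmult) (auto simp: C_def)
  also have "\<dots> = (\<integral>\<^sup>+z. (\<integral>\<^sup>+s. indicator {0<..<1} s * indicator (C s) z \<partial>lborel) \<partial>lborel)"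
    by (rule lborel_pair.Fubini') (simp add: indicator_def C_def, measurable)
  also have "\<dots> \<le> (\<integral>\<^sup>+z. ennreal (1 / H) * h z \<partial>lborel)"
  proof (intro nn_integral_mono)
    fix z :: real
    show "(\<integral>\<^sup>+s. indicator {0<..<1} s * indicator (C s) z \<partial>lborel) \<le> ennreal (1 / H) * h z"
    proof (cases "h z")
      case (real r)
      have "(\<integral>\<^sup>+s. indicator {0<..<1} s * indicator (C s) z \<partial>lborel) \<le> (\<integral>\<^sup>+s. indicator {0..r / H} s \<partial>lborel)"
        using H real by (intro nn_integral_mono) (auto simp: indicator_def C_def ennreal_le_iff field_simps)
      also have "\<dots> = ennreal (r / H)" using H real by simp
      finally show ?thesis using H real by (simp add: ennreal_mult[symmetric])
    qed (use H in \<open>simp add: ennreal_mult_top\<close>)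
  qed
  also have "\<dots> = ennreal (1 / H) * (\<integral>\<^sup>+z. h z \<partial>lborel)" by (subst nn_integral_cmult) auto
  finally have *: "ennreal ((1 - t) * (a / F) + t * (b / G)) \<le> ennreal (1 / H) * (\<integral>\<^sup>+z. h z \<partial>lborel)" .
  have "a powr (1 - t) * b powr t = H * ((a / F) powr (1 - t) * (b / G) powr t)"
    using ab F G by (simp add: H_def powr_divide)
  also have "\<dots> \<le> H * ((1 - t) * (a / F) + t * (b / G))"
    using H ab F G t by (intro mult_left_mono weighted_am_gm) auto
  finally have "ennreal (a powr (1 - t) * b powr t) \<le> ennreal H * ennreal ((1 - t) * (a / F) + t * (b / G))"
    using H t ab F G by (subst ennreal_mult[symmetric]) (auto intro!: ennreal_leI)
  also have "\<dots> \<le> ennreal H * (ennreal (1 / H) * (\<integral>\<^sup>+z. h z \<partial>lborel))" using * by (intro mult_left_mono) auto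
  also have "\<dots> = (\<integral>\<^sup>+z. h z \<partial>lborel)" using H by (simp add: mult.assoc[symmetric] ennreal_mult[symmetric])
  finally show "ennreal (a powr (1 - t) * b powr t) \<le> (\<integral>\<^sup>+z. h z \<partial>lborel)" .
qed

text \<open>The relation has the same shape for integrands and for integrals, so coordinates are
  integrated out one at a time: the line case makes the inner integrals satisfy the hypothesis in
  one dimension less.\<close>

lemma prekopa_leindler_PiM:
  fixes f g h :: "('i \<Rightarrow> real) \<Rightarrow> ennreal"
  assumes t: "0 < t" "t < 1" and "finite I"
    and "f \<in> borel_measurable (Pi\<^sub>M I (\<lambda>_. lborel))" "g \<in> borel_measurable (Pi\<^sub>M I (\<lambda>_. lborel))" "h \<in> borel_measurable (Pi\<^sub>M I (\<lambda>_. lborel))"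
    and "\<And>x y. x \<in> space (Pi\<^sub>M I (\<lambda>_. lborel)) \<Longrightarrow> y \<in> space (Pi\<^sub>M I (\<lambda>_. lborel)) \<Longrightarrow>
      dominates_geo_mean t (f x) (g y) (h (\<lambda>i\<in>I. (1 - t) * x i + t * y i))"
  shows "dominates_geo_mean t (\<integral>\<^sup>+x. f x \<partial>Pi\<^sub>M I (\<lambda>_. lborel)) (\<integral>\<^sup>+x. g x \<partial>Pi\<^sub>M I (\<lambda>_. lborel)) (\<integral>\<^sup>+x. h x \<partial>Pi\<^sub>M I (\<lambda>_. lborel))"
  using \<open>finite I\<close> assms(4-)
proof (induction I arbitrary: f g h)
  case empty
  have "dominates_geo_mean t (f (\<lambda>_. undefined)) (g (\<lambda>_. undefined)) (h (\<lambda>_. undefined))"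
    using empty(4)[of "\<lambda>_. undefined" "\<lambda>_. undefined"] by (simp add: space_PiM restrict_def)
  then show ?case by (simp add: PiM_empty nn_integral_count_space_finite)
next
  case (insert i I)
  interpret product_sigma_finite "\<lambda>_::'i. lborel :: real measure" by standard
  note [measurable] = insert.prems(1-3)
  have ins: "(\<integral>\<^sup>+x. k x \<partial>Pi\<^sub>M (insert i I) (\<lambda>_. lborel)) = (\<integral>\<^sup>+x. (\<integral>\<^sup>+y. k (x(i := y)) \<partial>lborel) \<partial>Pi\<^sub>M I (\<lambda>_. lborel))"
    if "k \<in> borel_measurable (Pi\<^sub>M (insert i I) (\<lambda>_. lborel))" for k :: "('i \<Rightarrow> real) \<Rightarrow> ennreal"
    using product_nn_integral_insert[OF insert.hyps that] by simp
  have meas: "(\<lambda>y. k (x(i := y))) \<in> borel_measurable borel"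
    if [measurable]: "k \<in> borel_measurable (Pi\<^sub>M (insert i I) (\<lambda>_. lborel))" and "x \<in> space (Pi\<^sub>M I (\<lambda>_. lborel))"
    for k :: "('i \<Rightarrow> real) \<Rightarrow> ennreal" and x
    using measurable_compose[OF measurable_component_update[OF that(2) insert.hyps(2)] that(1)] by simp
  show ?case unfolding ins[OF insert.prems(1)] ins[OF insert.prems(2)] ins[OF insert.prems(3)]
  proof (rule insert.IH)
    fix x y assume x: "x \<in> space (Pi\<^sub>M I (\<lambda>_. lborel :: real measure))" and y: "y \<in> space (Pi\<^sub>M I (\<lambda>_. lborel :: real measure))"
    have z: "(\<lambda>i\<in>I. (1 - t) * x i + t * y i) \<in> space (Pi\<^sub>M I (\<lambda>_. lborel :: real measure))" by (simp add: space_PiM)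
    show "dominates_geo_mean t (\<integral>\<^sup>+u. f (x(i := u)) \<partial>lborel) (\<integral>\<^sup>+u. g (y(i := u)) \<partial>lborel)
        (\<integral>\<^sup>+u. h ((\<lambda>i\<in>I. (1 - t) * x i + t * y i)(i := u)) \<partial>lborel)"
    proof (rule prekopa_leindler_line[OF t])
      fix u v :: real
      have "x(i := u) \<in> space (Pi\<^sub>M (insert i I) (\<lambda>_. lborel))" "y(i := v) \<in> space (Pi\<^sub>M (insert i I) (\<lambda>_. lborel))"
        using x y by (auto simp: space_PiM PiE_def extensional_def)
      from insert.prems(4)[OF this]
      have "dominates_geo_mean t (f (x(i := u))) (g (y(i := v))) (h (\<lambda>j\<in>insert i I. (1 - t) * (x(i := u)) j + t * (y(i := v)) j))" .
      also have "(\<lambda>j\<in>insert i I. (1 - t) * (x(i := u)) j + t * (y(i := v)) j) = (\<lambda>i\<in>I. (1 - t) * x i + t * y i)(i := (1 - t) * u + t * v)"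
        using insert.hyps by (auto simp: fun_eq_iff)
      finally show "dominates_geo_mean t (f (x(i := u))) (g (y(i := v))) (h ((\<lambda>i\<in>I. (1 - t) * x i + t * y i)(i := (1 - t) * u + t * v)))" .
    qed (use meas x y z insert.prems in auto)
  qed measurable
qed

section \<open>Log-concave measures\<close>

text \<open>\<open>C\<close> is any measurable set containing the Minkowski combination, which
  itself need not be Borel. No density is mentioned, so the property makes sense for every linear
  image, degenerate or not. Null \<open>A\<close> or \<open>B\<close> are harmless because
  \<open>0 powr p = 0\<close>.\<close>

definition log_concave_measure :: "'a::real_vector measure \<Rightarrow> bool" where
  "log_concave_measure \<mu> \<longleftrightarrow>
    (\<forall>t\<in>{0<..<1}. \<forall>A\<in>sets \<mu>. \<forall>B\<in>sets \<mu>. \<forall>C\<in>sets \<mu>.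
      (\<forall>x\<in>A. \<forall>y\<in>B. (1 - t) *\<^sub>R x + t *\<^sub>R y \<in> C) \<longrightarrow>
        measure \<mu> A powr (1 - t) * measure \<mu> B powr t \<le> measure \<mu> C)"

lemma measurable_linear_image_lebesgue_R [measurable]:
  fixes l :: "nat \<Rightarrow> 'a::euclidean_space"
  shows "(\<lambda>x. \<Sum>i<d. x i *\<^sub>R l i) \<in> borel_measurable (lebesgue_R d)"
  unfolding lebesgue_R_def by measurable

text \<open>Prekopa--Leindler is applied to the density times the indicators of the preimages of
  \<open>A\<close>, \<open>B\<close> and \<open>C\<close>; linearity carries the inclusion between
  the sets over to the preimages.\<close>

theorem log_concave_linear_image:
  fixes l :: "nat \<Rightarrow> 'a::euclidean_space"
  assumes "log_concave_distribution d M"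
  shows "log_concave_measure (distr M borel (\<lambda>x. \<Sum>i<d. x i *\<^sub>R l i))"
proof -
  obtain p where M: "prob_space M" and p[measurable]: "p \<in> borel_measurable (lebesgue_R d)"
    and lc: "log_concave_fun d p" and Mp: "M = density (lebesgue_R d) (\<lambda>x. ennreal (p x))"
    using assms by (auto simp: log_concave_distribution_def)
  interpret prob_space M by fact
  define L where "L = (\<lambda>x. \<Sum>i<d. x i *\<^sub>R l i)"
  have L[measurable]: "L \<in> borel_measurable (lebesgue_R d)" unfolding L_def by measurable
  have sM: "sets M = sets (lebesgue_R d)" unfolding Mp by simp
  have spM: "space M = space (lebesgue_R d)" unfolding Mp by simp
  have LM[measurable]: "L \<in> borel_measurable M" using L measurable_cong_sets[OF sM refl] by blast
  have e: "ennreal (measure (distr M borel L) A) = (\<integral>\<^sup>+x. ennreal (p x) * indicator A (L x) \<partial>lebesgue_R d)"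
    if [measurable]: "A \<in> sets borel" for A
  proof -
    have "ennreal (measure (distr M borel L) A) = emeasure M (L -` A \<inter> space (lebesgue_R d))"
      using that by (simp add: measure_distr emeasure_eq_measure spM)
    also have "\<dots> = (\<integral>\<^sup>+x. ennreal (p x) * indicator (L -` A \<inter> space (lebesgue_R d)) x \<partial>lebesgue_R d)"
      unfolding Mp by (subst emeasure_density) measurable
    also have "\<dots> = (\<integral>\<^sup>+x. ennreal (p x) * indicator A (L x) \<partial>lebesgue_R d)"
      by (intro nn_integral_cong) (auto simp: indicator_def)
    finally show ?thesis .
  qed
  have meas: "(\<lambda>x. ennreal (p x) * indicator A (L x)) \<in> borel_measurable (lebesgue_R d)" if [measurable]: "A \<in> sets borel" for A
    by measurable
  show ?thesis unfolding log_concave_measure_def L_def[symmetric]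
  proof (intro ballI impI)
    fix t :: real and A B C :: "'a set"
    assume t: "t \<in> {0<..<1}" and "A \<in> sets (distr M borel L)" "B \<in> sets (distr M borel L)" "C \<in> sets (distr M borel L)"
      and sub: "\<forall>x\<in>A. \<forall>y\<in>B. (1 - t) *\<^sub>R x + t *\<^sub>R y \<in> C"
    then have ABC[measurable]: "A \<in> sets borel" "B \<in> sets borel" "C \<in> sets borel" by auto
    let ?m = "measure (distr M borel L)"
    show "?m A powr (1 - t) * ?m B powr t \<le> ?m C"
    proof (cases "?m A = 0 \<or> ?m B = 0")
      case False
      then have pos: "?m A > 0" "?m B > 0" by (simp_all add: zero_less_measure_iff)
      have "dominates_geo_mean t (\<integral>\<^sup>+x. ennreal (p x) * indicator A (L x) \<partial>lebesgue_R d)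
        (\<integral>\<^sup>+x. ennreal (p x) * indicator B (L x) \<partial>lebesgue_R d) (\<integral>\<^sup>+x. ennreal (p x) * indicator C (L x) \<partial>lebesgue_R d)"
        unfolding lebesgue_R_def
      proof (rule prekopa_leindler_PiM)
        fix x y assume "x \<in> space (Pi\<^sub>M {..<d} (\<lambda>_. lborel :: real measure))" "y \<in> space (Pi\<^sub>M {..<d} (\<lambda>_. lborel :: real measure))"
        then have xy: "x \<in> space (lebesgue_R d)" "y \<in> space (lebesgue_R d)" by (auto simp: lebesgue_R_def)
        let ?z = "\<lambda>i\<in>{..<d}. (1 - t) * x i + t * y i"
        have z: "?z \<in> space (lebesgue_R d)" by (simp add: lebesgue_R_def space_PiM)
        have Lz: "L ?z = (1 - t) *\<^sub>R L x + t *\<^sub>R L y"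
          by (simp add: L_def scaleR_sum_right sum.distrib[symmetric] scaleR_add_left)
        show "dominates_geo_mean t (ennreal (p x) * indicator A (L x)) (ennreal (p y) * indicator B (L y))
            (ennreal (p ?z) * indicator C (L ?z))"
          unfolding dominates_geo_mean_def
        proof (intro allI impI)
          fix a b :: real assume ab: "0 < a" "0 < b" "ennreal a \<le> ennreal (p x) * indicator A (L x)"
            "ennreal b \<le> ennreal (p y) * indicator B (L y)"
          have A: "L x \<in> A" "a \<le> p x" using ab(1,3) by (cases "L x \<in> A"; auto simp: ennreal_le_iff2)+
          have B: "L y \<in> B" "b \<le> p y" using ab(2,4) by (cases "L y \<in> B"; auto simp: ennreal_le_iff2)+
          have "L ?z \<in> C" using sub A B Lz by simp
          moreover have "a powr (1 - t) * b powr t \<le> p x powr (1 - t) * p y powr t"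
            using ab A B t by (intro mult_mono powr_mono2) auto
          moreover have "\<dots> \<le> p ?z" using lc xy t by (auto simp: log_concave_fun_def)
          ultimately show "ennreal (a powr (1 - t) * b powr t) \<le> ennreal (p ?z) * indicator C (L ?z)"
            by (auto intro!: ennreal_leI)
        qed
      qed (use t ABC in \<open>auto intro!: meas[unfolded lebesgue_R_def]\<close>)
      then have "ennreal (?m A powr (1 - t) * ?m B powr t) \<le> ennreal (?m C)"
        using pos by (auto simp: dominates_geo_mean_def e[symmetric])
      then show ?thesis by (simp add: ennreal_le_iff)
    qed auto
  qed
qed

section \<open>Half-line masses of a standardised variable\<close>

text \<open>\<open>up\<close> and \<open>dn\<close> are midpoint log-concavity: halfway between a
  point beyond \<open>3 * T\<close> and a point of \<open>[-T, T]\<close> lies a point beyond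
  \<open>T\<close>. Chebyshev's bound thus enters squared, which improves the decay enough to
  control the tail of the second moment.\<close>

lemma (in prob_space) fourth_power_tail:
  fixes Z :: "'a \<Rightarrow> real"
  assumes [measurable]: "random_variable borel Z" and i: "integrable M (\<lambda>x. (Z x)\<^sup>2)" and v: "expectation (\<lambda>x. (Z x)\<^sup>2) \<le> 1"
    and up: "\<And>T. T > 0 \<Longrightarrow> prob {x\<in>space M. 3 * T < Z x} * prob {x\<in>space M. \<bar>Z x\<bar> \<le> T} \<le> (prob {x\<in>space M. T < Z x})\<^sup>2"
    and dn: "\<And>T. T > 0 \<Longrightarrow> prob {x\<in>space M. Z x < - (3 * T)} * prob {x\<in>space M. \<bar>Z x\<bar> \<le> T} \<le> (prob {x\<in>space M. Z x < - T})\<^sup>2"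
    and T: "T \<ge> 2"
  shows "prob {x\<in>space M. 3 * T < \<bar>Z x\<bar>} \<le> 4 / 3 / T ^ 4"
proof -
  define p where "p = prob {x\<in>space M. T < Z x}"
  define q where "q = prob {x\<in>space M. Z x < - T}"
  have pq: "p + q = prob {x\<in>space M. T < \<bar>Z x\<bar>}"
    unfolding p_def q_def using T by (subst finite_measure_Union[symmetric]) (auto intro!: arg_cong[where f=prob])
  have pq3: "prob {x\<in>space M. 3 * T < Z x} + prob {x\<in>space M. Z x < - (3 * T)} = prob {x\<in>space M. 3 * T < \<bar>Z x\<bar>}"
    using T by (subst finite_measure_Union[symmetric]) (auto intro!: arg_cong[where f=prob])
  have "p + q \<le> prob {x\<in>space M. T\<^sup>2 \<le> (Z x)\<^sup>2}"
    unfolding pq using T by (intro finite_measure_mono) (auto simp: abs_le_square_iff[symmetric])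
  also have "\<dots> \<le> expectation (\<lambda>x. (Z x)\<^sup>2) / T\<^sup>2"
    using T i by (intro integral_Markov_inequality_measure[where A="{}"]) auto
  also have "\<dots> \<le> 1 / T\<^sup>2" using v T by (intro divide_right_mono) auto
  finally have cheb: "p + q \<le> 1 / T\<^sup>2" .
  have "1 / T\<^sup>2 \<le> 1 / 2\<^sup>2" using T by (intro divide_left_mono power_mono) auto
  then have "p + q \<le> 1 / 4" using cheb by simp
  moreover have "prob {x\<in>space M. \<bar>Z x\<bar> \<le> T} = 1 - (p + q)"
    unfolding pq by (subst prob_compl[symmetric]) (auto intro!: arg_cong[where f=prob])
  ultimately have big: "prob {x\<in>space M. \<bar>Z x\<bar> \<le> T} \<ge> 3 / 4" by simp
  have 1: "prob {x\<in>space M. 3 * T < Z x} * (3 / 4) \<le> p\<^sup>2" unfolding p_def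
    by (rule order_trans[OF mult_left_mono[OF big] up]) (use T in auto)
  have 2: "prob {x\<in>space M. Z x < - (3 * T)} * (3 / 4) \<le> q\<^sup>2" unfolding q_def
    by (rule order_trans[OF mult_left_mono[OF big] dn]) (use T in auto)
  have "prob {x\<in>space M. 3 * T < \<bar>Z x\<bar>} * (3 / 4) \<le> p\<^sup>2 + q\<^sup>2" using 1 2 pq3 by simp
  also have "\<dots> \<le> (p + q)\<^sup>2" by (simp add: power2_sum p_def q_def)
  also have "\<dots> \<le> (1 / T\<^sup>2)\<^sup>2" using cheb by (intro power_mono) (auto simp: p_def q_def)
  finally show ?thesis by (simp add: power_divide)
qed

text \<open>The shells between \<open>48 * 3 ^ j\<close> and \<open>48 * 3 ^ (j + 1)\<close>
  contribute a geometric series of ratio 1/9. The threshold 48 brings its sum to 243/512, below one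
  half.\<close>

lemma (in prob_space) truncated_second_moment:
  fixes Z :: "'a \<Rightarrow> real"
  assumes [measurable]: "random_variable borel Z"
    and tail: "\<And>T. T \<ge> 2 \<Longrightarrow> prob {x\<in>space M. 3 * T < \<bar>Z x\<bar>} \<le> 4 / 3 / T ^ 4"
  shows "(\<integral>\<^sup>+x. ennreal ((Z x)\<^sup>2 * indicator {x. 48 < \<bar>Z x\<bar>} x) \<partial>M) \<le> ennreal (1 / 2)"
proof -
  define S :: "nat \<Rightarrow> real" where "S j = 3 ^ j * 16" for j
  have S2: "S j \<ge> 2" for j
  proof -
    have "(1::real) \<le> 3 ^ j" by (rule one_le_power) simp
    then show ?thesis unfolding S_def by linarith
  qed
  have SS: "S (Suc j) = 3 * S j" for j by (simp add: S_def)
  have "ennreal ((Z x)\<^sup>2 * indicator {x. 48 < \<bar>Z x\<bar>} x) \<le> (\<Sum>j. ennreal ((9 * S j)\<^sup>2 * indicator {x. 3 * S j < \<bar>Z x\<bar>} x))" for x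
  proof (cases "48 < \<bar>Z x\<bar>")
    case True
    obtain n0 where "\<bar>Z x\<bar> < (3::real) ^ n0" using real_arch_pow[of 3 "\<bar>Z x\<bar>"] by auto
    then have ex: "\<bar>Z x\<bar> \<le> 9 * S n0" by (simp add: S_def)
    define j where "j = (LEAST j. \<bar>Z x\<bar> \<le> 9 * S j)"
    have j: "\<bar>Z x\<bar> \<le> 9 * S j" unfolding j_def by (rule LeastI[of _ n0]) (rule ex)
    have j3: "3 * S j < \<bar>Z x\<bar>"
    proof (cases j)
      case 0 then show ?thesis using True by (simp add: S_def)
    next
      case (Suc i)
      then have "\<not> \<bar>Z x\<bar> \<le> 9 * S i" using not_less_Least[of i "\<lambda>j. \<bar>Z x\<bar> \<le> 9 * S j"] by (simp add: j_def)
      then show ?thesis using Suc SS by simp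
    qed
    have "(Z x)\<^sup>2 \<le> (9 * S j)\<^sup>2"
      by (rule abs_le_square_iff[THEN iffD1]) (use j S2[of j] in auto)
    then have "ennreal ((Z x)\<^sup>2 * indicator {x. 48 < \<bar>Z x\<bar>} x) \<le> ennreal ((9 * S j)\<^sup>2 * indicator {x. 3 * S j < \<bar>Z x\<bar>} x)"
      using True j3 by (intro ennreal_leI) simp
    also have "\<dots> \<le> (\<Sum>j. ennreal ((9 * S j)\<^sup>2 * indicator {x. 3 * S j < \<bar>Z x\<bar>} x))"
    proof -
      have "g j \<le> suminf g" for g :: "nat \<Rightarrow> ennreal" using sum_le_suminf[of g "{j}"] by simp
      then show ?thesis .
    qed
    finally show ?thesis .
  qed auto
  then have "(\<integral>\<^sup>+x. ennreal ((Z x)\<^sup>2 * indicator {x. 48 < \<bar>Z x\<bar>} x) \<partial>M)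
      \<le> (\<integral>\<^sup>+x. (\<Sum>j. ennreal ((9 * S j)\<^sup>2 * indicator {x. 3 * S j < \<bar>Z x\<bar>} x)) \<partial>M)" by (intro nn_integral_mono)
  also have "\<dots> = (\<Sum>j. \<integral>\<^sup>+x. ennreal ((9 * S j)\<^sup>2 * indicator {x. 3 * S j < \<bar>Z x\<bar>} x) \<partial>M)"
    by (intro nn_integral_suminf) measurable
  also have "\<dots> \<le> (\<Sum>j. ennreal (27 / 64 * (1 / 9) ^ j))"
  proof (intro suminf_le allI)
    fix j
    have "(\<integral>\<^sup>+x. ennreal ((9 * S j)\<^sup>2 * indicator {x. 3 * S j < \<bar>Z x\<bar>} x) \<partial>M)
        = (\<integral>\<^sup>+x. ennreal ((9 * S j)\<^sup>2) * indicator {x\<in>space M. 3 * S j < \<bar>Z x\<bar>} x \<partial>M)"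
      by (intro nn_integral_cong) (auto simp: indicator_def)
    also have "\<dots> = ennreal ((9 * S j)\<^sup>2 * prob {x\<in>space M. 3 * S j < \<bar>Z x\<bar>})"
      by (subst nn_integral_cmult_indicator) (auto simp: emeasure_eq_measure ennreal_mult)
    also have "\<dots> \<le> ennreal (27 / 64 * (1 / 9) ^ j)"
    proof (intro ennreal_leI)
      have "(9 * S j)\<^sup>2 * prob {x\<in>space M. 3 * S j < \<bar>Z x\<bar>} \<le> (9 * S j)\<^sup>2 * (4 / 3 / S j ^ 4)"
        by (intro mult_left_mono tail S2) auto
      also have "\<dots> = 108 / (S j)\<^sup>2" using S2[of j] by (simp add: power2_eq_square power4_eq_xxxx)
      also have "\<dots> = 27 / 64 * (1 / 9) ^ j" by (simp add: S_def power_mult_distrib power_divide power_mult[symmetric] power2_eq_square)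
         (simp add: power_mult_distrib[symmetric])
      finally show "(9 * S j)\<^sup>2 * prob {x\<in>space M. 3 * S j < \<bar>Z x\<bar>} \<le> 27 / 64 * (1 / 9) ^ j" .
    qed
    finally show "(\<integral>\<^sup>+x. ennreal ((9 * S j)\<^sup>2 * indicator {x. 3 * S j < \<bar>Z x\<bar>} x) \<partial>M) \<le> ennreal (27 / 64 * (1 / 9) ^ j)" .
  qed auto
  also have "\<dots> = ennreal (27 / 64 * (1 / (1 - 1 / 9)))"
  proof -
    have "(\<lambda>j. 27 / 64 * (1 / 9 :: real) ^ j) sums (27 / 64 * (1 / (1 - 1 / 9)))"
      by (intro sums_mult geometric_sums) simp
    then show ?thesis by (subst suminf_ennreal2) (auto simp: sums_iff)
  qed
  also have "\<dots> \<le> ennreal (1 / 2)" by (intro ennreal_leI) simp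
  finally show ?thesis .
qed

text \<open>At least half of the second moment sits on \<open>|Z| \<le> 48\<close>, so
  \<open>E|Z| \<ge> 1/96\<close>. As the mean is zero, the positive part carries half of
  \<open>E|Z|\<close>, which is impossible if \<open>Z\<close> rarely exceeds a small
  constant.\<close>

lemma (in prob_space) half_line_mass:
  fixes Z :: "'a \<Rightarrow> real"
  assumes [measurable]: "random_variable borel Z" and i: "integrable M Z" "integrable M (\<lambda>x. (Z x)\<^sup>2)"
    and v: "expectation Z = 0" "expectation (\<lambda>x. (Z x)\<^sup>2) = 1"
    and up: "\<And>T. T > 0 \<Longrightarrow> prob {x\<in>space M. 3 * T < Z x} * prob {x\<in>space M. \<bar>Z x\<bar> \<le> T} \<le> (prob {x\<in>space M. T < Z x})\<^sup>2"
    and dn: "\<And>T. T > 0 \<Longrightarrow> prob {x\<in>space M. Z x < - (3 * T)} * prob {x\<in>space M. \<bar>Z x\<bar> \<le> T} \<le> (prob {x\<in>space M. Z x < - T})\<^sup>2"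
  shows "prob {x\<in>space M. 1 / 384 \<le> Z x} \<ge> (1 / 384)\<^sup>2"
proof -
  define W where "W = (\<lambda>x. (Z x)\<^sup>2 * indicator {x. 48 < \<bar>Z x\<bar>} x)"
  have [measurable]: "W \<in> borel_measurable M" unfolding W_def by measurable
  have Wi: "integrable M W"
    by (rule Bochner_Integration.integrable_bound[OF i(2)]) (auto simp: W_def indicator_def)
  have "ennreal (expectation W) = (\<integral>\<^sup>+x. ennreal (W x) \<partial>M)"
    using Wi by (intro nn_integral_eq_integral[symmetric]) (auto simp: W_def)
  also have "\<dots> \<le> ennreal (1 / 2)"
    unfolding W_def by (intro truncated_second_moment fourth_power_tail i up dn) (use v in auto)
  finally have EW: "expectation W \<le> 1 / 2" by (subst (asm) ennreal_le_iff) auto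
  \<comment> \<open>\<open>1/96 - 3 * c = c\<close> for this value, so the integrated inequality
    leaves exactly \<open>c \<le> prob / c\<close>.\<close>
  define c :: real where "c = 1 / 384"
  define I where "I = (\<lambda>x. indicator {x\<in>space M. c \<le> Z x} x :: real)"
  have Ii: "integrable M I" unfolding I_def by (auto simp: emeasure_eq_measure)
  have EI: "expectation I = prob {x\<in>space M. c \<le> Z x}" unfolding I_def by simp
  \<comment> \<open>The summand \<open>Z\<close> has mean zero and turns \<open>|Z|\<close> into
    twice the positive part. Where \<open>Z \<ge> c\<close>, AM-GM splits \<open>2 * Z\<close> into
    \<open>c * Z\<^sup>2 + 1 / c\<close>, and the indicator pays for the second term.\<close>
  have point: "((Z x)\<^sup>2 - W x) / 48 + Z x \<le> 2 * c + c * (Z x)\<^sup>2 + I x / c" if "x \<in> space M" for x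
  proof -
    have 1: "((Z x)\<^sup>2 - W x) / 48 \<le> \<bar>Z x\<bar>"
    proof (cases "48 < \<bar>Z x\<bar>")
      case False
      then have "\<bar>Z x\<bar> * \<bar>Z x\<bar> \<le> 48 * \<bar>Z x\<bar>" by (intro mult_right_mono) auto
      then show ?thesis using False by (simp add: W_def power2_eq_square abs_mult_self_eq)
    qed (simp add: W_def)
    have 2: "2 * Z x \<le> c * (Z x)\<^sup>2 + 1 / c"
      using zero_le_power2[of "c * Z x - 1"] by (simp add: c_def power2_eq_square algebra_simps)
    show ?thesis
    proof (cases "c \<le> Z x")
      case True
      then have "\<bar>Z x\<bar> = Z x" by (simp add: c_def)
      moreover have "I x = 1" "c > 0" using True that by (auto simp: I_def c_def)
      moreover have "I x / c = 1 / c" using \<open>I x = 1\<close> by simp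
      ultimately show ?thesis using 1 2 by linarith
    next
      case False
      have "0 \<le> c * (Z x)\<^sup>2" by (simp add: c_def)
      moreover have "\<bar>Z x\<bar> + Z x \<le> 2 * c" using False by (simp add: c_def)
      moreover have "I x / c = 0" using False by (simp add: I_def)
      ultimately show ?thesis using 1 by linarith
    qed
  qed
  have "expectation (\<lambda>x. ((Z x)\<^sup>2 - W x) / 48 + Z x) \<le> expectation (\<lambda>x. 2 * c + c * (Z x)\<^sup>2 + I x / c)"
    using i Wi Ii by (intro integral_mono point) auto
  then have "(1 - expectation W) / 48 \<le> 2 * c + c + prob {x\<in>space M. c \<le> Z x} / c"
    using i Wi Ii v by (simp add: EI prob_space)
  then show ?thesis using EW by (simp add: c_def power2_eq_square)
qed

section \<open>Density bounds for planar marginals\<close>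

lemma log_concave_midpoint:
  fixes \<mu> :: "'a::real_vector measure"
  assumes "log_concave_measure \<mu>" and "A \<in> sets \<mu>" "B \<in> sets \<mu>" "C \<in> sets \<mu>"
    and "\<And>x y. x \<in> A \<Longrightarrow> y \<in> B \<Longrightarrow> (1/2) *\<^sub>R x + (1/2) *\<^sub>R y \<in> C"
  shows "measure \<mu> A * measure \<mu> B \<le> (measure \<mu> C)\<^sup>2"
proof -
  have "measure \<mu> A powr (1 - 1/2) * measure \<mu> B powr (1/2) \<le> measure \<mu> C"
    using assms(1)[unfolded log_concave_measure_def, rule_format, of "1/2" A B C] assms(2-) by auto
  then have "sqrt (measure \<mu> A) * sqrt (measure \<mu> B) \<le> measure \<mu> C" by (simp add: powr_half_sqrt)
  then have "(sqrt (measure \<mu> A) * sqrt (measure \<mu> B))\<^sup>2 \<le> (measure \<mu> C)\<^sup>2" by (intro power_mono) auto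
  then show ?thesis by (simp add: power_mult_distrib)
qed

text \<open>\<open>r\<close> and \<open>h\<close> are half-lengths of the sides. They are
  independent because thin cones call for thin rectangles.\<close>

definition rect :: "real \<Rightarrow> real \<Rightarrow> real \<times> real \<Rightarrow> (real \<times> real) set" where
  "rect r h z = {x. \<bar>fst x - fst z\<bar> \<le> r \<and> \<bar>snd x - snd z\<bar> \<le> h}"

lemma measurable_rect [measurable]: "rect r h z \<in> sets borel"
proof -
  have "closed (rect r h z)" unfolding rect_def
    by (intro closed_Collect_conj closed_Collect_le continuous_intros)
  then show ?thesis by simp
qed

lemma rect_sym: "x \<in> rect r h z \<longleftrightarrow> z \<in> rect r h x"
  by (auto simp: rect_def)

lemma emeasure_rect:
  assumes "0 \<le> r" "0 \<le> h"
  shows "emeasure lborel (rect r h z) = ennreal (4 * r * h)"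
proof -
  have "rect r h z = {fst z - r..fst z + r} \<times> {snd z - h..snd z + h}" by (auto simp: rect_def)
  then have "emeasure lborel (rect r h z) = emeasure (lborel \<Otimes>\<^sub>M lborel) ({fst z - r..fst z + r} \<times> {snd z - h..snd z + h})"
    by (simp add: lborel_prod)
  also have "\<dots> = ennreal (2 * r) * ennreal (2 * h)"
    using assms by (subst lborel.emeasure_pair_measure_Times) auto
  finally show ?thesis using assms by (simp add: ennreal_mult[symmetric] mult_ac)
qed

text \<open>The half-plane mass \<open>(1 / 384)\<^sup>2\<close> spread over the square of side
  \<open>2 * 1101\<close>, which contains all centres in the averaging argument.\<close>

definition low_density :: real where "low_density = (1 / 384)\<^sup>2 / (2 * 1101)\<^sup>2"

lemma low_density_pos: "low_density > 0" by (simp add: low_density_def)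

text \<open>The factors arise in \<open>rect_mass_upper\<close>:
  \<open>10 ^ 4 = (4 * 25)\<^sup>2\<close> and \<open>2000 ^ 4 = 1 / b ^ 4\<close>.\<close>

definition high_density :: real where "high_density = 10 ^ 4 * 2000 ^ 4 / low_density"

lemma high_density_pos: "high_density > 0" using low_density_pos by (simp add: high_density_def)

lemma sum_inverse_squares: "(\<Sum>k<K. 1 / (real k + 1)\<^sup>2) \<le> 2 - 1 / real K"
proof (induction K)
  case (Suc K)
  show ?case
  proof (cases "K = 0")
    case False
    then have "1 / (real K + 1)\<^sup>2 \<le> 1 / (real K * (real K + 1))" by (intro divide_left_mono) (auto simp: power2_eq_square)
    also have "\<dots> = 1 / real K - 1 / (real K + 1)" using False by (simp add: field_simps)
    finally show ?thesis using Suc by (simp add: add_ac)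
  qed simp
qed simp

locale isotropic_plane = prob_space \<mu> for \<mu> :: "(real \<times> real) measure" +
  assumes sets_mu [measurable_cong]: "sets \<mu> = sets borel"
    and lc: "log_concave_measure \<mu>"
    and int1: "integrable \<mu> (\<lambda>x. e \<bullet> x)" and mean: "expectation (\<lambda>x. e \<bullet> x) = 0"
    and int2: "integrable \<mu> (\<lambda>x. (e \<bullet> x)\<^sup>2)" and var: "expectation (\<lambda>x. (e \<bullet> x)\<^sup>2) = (norm e)\<^sup>2"
begin

lemma space_mu [simp]: "space \<mu> = UNIV"
  using sets_eq_imp_space_eq[OF sets_mu] by simp

lemma midpoint_mass:
  assumes "A \<in> sets borel" "B \<in> sets borel" "C \<in> sets borel"
    and "\<And>x y. x \<in> A \<Longrightarrow> y \<in> B \<Longrightarrow> (1/2) *\<^sub>R x + (1/2) *\<^sub>R y \<in> C"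
  shows "prob A * prob B \<le> (prob C)\<^sup>2"
  using assms by (intro log_concave_midpoint[OF lc]) (auto simp: sets_mu)

lemma half_plane_mass:
  assumes "norm e = 1"
  shows "prob {x. 1 / 384 \<le> e \<bullet> x} \<ge> (1 / 384)\<^sup>2"
proof -
  have "prob {x\<in>space \<mu>. 1 / 384 \<le> e \<bullet> x} \<ge> (1 / 384)\<^sup>2"
  proof (rule half_line_mass)
    fix T :: real assume T: "T > 0"
    show "prob {x\<in>space \<mu>. 3 * T < e \<bullet> x} * prob {x\<in>space \<mu>. \<bar>e \<bullet> x\<bar> \<le> T} \<le> (prob {x\<in>space \<mu>. T < e \<bullet> x})\<^sup>2"
      by (rule midpoint_mass) (auto simp: inner_add_right)
    show "prob {x\<in>space \<mu>. e \<bullet> x < - (3 * T)} * prob {x\<in>space \<mu>. \<bar>e \<bullet> x\<bar> \<le> T} \<le> (prob {x\<in>space \<mu>. e \<bullet> x < - T})\<^sup>2"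
      by (rule midpoint_mass) (auto simp: inner_add_right)
  qed (use assms int1 int2 mean var in auto)
  then show ?thesis by simp
qed

lemma second_moment_tail:
  assumes "T > 0"
  shows "prob {x. T \<le> \<bar>e \<bullet> x\<bar>} \<le> (norm e)\<^sup>2 / T\<^sup>2"
proof -
  have "prob {x. T \<le> \<bar>e \<bullet> x\<bar>} = prob {x\<in>space \<mu>. T\<^sup>2 \<le> (e \<bullet> x)\<^sup>2}"
    using assms by (intro arg_cong[where f=prob]) (auto simp: abs_le_square_iff[symmetric])
  also have "\<dots> \<le> expectation (\<lambda>x. (e \<bullet> x)\<^sup>2) / T\<^sup>2"
    using assms int2 by (intro integral_Markov_inequality_measure[where A="{}"]) auto
  finally show ?thesis by (simp add: var)
qed

text \<open>Chebyshev in the two coordinates leaves at most \<open>4 / 1100\<^sup>2\<close> outside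
  the disc, just below half of \<open>(1 / 384)\<^sup>2\<close>.\<close>

lemma half_disc_mass:
  assumes "norm e = 1"
  shows "prob {x. 1 / 384 \<le> e \<bullet> x \<and> norm x < 1100} \<ge> (1 / 384)\<^sup>2 / 2"
proof -
  have "prob {x. 1 / 384 \<le> e \<bullet> x} \<le> prob ({x. 1 / 384 \<le> e \<bullet> x \<and> norm x < 1100} \<union> ({x. 1100 / sqrt 2 \<le> \<bar>(1, 0) \<bullet> x\<bar>} \<union> {x. 1100 / sqrt 2 \<le> \<bar>(0, 1) \<bullet> x\<bar>}))"
  proof (intro finite_measure_mono)
    show "{x. 1 / 384 \<le> e \<bullet> x} \<subseteq> {x. 1 / 384 \<le> e \<bullet> x \<and> norm x < 1100} \<union> ({x. 1100 / sqrt 2 \<le> \<bar>(1, 0) \<bullet> x\<bar>} \<union> {x. 1100 / sqrt 2 \<le> \<bar>(0, 1) \<bullet> x\<bar>})"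
    proof
      fix x :: "real \<times> real" assume x: "x \<in> {x. 1 / 384 \<le> e \<bullet> x}"
      obtain a b where ab: "x = (a, b)" by (cases x)
      have small: "norm x < 1100" if "\<bar>a\<bar> < 1100 / sqrt 2" "\<bar>b\<bar> < 1100 / sqrt 2"
      proof -
        from that have "\<bar>a\<bar>\<^sup>2 < (1100 / sqrt 2)\<^sup>2" "\<bar>b\<bar>\<^sup>2 < (1100 / sqrt 2)\<^sup>2" by (intro power_strict_mono; simp)+
        then have "a\<^sup>2 + b\<^sup>2 < 1100\<^sup>2" by (simp add: power_divide)
        then show ?thesis unfolding ab norm_Pair by (intro real_less_lsqrt) auto
      qed
      show "x \<in> {x. 1 / 384 \<le> e \<bullet> x \<and> norm x < 1100} \<union> ({x. 1100 / sqrt 2 \<le> \<bar>(1, 0) \<bullet> x\<bar>} \<union> {x. 1100 / sqrt 2 \<le> \<bar>(0, 1) \<bullet> x\<bar>})"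
        using x small by (cases "\<bar>a\<bar> < 1100 / sqrt 2 \<and> \<bar>b\<bar> < 1100 / sqrt 2") (auto simp: ab not_less)
    qed
  qed measurable
  also have "\<dots> \<le> prob {x. 1 / 384 \<le> e \<bullet> x \<and> norm x < 1100} + (prob {x. 1100 / sqrt 2 \<le> \<bar>(1, 0) \<bullet> x\<bar>} + prob {x. 1100 / sqrt 2 \<le> \<bar>(0, 1) \<bullet> x\<bar>})"
    by (intro order_trans[OF measure_Un_le] add_left_mono measure_Un_le) measurable
  also have "\<dots> \<le> prob {x. 1 / 384 \<le> e \<bullet> x \<and> norm x < 1100} + ((norm (1::real, 0::real))\<^sup>2 / (1100 / sqrt 2)\<^sup>2 + (norm (0::real, 1::real))\<^sup>2 / (1100 / sqrt 2)\<^sup>2)"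
    by (intro add_left_mono add_mono second_moment_tail) auto
  finally show ?thesis using half_plane_mass[OF assms] by (simp add: norm_Pair power_divide)
qed

text \<open>Membership in a rectangle is symmetric in point and centre, so averaging masses over
  centres is the same as averaging areas over random points.\<close>

lemma rect_mass_Fubini:
  assumes [measurable]: "D \<in> sets borel"
  shows "(\<integral>\<^sup>+z. indicator D z * ennreal (prob (rect r h z)) \<partial>lborel) = (\<integral>\<^sup>+x. emeasure lborel (D \<inter> rect r h x) \<partial>\<mu>)"
proof -
  interpret P: pair_sigma_finite \<mu> "lborel :: (real \<times> real) measure"
    by (intro pair_sigma_finite.intro sigma_finite_measure_axioms lborel.sigma_finite_measure_axioms)
  have "(\<integral>\<^sup>+z. indicator D z * ennreal (prob (rect r h z)) \<partial>lborel)
      = (\<integral>\<^sup>+z. (\<integral>\<^sup>+x. indicator D z * indicator (rect r h z) x \<partial>\<mu>) \<partial>lborel)"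
    by (intro nn_integral_cong, subst nn_integral_cmult) (auto simp: emeasure_eq_measure sets_mu)
  also have "\<dots> = (\<integral>\<^sup>+x. (\<integral>\<^sup>+z. indicator D z * indicator (rect r h z) x \<partial>lborel) \<partial>\<mu>)"
  proof (rule P.Fubini'[of "\<lambda>x z. indicator D z * indicator (rect r h z) x"])
    let ?E = "{p :: (real \<times> real) \<times> (real \<times> real). fst p \<in> rect r h (snd p)}"
    have "closed ?E" unfolding rect_def mem_Collect_eq
      by (intro closed_Collect_conj closed_Collect_le continuous_intros)
    then have [measurable]: "?E \<in> sets borel" by simp
    have [measurable]: "(snd :: (real \<times> real) \<times> (real \<times> real) \<Rightarrow> _) \<in> borel_measurable borel"
      by (intro borel_measurable_continuous_onI continuous_intros)
    have "(\<lambda>p. indicator D (snd p) * indicator ?E p :: ennreal) \<in> borel_measurable borel" by measurable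
    moreover have "sets (\<mu> \<Otimes>\<^sub>M (lborel :: (real \<times> real) measure)) = sets borel"
      using sets_pair_measure_cong[OF sets_mu sets_lborel] by (simp only: borel_prod)
    ultimately have "(\<lambda>p. indicator D (snd p) * indicator ?E p :: ennreal) \<in> borel_measurable (\<mu> \<Otimes>\<^sub>M lborel)"
      using measurable_cong_sets[OF _ refl] by blast
    also have "(\<lambda>p. indicator D (snd p) * indicator ?E p :: ennreal) = (\<lambda>(x, z). indicator D z * indicator (rect r h z) x)"
      by (auto simp: fun_eq_iff indicator_def)
    finally show "(\<lambda>(x, z). indicator D z * indicator (rect r h z) x :: ennreal) \<in> borel_measurable (\<mu> \<Otimes>\<^sub>M lborel)" .
  qed
  also have "\<dots> = (\<integral>\<^sup>+x. (\<integral>\<^sup>+z. indicator (D \<inter> rect r h x) z \<partial>lborel) \<partial>\<mu>)"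
    by (intro nn_integral_cong) (auto simp: indicator_def rect_sym)
  also have "\<dots> = (\<integral>\<^sup>+x. emeasure lborel (D \<inter> rect r h x) \<partial>\<mu>)"
    by (intro nn_integral_cong nn_integral_indicator) auto
  finally show ?thesis .
qed

text \<open>Rectangles around points of the half disc stay inside \<open>D\<close>, since
  \<open>r + h \<le> 1/768\<close> moves the boundary only from 1/384 to 1/768. Hence the rectangle
  masses integrate over \<open>D\<close> to at least \<open>4 * r * h\<close> times the half-disc
  mass, and some centre must reach the average.\<close>

lemma rect_mass_half_plane:
  assumes e: "norm e = 1" and rh: "0 < r" "r \<le> 1 / 1536" "0 < h" "h \<le> 1 / 1536"
  shows "\<exists>z. 1 / 768 \<le> e \<bullet> z \<and> low_density * (r * h) \<le> prob (rect r h z)"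
proof (rule ccontr)
  assume neg: "\<not> ?thesis"
  define D where "D = {z. 1 / 768 \<le> e \<bullet> z \<and> norm z < 1101}"
  define A where "A = {x. 1 / 384 \<le> e \<bullet> x \<and> norm x < 1100}"
  have [measurable]: "D \<in> sets borel" "A \<in> sets borel" unfolding D_def A_def by measurable
  have sub: "rect r h x \<subseteq> D" if "x \<in> A" for x
  proof
    fix z assume z: "z \<in> rect r h x"
    have "norm (z - x) \<le> \<bar>fst (z - x)\<bar> + \<bar>snd (z - x)\<bar>"
      using norm_Pair_le[of "fst (z - x)" "snd (z - x)"] by (simp only: prod.collapse real_norm_def)
    also have "\<dots> \<le> 1 / 768" using z rh by (simp add: rect_def)
    finally have n: "norm (z - x) \<le> 1 / 768" .
    have "\<bar>e \<bullet> (z - x)\<bar> \<le> norm e * norm (z - x)" by (rule Cauchy_Schwarz_ineq2)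
    then have "\<bar>e \<bullet> z - e \<bullet> x\<bar> \<le> 1 / 768" using e n by (simp add: inner_diff_right)
    moreover have "norm z \<le> norm x + norm (z - x)" using norm_triangle_ineq[of x "z - x"] by simp
    moreover have "1 / 384 \<le> e \<bullet> x" "norm x < 1100" using that by (auto simp: A_def)
    ultimately have "1 / 768 \<le> e \<bullet> z" "norm z < 1101" using n by linarith+
    then show "z \<in> D" by (simp add: D_def)
  qed
  have "ennreal (4 * r * h * ((1 / 384)\<^sup>2 / 2)) \<le> ennreal (4 * r * h * prob A)"
    using rh half_disc_mass[OF e] by (intro ennreal_leI mult_left_mono) (auto simp: A_def)
  also have "\<dots> = (\<integral>\<^sup>+x. ennreal (4 * r * h) * indicator A x \<partial>\<mu>)"
    using rh by (subst nn_integral_cmult_indicator) (auto simp: emeasure_eq_measure ennreal_mult sets_mu)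
  also have "\<dots> \<le> (\<integral>\<^sup>+x. emeasure lborel (D \<inter> rect r h x) \<partial>\<mu>)"
  proof (intro nn_integral_mono)
    fix x
    have "D \<inter> rect r h x = rect r h x" if "x \<in> A" using sub[OF that] by auto
    then show "ennreal (4 * r * h) * indicator A x \<le> emeasure lborel (D \<inter> rect r h x)"
      using rh by (auto simp: indicator_def emeasure_rect)
  qed
  also have "\<dots> = (\<integral>\<^sup>+z. indicator D z * ennreal (prob (rect r h z)) \<partial>lborel)"
    by (rule rect_mass_Fubini[symmetric]) measurable
  also have "\<dots> \<le> (\<integral>\<^sup>+z. ennreal (low_density * (r * h)) * indicator (rect 1101 1101 0) z \<partial>lborel)"
  proof (intro nn_integral_mono)
    fix z :: "real \<times> real"
    show "indicator D z * ennreal (prob (rect r h z)) \<le> ennreal (low_density * (r * h)) * indicator (rect 1101 1101 0) z"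
    proof (cases "z \<in> D")
      case True
      have "\<bar>fst z\<bar> \<le> norm z" "\<bar>snd z\<bar> \<le> norm z"
        using norm_fst_le[of "fst z" "snd z"] norm_snd_le[of "snd z" "fst z"] by (simp_all only: prod.collapse real_norm_def)
      then have "z \<in> rect 1101 1101 0" using True by (auto simp: D_def rect_def)
      moreover have "\<not> low_density * (r * h) \<le> prob (rect r h z)" using neg True unfolding D_def by blast
      ultimately show ?thesis using True by (auto intro!: ennreal_leI)
    qed auto
  qed
  also have "\<dots> = ennreal (low_density * (r * h)) * ennreal (4 * 1101 * 1101)"
    by (subst nn_integral_cmult_indicator) (auto simp: emeasure_rect)
  also have "\<dots> = ennreal (low_density * (r * h) * (4 * 1101 * 1101))"
    using rh low_density_pos by (subst ennreal_mult) auto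
  finally have "4 * r * h * ((1 / 384)\<^sup>2 / 2) \<le> low_density * (r * h) * (4 * 1101 * 1101)"
    using rh low_density_pos by (subst (asm) ennreal_le_iff) auto
  then show False using mult_pos_pos[OF rh(1,3)] mult_pos_pos[OF rh(3,1)] by (simp add: low_density_def power2_eq_square)
qed

text \<open>The centres of mass at least \<open>q\<close> form a convex set that meets every half
  plane at distance 1/768 from the origin. A point closer to the origin and outside this set would
  be separated from it by a line, which leaves such a half plane without a point of the set.\<close>

lemma rect_mass_lower:
  assumes z0: "norm z0 < 1 / 768" and rh: "0 < r" "r \<le> 1 / 1536" "0 < h" "h \<le> 1 / 1536"
  shows "low_density * (r * h) \<le> prob (rect r h z0)"
proof (rule ccontr)
  assume neg: "\<not> ?thesis"
  define q where "q = low_density * (r * h)"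
  have q: "q > 0" using rh low_density_pos by (simp add: q_def)
  define S where "S = {z. q \<le> prob (rect r h z)}"
  have "convex S" unfolding convex_alt
  proof (intro ballI allI impI)
    fix x y and t :: real assume xy: "x \<in> S" "y \<in> S" and t: "0 \<le> t \<and> t \<le> 1"
    show "(1 - t) *\<^sub>R x + t *\<^sub>R y \<in> S"
    proof (cases "t = 0 \<or> t = 1")
      case False
      then have t01: "t \<in> {0<..<1}" using t by auto
      have conv: "\<bar>(1 - t) * a + t * b - ((1 - t) * a' + t * b')\<bar> \<le> s" if "\<bar>a - a'\<bar> \<le> s" "\<bar>b - b'\<bar> \<le> s" for a b a' b' s
      proof -
        have "\<bar>(1 - t) * a + t * b - ((1 - t) * a' + t * b')\<bar> = \<bar>(1 - t) * (a - a') + t * (b - b')\<bar>" by (simp add: algebra_simps)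
        also have "\<dots> \<le> (1 - t) * \<bar>a - a'\<bar> + t * \<bar>b - b'\<bar>" using t by (intro order_trans[OF abs_triangle_ineq]) (simp add: abs_mult)
        also have "\<dots> \<le> s" using t that by (intro convex_bound_le) auto
        finally show ?thesis .
      qed
      have "q = q powr (1 - t) * q powr t" using q by (simp add: powr_add[symmetric])
      also have "\<dots> \<le> prob (rect r h x) powr (1 - t) * prob (rect r h y) powr t"
        using xy q t by (intro mult_mono powr_mono2) (auto simp: S_def)
      also have "\<dots> \<le> prob (rect r h ((1 - t) *\<^sub>R x + t *\<^sub>R y))"
        by (rule lc[unfolded log_concave_measure_def, rule_format, OF t01])
          (simp add: sets_mu | (auto simp: rect_def intro!: conv))+
      finally show ?thesis by (simp add: S_def)
    qed (use xy in auto)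
  qed
  then have cv: "convex ((\<lambda>x. - z0 + x) ` S)" by (rule convex_translation)
  have "0 \<notin> (\<lambda>x. - z0 + x) ` S" using neg by (auto simp: S_def q_def)
  from separating_hyperplane_set_0[OF cv this] obtain a where a: "a \<noteq> 0" and sep: "\<forall>x\<in>(\<lambda>x. - z0 + x) ` S. 0 \<le> a \<bullet> x"
    by blast
  have "norm (- a /\<^sub>R norm a) = 1" using a by simp
  from rect_mass_half_plane[OF this rh] obtain x where x: "1 / 768 \<le> (- a /\<^sub>R norm a) \<bullet> x" "x \<in> S"
    by (auto simp: S_def q_def)
  have "a \<bullet> z0 \<le> a \<bullet> x" using bspec[OF sep imageI[OF x(2)]] by (simp add: inner_add_right inner_diff_right)
  moreover have "a \<bullet> x \<le> - norm a / 768" using x(1) a by (simp add: field_simps)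
  moreover have "\<bar>a \<bullet> z0\<bar> \<le> norm a * norm z0" by (rule Cauchy_Schwarz_ineq2)
  moreover have "norm a * norm z0 < norm a * (1 / 768)" using z0 a by (intro mult_strict_left_mono) auto
  ultimately show False by linarith
qed

text \<open>For \<open>u\<close> near \<open>z / 2\<close> the reflected point
  \<open>2 u - z\<close> is near the origin, where rectangles have mass at least \<open>q\<close>;
  the midpoint inequality gives the rectangle at \<open>u\<close> mass at least
  \<open>sqrt (m * q)\<close>. The average of these masses over \<open>D\<close> only sees points
  far out, so Chebyshev bounds it by the inverse square of \<open>1 + |y|\<close>, and squaring
  gives the fourth power.\<close>

lemma rect_mass_upper:
  assumes rh: "0 < r" "r \<le> 1 / 1536" "0 < h" "h \<le> 1 / 1536"
  shows "prob (rect r h (0, y)) \<le> high_density * (r * h) / (1 + \<bar>y\<bar>) ^ 4"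
proof -
  \<comment> \<open>The reflected points have norm at most \<open>2 * b = 1/1000\<close>, below the
    radius 1/768 of the lower bound.\<close>
  define b :: real where "b = 1 / 2000"
  define z :: "real \<times> real" where "z = (0, y)"
  define m where "m = prob (rect r h z)"
  define q where "q = low_density * (r * h)"
  define D where "D = rect (b / 2) (b / 2) ((1/2) *\<^sub>R z)"
  have q: "q > 0" using rh low_density_pos by (simp add: q_def)
  have b: "b > 0" by (simp add: b_def)
  have D[measurable]: "D \<in> sets borel" unfolding D_def by measurable
  have low: "sqrt (m * q) \<le> prob (rect r h u)" if u: "u \<in> D" for u
  proof -
    have "\<bar>fst u\<bar> \<le> b / 2" "\<bar>snd u - y / 2\<bar> \<le> b / 2" using u by (simp_all add: D_def rect_def z_def)
    then have "\<bar>2 * fst u\<bar> \<le> b" "\<bar>2 * snd u - y\<bar> \<le> b" by linarith+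
    then have x0: "\<bar>fst (2 *\<^sub>R u - z)\<bar> \<le> b" "\<bar>snd (2 *\<^sub>R u - z)\<bar> \<le> b" by (simp_all add: z_def)
    have "norm (2 *\<^sub>R u - z) \<le> \<bar>fst (2 *\<^sub>R u - z)\<bar> + \<bar>snd (2 *\<^sub>R u - z)\<bar>"
      using norm_Pair_le[of "fst (2 *\<^sub>R u - z)" "snd (2 *\<^sub>R u - z)"] by (simp only: prod.collapse real_norm_def)
    then have "norm (2 *\<^sub>R u - z) < 1 / 768" using x0 by (simp add: b_def)
    then have "q \<le> prob (rect r h (2 *\<^sub>R u - z))" unfolding q_def by (rule rect_mass_lower) (use rh in auto)
    then have "m * q \<le> m * prob (rect r h (2 *\<^sub>R u - z))" by (intro mult_left_mono) (auto simp: m_def)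
    also have "\<dots> \<le> (prob (rect r h u))\<^sup>2" unfolding m_def
      by (rule midpoint_mass) (simp | (auto simp: rect_def abs_le_iff field_simps))+
    finally show ?thesis by (intro real_le_lsqrt) auto
  qed
  \<comment> \<open>For \<open>|y| < 4\<close> the bound exceeds 1; otherwise
    \<open>|y| / 2 - 1 \<ge> |y| / 4\<close> and \<open>5/4 * |y| \<ge> 1 + |y|\<close>.\<close>
  have far: "prob {x. \<bar>y\<bar> / 2 - 1 \<le> \<bar>snd x\<bar>} \<le> 25 / (1 + \<bar>y\<bar>)\<^sup>2"
  proof (cases "\<bar>y\<bar> < 4")
    case True
    have "(1 + \<bar>y\<bar>)\<^sup>2 \<le> 5\<^sup>2" using True by (intro power_mono) auto
    then have "1 \<le> 25 / (1 + \<bar>y\<bar>)\<^sup>2" by (simp add: field_simps)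
    then show ?thesis using prob_le_1 order_trans by blast
  next
    case False
    have "prob {x. \<bar>y\<bar> / 2 - 1 \<le> \<bar>snd x\<bar>} \<le> prob {x. \<bar>y\<bar> / 4 \<le> \<bar>(0, 1) \<bullet> x\<bar>}"
    proof (rule finite_measure_mono)
      show "{x. \<bar>y\<bar> / 2 - 1 \<le> \<bar>snd x\<bar>} \<subseteq> {x. \<bar>y\<bar> / 4 \<le> \<bar>(0, 1) \<bullet> x\<bar>}" using False by (auto simp: inner_prod_def)
    qed measurable
    also have "\<dots> \<le> (norm (0::real, 1::real))\<^sup>2 / (\<bar>y\<bar> / 4)\<^sup>2" using False by (intro second_moment_tail) auto
    also have "\<dots> = 16 / \<bar>y\<bar>\<^sup>2" by (simp add: norm_Pair power_divide)
    also have "\<dots> = 25 / (5 / 4 * \<bar>y\<bar>)\<^sup>2" using False by (simp add: power_mult_distrib power_divide)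
    also have "\<dots> \<le> 25 / (1 + \<bar>y\<bar>)\<^sup>2" using False by (intro divide_left_mono power_mono mult_pos_pos zero_less_power) auto
    finally show ?thesis .
  qed
  have "ennreal (sqrt (m * q) * b\<^sup>2) = (\<integral>\<^sup>+u. ennreal (sqrt (m * q)) * indicator D u \<partial>lborel)"
    using b q by (subst nn_integral_cmult_indicator) (auto simp: D_def emeasure_rect ennreal_mult[symmetric] power2_eq_square m_def)
  also have "\<dots> \<le> (\<integral>\<^sup>+u. indicator D u * ennreal (prob (rect r h u)) \<partial>lborel)"
    using low by (intro nn_integral_mono) (auto simp: indicator_def intro!: ennreal_leI)
  also have "\<dots> = (\<integral>\<^sup>+x. emeasure lborel (D \<inter> rect r h x) \<partial>\<mu>)" by (rule rect_mass_Fubini) measurable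
  also have "\<dots> \<le> (\<integral>\<^sup>+x. ennreal (4 * r * h) * indicator {x. \<bar>y\<bar> / 2 - 1 \<le> \<bar>snd x\<bar>} x \<partial>\<mu>)"
  proof (intro nn_integral_mono)
    fix x
    show "emeasure lborel (D \<inter> rect r h x) \<le> ennreal (4 * r * h) * indicator {x. \<bar>y\<bar> / 2 - 1 \<le> \<bar>snd x\<bar>} x"
    proof (cases "\<bar>y\<bar> / 2 - 1 \<le> \<bar>snd x\<bar>")
      case True
      have "emeasure lborel (D \<inter> rect r h x) \<le> emeasure lborel (rect r h x)" by (intro emeasure_mono) auto
      then show ?thesis using True rh by (simp add: emeasure_rect)
    next
      case False
      have "D \<inter> rect r h x = {}"
      proof (rule ccontr)
        assume "D \<inter> rect r h x \<noteq> {}"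
        then obtain u where "u \<in> D" "u \<in> rect r h x" by auto
        then have "\<bar>snd u - y / 2\<bar> \<le> b / 2" "\<bar>snd u - snd x\<bar> \<le> h" by (auto simp: D_def rect_def z_def)
        then have "\<bar>y\<bar> / 2 \<le> \<bar>snd x\<bar> + h + b / 2" by linarith
        then show False using False rh by (simp add: b_def)
      qed
      then show ?thesis by simp
    qed
  qed
  also have "\<dots> = ennreal (4 * r * h * prob {x. \<bar>y\<bar> / 2 - 1 \<le> \<bar>snd x\<bar>})"
    using rh borel_closed[OF closed_Collect_le[of "\<lambda>x :: real \<times> real. \<bar>y\<bar> / 2 - 1" "\<lambda>x. \<bar>snd x\<bar>"]] by (subst nn_integral_cmult_indicator) (auto simp: emeasure_eq_measure ennreal_mult sets_mu continuous_intros)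
  also have "\<dots> \<le> ennreal (4 * r * h * (25 / (1 + \<bar>y\<bar>)\<^sup>2))"
    using rh far by (intro ennreal_leI mult_left_mono) auto
  finally have "sqrt (m * q) * b\<^sup>2 \<le> 4 * r * h * (25 / (1 + \<bar>y\<bar>)\<^sup>2)"
    using rh by (subst (asm) ennreal_le_iff) auto
  then have "(sqrt (m * q) * b\<^sup>2)\<^sup>2 \<le> (4 * r * h * (25 / (1 + \<bar>y\<bar>)\<^sup>2))\<^sup>2"
    using q by (intro power_mono) (auto simp: m_def)
  moreover have sq: "(sqrt (m * q))\<^sup>2 = m * q" using q by (intro real_sqrt_pow2) (simp add: m_def)
  ultimately have "m * q * (b\<^sup>2)\<^sup>2 \<le> (4 * r * h * (25 / (1 + \<bar>y\<bar>)\<^sup>2))\<^sup>2" by (simp only: power_mult_distrib)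
  then have "m * low_density * b ^ 4 * (r * h) \<le> 10 ^ 4 * (r * h) / (1 + \<bar>y\<bar>) ^ 4 * (r * h)"
    by (simp add: m_def power_mult_distrib power_divide q_def power2_eq_square power4_eq_xxxx mult_ac)
  then have "m * low_density * b ^ 4 \<le> 10 ^ 4 * (r * h) / (1 + \<bar>y\<bar>) ^ 4"
    using mult_pos_pos[OF rh(1,3)] by (subst (asm) mult_le_cancel_right_pos)
  then show ?thesis using low_density_pos
    by (simp add: m_def[symmetric] z_def[symmetric] high_density_def b_def field_simps)
qed

section \<open>Masses of planar double cones\<close>

lemma double_cone_mass_lower:
  assumes s: "0 < s" "s \<le> 1"
  shows "low_density / 8000000 * s \<le> prob {x. \<bar>fst x\<bar> < s * \<bar>snd x\<bar>}"
proof -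
  \<comment> \<open>On this rectangle \<open>snd x \<ge> 1/2000\<close>, so the cone has half-width
    at least \<open>s / 2000\<close> there, twice that of the rectangle.\<close>
  have "low_density * (s / 4000 * (1 / 2000)) \<le> prob (rect (s / 4000) (1 / 2000) (0, 1 / 1000))"
    using s by (intro rect_mass_lower) (auto simp: norm_Pair)
  also have "\<dots> \<le> prob {x. \<bar>fst x\<bar> < s * \<bar>snd x\<bar>}"
  proof (rule finite_measure_mono)
    show "rect (s / 4000) (1 / 2000) (0, 1 / 1000) \<subseteq> {x. \<bar>fst x\<bar> < s * \<bar>snd x\<bar>}"
    proof
      fix x :: "real \<times> real" assume x: "x \<in> rect (s / 4000) (1 / 2000) (0, 1 / 1000)"
      then have "\<bar>snd x - 1 / 1000\<bar> \<le> 1 / 2000" by (simp add: rect_def)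
      then have "1 / 2000 \<le> snd x" by linarith
      then have "s * (1 / 2000) \<le> s * \<bar>snd x\<bar>" using s by (intro mult_left_mono) auto
      moreover have "\<bar>fst x\<bar> \<le> s / 4000" using x by (simp add: rect_def)
      ultimately show "x \<in> {x. \<bar>fst x\<bar> < s * \<bar>snd x\<bar>}" using s unfolding mem_Collect_eq by linarith
    qed
    have "open {x :: real \<times> real. \<bar>fst x\<bar> < s * \<bar>snd x\<bar>}" by (intro open_Collect_less continuous_intros)
    then show "{x. \<bar>fst x\<bar> < s * \<bar>snd x\<bar>} \<in> events" by (simp add: sets_mu)
  qed
  finally show ?thesis by simp
qed

text \<open>The cone is cut at height \<open>h / s\<close>. Beyond it Chebyshev leaves mass of order
  \<open>s\<^sup>2\<close>; below it the layer \<open>k\<close> fits into two rectangles small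
  enough for \<open>rect_mass_upper\<close>. Their width grows linearly in \<open>k\<close> while
  the density bound decays like the fourth power, so the layers are summable.\<close>

lemma double_cone_mass_upper:
  assumes s: "0 < s" "s \<le> 1"
  shows "prob {x. \<bar>fst x\<bar> \<le> s * \<bar>snd x\<bar>} \<le> (4 * high_density + 1) * 4000\<^sup>2 * s"
proof -
  define h :: real where "h = 1 / 4000"
  define K where "K = nat \<lceil>1 / s\<rceil>"
  define r where "r k = s * h * (real k + 1)" for k :: nat
  define R where "R k = rect (r k) h (0, h * real k) \<union> rect (r k) h (0, - (h * real k))" for k
  have h: "h > 0" by (simp add: h_def)
  have [measurable]: "R k \<in> events" for k unfolding R_def by (simp add: sets_mu)
  have sub: "{x. \<bar>fst x\<bar> \<le> s * \<bar>snd x\<bar>} \<subseteq> {x. h / s \<le> \<bar>(0, 1) \<bullet> x\<bar>} \<union> (\<Union>k\<in>{..<K}. R k)"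
  proof
    fix x :: "real \<times> real" assume x: "x \<in> {x. \<bar>fst x\<bar> \<le> s * \<bar>snd x\<bar>}"
    show "x \<in> {x. h / s \<le> \<bar>(0, 1) \<bullet> x\<bar>} \<union> (\<Union>k\<in>{..<K}. R k)"
    proof (cases "h / s \<le> \<bar>snd x\<bar>")
      case True
      then show ?thesis by (simp add: inner_prod_def)
    next
      case False
      define k where "k = nat \<lfloor>\<bar>snd x\<bar> / h\<rfloor>"
      have "0 \<le> \<bar>snd x\<bar> / h" using h by simp
      then have "real k \<le> \<bar>snd x\<bar> / h" "\<bar>snd x\<bar> / h < real k + 1" unfolding k_def by linarith+
      then have k: "h * real k \<le> \<bar>snd x\<bar>" "\<bar>snd x\<bar> \<le> h * (real k + 1)" using h by (auto simp: field_simps)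
      have "h * real k < h * (1 / s)" using k(1) False by simp
      then have "real k < 1 / s" using h by (subst (asm) mult_less_cancel_left_pos)
      then have "k < K" unfolding K_def by linarith
      have "s * \<bar>snd x\<bar> \<le> s * (h * (real k + 1))" using k s by (intro mult_left_mono) auto
      then have "\<bar>fst x\<bar> \<le> r k" using x by (simp add: r_def mult.assoc)
      then have "x \<in> R k" using k by (cases "snd x \<ge> 0") (auto simp: R_def rect_def abs_le_iff algebra_simps)
      then show ?thesis using \<open>k < K\<close> by auto
    qed
  qed
  have Rk: "prob (R k) \<le> 2 * high_density * 4000\<^sup>2 * s * (1 / (real k + 1)\<^sup>2)" if "k < K" for k
  proof -
    have "real k < 1 / s" using that unfolding K_def by linarith
    then have "s * real k < 1" using s by (simp add: field_simps)
    then have "s * (real k + 1) \<le> 2" using s by (simp add: algebra_simps)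
    then have rk: "0 < r k" "r k \<le> 1 / 1536" using s by (auto simp: r_def h_def)
    have hk: "h * (1 + real k) \<le> 1 + \<bar>h * real k\<bar>" by (simp add: h_def)
    have one: "prob (rect (r k) h (0, y)) \<le> high_density * 4000\<^sup>2 * s * (1 / (real k + 1)\<^sup>2)" if y: "\<bar>y\<bar> = h * real k" for y
    proof -
      have "prob (rect (r k) h (0, y)) \<le> high_density * (r k * h) / (1 + \<bar>y\<bar>) ^ 4"
        using rk by (intro rect_mass_upper) (auto simp: h_def)
      also have "\<dots> \<le> high_density * (r k * h) / (h * (1 + real k)) ^ 4"
        using rk h high_density_pos y hk by (intro divide_left_mono power_mono mult_nonneg_nonneg mult_pos_pos zero_less_power) (auto simp: h_def)
      also have "\<dots> = high_density * 4000\<^sup>2 * s * (1 / (real k + 1) ^ 3)"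
      proof -
        have "X * (s * g * a * g) / (g * a) ^ 4 = X * (1 / g)\<^sup>2 * s * (1 / a ^ 3)" if "g > 0" "a > 0" for X g a :: real
          using that by (simp add: divide_simps) (simp add: eval_nat_numeral)
        from this[of h "real k + 1" high_density] show ?thesis by (simp add: r_def h_def add.commute)
      qed
      also have "\<dots> \<le> high_density * 4000\<^sup>2 * s * (1 / (real k + 1)\<^sup>2)"
        using high_density_pos s by (intro mult_left_mono divide_left_mono power_increasing) auto
      finally show ?thesis .
    qed
    have "prob (R k) \<le> prob (rect (r k) h (0, h * real k)) + prob (rect (r k) h (0, - (h * real k)))"
      unfolding R_def by (rule measure_Un_le) (simp_all add: sets_mu)
    also have "\<dots> \<le> 2 * (high_density * 4000\<^sup>2 * s * (1 / (real k + 1)\<^sup>2))"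
      using one[of "h * real k"] one[of "- (h * real k)"] h by (simp add: abs_mult)
    finally show ?thesis by simp
  qed
  have "prob {x. \<bar>fst x\<bar> \<le> s * \<bar>snd x\<bar>} \<le> prob ({x. h / s \<le> \<bar>(0, 1) \<bullet> x\<bar>} \<union> (\<Union>k\<in>{..<K}. R k))"
    by (rule finite_measure_mono[OF sub]) measurable
  also have "\<dots> \<le> prob {x. h / s \<le> \<bar>(0, 1) \<bullet> x\<bar>} + prob (\<Union>k\<in>{..<K}. R k)"
    by (intro measure_Un_le) measurable
  also have "\<dots> \<le> (norm (0::real, 1::real))\<^sup>2 / (h / s)\<^sup>2 + (\<Sum>k<K. prob (R k))"
    using h s by (intro add_mono second_moment_tail finite_measure_subadditive_finite) auto
  also have "\<dots> \<le> 4000\<^sup>2 * s + (\<Sum>k<K. 2 * high_density * 4000\<^sup>2 * s * (1 / (real k + 1)\<^sup>2))"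
  proof (intro add_mono sum_mono Rk)
    have "s\<^sup>2 \<le> s" using s by (simp add: power2_eq_square mult_left_le)
    then show "(norm (0::real, 1::real))\<^sup>2 / (h / s)\<^sup>2 \<le> 4000\<^sup>2 * s" by (simp add: norm_Pair h_def power_divide power_mult_distrib)
  qed auto
  also have "(\<Sum>k<K. 2 * high_density * 4000\<^sup>2 * s * (1 / (real k + 1)\<^sup>2)) = 2 * high_density * 4000\<^sup>2 * s * (\<Sum>k<K. 1 / (real k + 1)\<^sup>2)"
    by (simp add: sum_distrib_left)
  also have "\<dots> \<le> 2 * high_density * 4000\<^sup>2 * s * 2"
    using sum_inverse_squares[of K] high_density_pos s by (intro mult_left_mono) (auto intro: order_trans)
  finally show ?thesis by (simp add: algebra_simps)
qed

end

section \<open>Disagreement of halfspaces and angle\<close>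

lemma sum_square_affine:
  fixes u v :: "nat \<Rightarrow> real"
  shows "(\<Sum>i<d. (a * u i + b * v i) * (a' * u i + b' * v i))
    = a * a' * (\<Sum>i<d. u i * u i) + (a * b' + b * a') * (\<Sum>i<d. u i * v i) + b * b' * (\<Sum>i<d. v i * v i)"
  by (simp add: sum_distrib_left sum.distrib[symmetric] algebra_simps)

definition disagreement :: "'z measure \<Rightarrow> ('z \<Rightarrow> int) \<Rightarrow> ('z \<Rightarrow> int) \<Rightarrow> real" where
  "disagreement M f g = measure M {x\<in>space M. f x \<noteq> g x}"

text \<open>The first value serves proper angles, where the normals are \<open>2 * s\<close> apart;
  the second serves opposite normals, which are 2 apart.\<close>

definition angle_low :: real where "angle_low = min (low_density / 16000000) ((1 / 384)\<^sup>2 / 2)"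
definition angle_high :: real where "angle_high = (4 * high_density + 1) * 4000\<^sup>2"

lemma angle_low_pos: "angle_low > 0" using low_density_pos by (simp add: angle_low_def)
lemma angle_high_ge_1: "angle_high \<ge> 1" using high_density_pos by (simp add: angle_high_def)

lemma measurable_linear_form [measurable]:
  "(\<lambda>x. \<Sum>i<d. w i * x i) \<in> borel_measurable (lebesgue_R d)"
  unfolding lebesgue_R_def by measurable

lemma measurable_halfspace [measurable]: "halfspace d w \<in> lebesgue_R d \<rightarrow>\<^sub>M count_space UNIV"
  unfolding halfspace_def by measurable

locale isotropic_log_concave =
  fixes d :: nat and M :: "(nat \<Rightarrow> real) measure"
  assumes lcd: "log_concave_distribution d M" and zm: "zero_mean d M" and iso: "isotropic d M"
begin

sublocale prob_space M using lcd by (simp add: log_concave_distribution_def)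

lemma sets_M [measurable_cong]: "sets M = sets (lebesgue_R d)"
  using lcd by (auto simp: log_concave_distribution_def)

abbreviation lin :: "(nat \<Rightarrow> real) \<Rightarrow> (nat \<Rightarrow> real) \<Rightarrow> real" where
  "lin w x \<equiv> (\<Sum>i<d. w i * x i)"

lemma lin_integrable: "integrable M (lin w)"
  using zm by (auto simp: zero_mean_def intro!: Bochner_Integration.integrable_sum)

lemma lin_mean: "expectation (lin w) = 0"
  using zm by (subst Bochner_Integration.integral_sum) (auto simp: zero_mean_def)

lemma lin_prod_eq: "lin w x * lin v x = (\<Sum>i<d. \<Sum>j<d. w i * v j * (x i * x j))"
  unfolding sum_product by (intro sum.cong refl) (simp add: mult_ac)

lemma lin_prod_integrable: "integrable M (\<lambda>x. lin w x * lin v x)"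
  unfolding lin_prod_eq using iso by (auto simp: isotropic_def intro!: Bochner_Integration.integrable_sum)

lemma lin_prod_mean: "expectation (\<lambda>x. lin w x * lin v x) = (\<Sum>i<d. w i * v i)"
proof -
  have "expectation (\<lambda>x. lin w x * lin v x) = (\<Sum>i<d. \<Sum>j<d. w i * v j * expectation (\<lambda>x. x i * x j))"
    unfolding lin_prod_eq using iso
    by (subst Bochner_Integration.integral_sum, force simp: isotropic_def intro!: Bochner_Integration.integrable_sum)+
      (auto simp: isotropic_def intro!: sum.cong)
  also have "\<dots> = (\<Sum>i<d. \<Sum>j<d. if i = j then w i * v j else 0)"
    using iso by (intro sum.cong refl) (auto simp: isotropic_def)
  also have "\<dots> = (\<Sum>i<d. w i * v i)" by (intro sum.cong refl) (simp add: sum.delta)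
  finally show ?thesis .
qed

text \<open>Needed for opposite normals, where no second direction is available; in dimension one
  there is no plane to project to at all.\<close>

lemma linear_form_half_line_mass:
  assumes "(\<Sum>i<d. w i * w i) = 1"
  shows "prob {x\<in>space M. 1 / 384 \<le> lin w x} \<ge> (1 / 384)\<^sup>2"
proof (rule half_line_mass)
  have eq: "lin w = (\<lambda>x. \<Sum>i<d. x i *\<^sub>R w i)" by (simp add: mult.commute)
  have lc: "log_concave_measure (distr M borel (lin w))"
    using log_concave_linear_image[OF lcd, of w] unfolding eq .
  have m: "prob {x\<in>space M. P (lin w x)} = measure (distr M borel (lin w)) {z. P z}" if "{z. P z} \<in> sets borel" for P
    using that by (subst measure_distr) (auto intro!: arg_cong[where f=prob])
  fix T :: real assume T: "T > 0"
  show "prob {x\<in>space M. 3 * T < lin w x} * prob {x\<in>space M. \<bar>lin w x\<bar> \<le> T} \<le> (prob {x\<in>space M. T < lin w x})\<^sup>2"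
    by (subst (1 2 3) m) (auto intro!: log_concave_midpoint[OF lc])
  show "prob {x\<in>space M. lin w x < - (3 * T)} * prob {x\<in>space M. \<bar>lin w x\<bar> \<le> T} \<le> (prob {x\<in>space M. lin w x < - T})\<^sup>2"
    by (subst (1 2 3) m) (auto intro!: log_concave_midpoint[OF lc])
qed (use assms lin_integrable lin_mean lin_prod_integrable[of w w] lin_prod_mean[of w w] in \<open>auto simp: power2_eq_square\<close>)

lemma plane_projection:
  assumes "(\<Sum>i<d. u i * u i) = 1" "(\<Sum>i<d. v i * v i) = 1" "(\<Sum>i<d. u i * v i) = 0"
  shows "isotropic_plane (distr M borel (\<lambda>x. (lin u x, lin v x)))"
proof -
  define L where "L = (\<lambda>x. (lin u x, lin v x))"
  have eq: "L = (\<lambda>x. \<Sum>i<d. x i *\<^sub>R (u i, v i))"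
    by (auto simp: L_def fun_eq_iff prod_eq_iff fst_sum snd_sum mult.commute)
  have [measurable]: "L \<in> borel_measurable M" unfolding eq by measurable
  have inner: "e \<bullet> L x = lin (\<lambda>i. fst e * u i + snd e * v i) x" for e x
    by (simp add: L_def inner_prod_def sum_distrib_left sum.distrib[symmetric] algebra_simps)
  interpret D: prob_space "distr M borel L" by (rule prob_space_distr) measurable
  have var: "expectation (\<lambda>x. (e \<bullet> L x)\<^sup>2) = (norm e)\<^sup>2" for e
    unfolding inner power2_eq_square lin_prod_mean sum_square_affine
    using assms by (simp add: norm_prod_def power2_eq_square[symmetric])
  have "isotropic_plane (distr M borel L)"
  proof
    show "log_concave_measure (distr M borel L)" unfolding eq by (rule log_concave_linear_image[OF lcd])
    fix e :: "real \<times> real"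
    show "integrable (distr M borel L) (\<lambda>x. e \<bullet> x)"
      by (subst integrable_distr_eq) (auto simp: inner lin_integrable)
    show "integrable (distr M borel L) (\<lambda>x. (e \<bullet> x)\<^sup>2)"
      by (subst integrable_distr_eq) (auto simp: inner power2_eq_square lin_prod_integrable)
    show "(\<integral>x. e \<bullet> x \<partial>distr M borel L) = 0"
      by (subst integral_distr) (auto simp: inner lin_mean)
    show "(\<integral>x. (e \<bullet> x)\<^sup>2 \<partial>distr M borel L) = (norm e)\<^sup>2"
      by (subst integral_distr) (auto simp: var)
  qed simp
  then show ?thesis by (simp add: L_def)
qed

lemma disagreement_le_1: "disagreement M f g \<le> 1"
  by (simp add: disagreement_def)

text \<open>The half sum \<open>m\<close> and half difference \<open>k\<close> of two unit normals
  are orthogonal, with lengths \<open>c\<close> and \<open>s\<close>, the cosine and sine of half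
  the angle. Up to the boundary, the signs differ where \<open>|lin m x| < |lin k x|\<close>, a
  double cone in the plane of \<open>m\<close> and \<open>k\<close>.\<close>

lemma disagreement_angle:
  assumes w: "(\<Sum>i<d. w i * w i) = 1" and v: "(\<Sum>i<d. v i * v i) = 1"
  defines "D \<equiv> L2_set (\<lambda>i. w i - v i) {..<d}"
  shows "angle_low * D \<le> disagreement M (halfspace d w) (halfspace d v)"
    and "disagreement M (halfspace d w) (halfspace d v) \<le> angle_high * D"
proof -
  define m where "m = (\<lambda>i. (w i + v i) / 2)"
  define k where "k = (\<lambda>i. (v i - w i) / 2)"
  define p where "p = (\<Sum>i<d. w i * v i)"
  have mm: "(\<Sum>i<d. m i * m i) = (1 + p) / 2" and kk: "(\<Sum>i<d. k i * k i) = (1 - p) / 2" and mk: "(\<Sum>i<d. m i * k i) = 0"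
    using sum_square_affine[where d=d and u=w and v=v and a="1/2" and b="1/2" and a'="1/2" and b'="1/2"] sum_square_affine[where d=d and u=w and v=v and a="-1/2" and b="1/2" and a'="-1/2" and b'="1/2"]
      sum_square_affine[where d=d and u=w and v=v and a="1/2" and b="1/2" and a'="-1/2" and b'="1/2"] w v
    by (simp_all add: m_def k_def p_def add_divide_distrib diff_divide_distrib)
  have nn: "0 \<le> (\<Sum>i<d. m i * m i)" "0 \<le> (\<Sum>i<d. k i * k i)" by (auto intro!: sum_nonneg)
  define c where "c = sqrt ((1 + p) / 2)"
  define s where "s = sqrt ((1 - p) / 2)"
  have cs: "c\<^sup>2 = (1 + p) / 2" "s\<^sup>2 = (1 - p) / 2" "0 \<le> c" "0 \<le> s" using nn mm kk by (auto simp: c_def s_def)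
  have cs1: "c\<^sup>2 + s\<^sup>2 = 1" using cs by simp
  have "D\<^sup>2 = (\<Sum>i<d. (w i - v i)\<^sup>2)" unfolding D_def L2_set_def by (intro real_sqrt_pow2 sum_nonneg) auto
  also have "\<dots> = (2 * s)\<^sup>2"
    using sum_square_affine[where d=d and u=w and v=v and a="1" and b="-1" and a'="1" and b'="-1"] w v cs by (simp add: p_def power2_eq_square)
  finally have Ds: "D = 2 * s" using cs(4) by (subst (asm) power2_eq_iff_nonneg) (auto simp: D_def L2_set_nonneg)
  have lw: "lin w x = lin m x - lin k x" and lv: "lin v x = lin m x + lin k x" for x
    by (simp_all add: m_def k_def sum_subtractf[symmetric] sum.distrib[symmetric] algebra_simps add_divide_distrib diff_divide_distrib)
  have lower: "prob {x\<in>space M. \<bar>lin m x\<bar> < \<bar>lin k x\<bar>} \<le> disagreement M (halfspace d w) (halfspace d v)"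
    unfolding disagreement_def by (intro finite_measure_mono) (auto simp: halfspace_def lw lv)
  have upper: "disagreement M (halfspace d w) (halfspace d v) \<le> prob {x\<in>space M. \<bar>lin m x\<bar> \<le> \<bar>lin k x\<bar>}"
    unfolding disagreement_def by (intro finite_measure_mono) (auto simp: halfspace_def lw lv split: if_splits)
  have "angle_low * D \<le> disagreement M (halfspace d w) (halfspace d v) \<and> disagreement M (halfspace d w) (halfspace d v) \<le> angle_high * D"
  \<comment> \<open>Equal or opposite normals span no plane; in dimension one these are the only
    cases.\<close>
  proof (cases "s = 0 \<or> c = 0")
    case False
    then have c: "c > 0" and s: "s > 0" using cs by auto
    have "s\<^sup>2 \<le> 1\<^sup>2" unfolding power_one using cs1 zero_le_power2[of c] by linarith
    then have s1: "s \<le> 1" by (rule power2_le_imp_le) simp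
    define u1 where "u1 = (\<lambda>i. m i / c)"
    define u2 where "u2 = (\<lambda>i. k i / s)"
    have "(\<Sum>i<d. u1 i * u1 i) = (\<Sum>i<d. m i * m i) / c\<^sup>2" "(\<Sum>i<d. u2 i * u2 i) = (\<Sum>i<d. k i * k i) / s\<^sup>2"
      "(\<Sum>i<d. u1 i * u2 i) = (\<Sum>i<d. m i * k i) / (c * s)"
      by (simp_all add: u1_def u2_def sum_divide_distrib power2_eq_square)
    then have "(\<Sum>i<d. u1 i * u1 i) = 1" "(\<Sum>i<d. u2 i * u2 i) = 1" "(\<Sum>i<d. u1 i * u2 i) = 0"
      using mm kk mk cs c s by auto
    then interpret P: isotropic_plane "distr M borel (\<lambda>x. (lin u1 x, lin u2 x))" by (rule plane_projection)
    have lm: "lin m x = c * lin u1 x" and lk: "lin k x = s * lin u2 x" for x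
      using c s by (simp_all add: u1_def u2_def sum_distrib_left)
    have pm: "P.prob {z. Q (fst z) (snd z)} = prob {x\<in>space M. Q (lin u1 x) (lin u2 x)}"
      if "{z :: real \<times> real. Q (fst z) (snd z)} \<in> sets borel" for Q
      using that by (subst measure_distr) (auto intro!: arg_cong[where f=prob])
    have "low_density / 8000000 * s \<le> P.prob {z. \<bar>fst z\<bar> < s * \<bar>snd z\<bar>}"
      by (rule P.double_cone_mass_lower) (use s s1 in auto)
    also have "\<dots> = prob {x\<in>space M. \<bar>lin u1 x\<bar> < s * \<bar>lin u2 x\<bar>}"
    proof (rule pm[of "\<lambda>a b. \<bar>a\<bar> < s * \<bar>b\<bar>"])
      have "open {z :: real \<times> real. \<bar>fst z\<bar> < s * \<bar>snd z\<bar>}" by (intro open_Collect_less continuous_intros)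
      then show "{z :: real \<times> real. \<bar>fst z\<bar> < s * \<bar>snd z\<bar>} \<in> sets borel" by simp
    qed
    also have "\<dots> \<le> prob {x\<in>space M. \<bar>lin m x\<bar> < \<bar>lin k x\<bar>}"
    proof (rule finite_measure_mono)
      have "c\<^sup>2 \<le> 1\<^sup>2" unfolding power_one using cs1 zero_le_power2[of s] by linarith
      then have c1: "c \<le> 1" by (rule power2_le_imp_le) simp
      have "\<bar>lin m x\<bar> \<le> \<bar>lin u1 x\<bar>" for x using c c1 by (simp add: lm abs_mult mult_left_le_one_le)
      then show "{x\<in>space M. \<bar>lin u1 x\<bar> < s * \<bar>lin u2 x\<bar>} \<subseteq> {x\<in>space M. \<bar>lin m x\<bar> < \<bar>lin k x\<bar>}"
        using s by (auto simp: lk abs_mult intro: le_less_trans)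
    qed measurable
    finally have 1: "low_density / 8000000 * s \<le> disagreement M (halfspace d w) (halfspace d v)" using lower by linarith
    have "angle_low * D \<le> low_density / 16000000 * (2 * s)" unfolding Ds angle_low_def using s by (intro mult_right_mono) auto
    then have lo: "angle_low * D \<le> disagreement M (halfspace d w) (halfspace d v)" using 1 by simp
    have hi: "disagreement M (halfspace d w) (halfspace d v) \<le> angle_high * D"
    \<comment> \<open>For \<open>s \<le> 1/2\<close> the cosine is at least 1/2, so normalising
      \<open>m\<close> at most doubles the opening. For larger \<open>s\<close> the claimed bound
      exceeds 1.\<close>
    proof (cases "2 * s \<le> 1")
      case True
      have "c \<ge> 1 / 2"
      proof (rule power2_le_imp_le)
        have "(2 * s)\<^sup>2 \<le> 1\<^sup>2" using True s by (intro power_mono) auto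
        then show "(1 / 2)\<^sup>2 \<le> c\<^sup>2" using cs1 by (simp add: power2_eq_square)
      qed (use c in auto)
      have "prob {x\<in>space M. \<bar>lin m x\<bar> \<le> \<bar>lin k x\<bar>} \<le> prob {x\<in>space M. \<bar>lin u1 x\<bar> \<le> 2 * s * \<bar>lin u2 x\<bar>}"
      proof (rule finite_measure_mono)
        have double: "a \<le> 2 * s * b" if "1 / 2 * a \<le> t" "t = s * b" for a b t :: real using that by simp
        have u1: "1 / 2 * \<bar>lin u1 x\<bar> \<le> \<bar>lin m x\<bar>" for x
          unfolding lm abs_mult using \<open>c \<ge> 1 / 2\<close> by (intro mult_right_mono) auto
        have u2: "\<bar>lin k x\<bar> = s * \<bar>lin u2 x\<bar>" for x using s by (simp only: lk abs_mult abs_of_pos)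
        have cone: "\<bar>lin u1 x\<bar> \<le> 2 * s * \<bar>lin u2 x\<bar>" if "\<bar>lin m x\<bar> \<le> \<bar>lin k x\<bar>" for x
          by (rule double[OF order_trans[OF u1 that] u2])
        show "{x\<in>space M. \<bar>lin m x\<bar> \<le> \<bar>lin k x\<bar>} \<subseteq> {x\<in>space M. \<bar>lin u1 x\<bar> \<le> 2 * s * \<bar>lin u2 x\<bar>}"
          by (intro Collect_mono impI, elim conjE, intro conjI, assumption, rule cone, assumption)
      qed measurable
      also have "\<dots> = P.prob {z. \<bar>fst z\<bar> \<le> 2 * s * \<bar>snd z\<bar>}"
      proof (rule pm[of "\<lambda>a b. \<bar>a\<bar> \<le> 2 * s * \<bar>b\<bar>", symmetric])
        have "closed {z :: real \<times> real. \<bar>fst z\<bar> \<le> 2 * s * \<bar>snd z\<bar>}" by (intro closed_Collect_le continuous_intros)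
        then show "{z :: real \<times> real. \<bar>fst z\<bar> \<le> 2 * s * \<bar>snd z\<bar>} \<in> sets borel" by simp
      qed
      also have "\<dots> \<le> angle_high * (2 * s)" unfolding angle_high_def
        by (rule P.double_cone_mass_upper) (use s True in auto)
      finally show ?thesis using upper Ds by simp
    next
      case False
      have "1 * 1 \<le> angle_high * D" using angle_high_ge_1 False Ds by (intro mult_mono) auto
      then show ?thesis using disagreement_le_1[of "halfspace d w" "halfspace d v"] by simp
    qed
    show ?thesis using lo hi by simp
  next
    case True
    show ?thesis
    proof (cases "s = 0")
      case True
      then have "(\<Sum>i<d. k i * k i) = 0" using cs kk by simp
      then have "\<forall>i<d. k i = 0" by (subst (asm) sum_nonneg_eq_0_iff) auto
      then have "halfspace d w x = halfspace d v x" for x by (simp add: halfspace_def k_def)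
      then show ?thesis using True Ds by (simp add: disagreement_def)
    next
      case False
      then have "c = 0" using True by simp
      then have "s\<^sup>2 = 1\<^sup>2" using cs1 by simp
      then have s1: "s = 1" using cs(4) by (subst (asm) power2_eq_iff_nonneg) auto
      have "(\<Sum>i<d. m i * m i) = 0" using cs mm \<open>c = 0\<close> by simp
      then have "\<forall>i<d. m i = 0" by (subst (asm) sum_nonneg_eq_0_iff) auto
      then have lm: "lin m x = 0" for x by simp
      have "(1 / 384)\<^sup>2 \<le> prob {x\<in>space M. 1 / 384 \<le> lin w x}" by (rule linear_form_half_line_mass[OF w])
      also have "\<dots> \<le> prob {x\<in>space M. \<bar>lin m x\<bar> < \<bar>lin k x\<bar>}" unfolding lm
        by (intro finite_measure_mono) (auto simp: lw lm)
      finally have 1: "(1 / 384)\<^sup>2 \<le> disagreement M (halfspace d w) (halfspace d v)" using lower by linarith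
      have "angle_low * D \<le> (1 / 384)\<^sup>2 / 2 * 2" unfolding Ds s1 angle_low_def by simp
      moreover have "1 * 1 \<le> angle_high * D" using angle_high_ge_1 Ds s1 by (intro mult_mono) auto
      ultimately show ?thesis using 1 disagreement_le_1[of "halfspace d w" "halfspace d v"] by simp
    qed
  qed
  then show "angle_low * D \<le> disagreement M (halfspace d w) (halfspace d v)"
    and "disagreement M (halfspace d w) (halfspace d v) \<le> angle_high * D" by auto
qed

end

section \<open>Lattice cells and coverings\<close>

lemma sum_exp_neg_square: "(\<Sum>k\<in>{-int m..int m}. exp (- (real_of_int k)\<^sup>2)) \<le> 3"
proof -
  have half: "exp (-1) \<le> (1 / 2 :: real)"
    using exp_ge_add_one_self[of "1::real"] by (simp add: exp_minus field_simps)
  have "(\<Sum>k\<in>{-int m..int m}. exp (- (real_of_int k)\<^sup>2)) \<le> 3 - 2 * (1 / 2) ^ m"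
  proof (induction m)
    case (Suc m)
    have "{-int (Suc m)..int (Suc m)} = insert (- int (Suc m)) (insert (int (Suc m)) {-int m..int m})" by auto
    then have "(\<Sum>k\<in>{-int (Suc m)..int (Suc m)}. exp (- (real_of_int k)\<^sup>2))
        = 2 * exp (- (real (Suc m))\<^sup>2) + (\<Sum>k\<in>{-int m..int m}. exp (- (real_of_int k)\<^sup>2))"
      by (simp add: power2_eq_square algebra_simps)
    moreover have "exp (- (real (Suc m))\<^sup>2) \<le> (1 / 2) ^ Suc m"
    proof -
      have "exp (- (real (Suc m))\<^sup>2) \<le> exp (- real (Suc m))"
        using self_le_power[of "real (Suc m)" 2] by simp
      also have "\<dots> = exp (-1) ^ Suc m" by (simp only: exp_of_nat_mult[symmetric] mult_minus_right mult_1_right)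
      also have "\<dots> \<le> (1 / 2) ^ Suc m" using half by (rule power_mono) simp
      finally show ?thesis .
    qed
    moreover have "2 * (1 / 2 :: real) ^ Suc m = (1 / 2) ^ m" by simp
    ultimately show ?case using Suc by linarith
  qed simp
  also have "\<dots> \<le> 3" by simp
  finally show ?thesis .
qed

text \<open>Lattice points are counted through the generating function: each point of the ball contributes
  at least \<open>1\<close> to \<open>e\<^sup>K\<^sup>d \<Sum>\<^sub>z e\<close> raised to \<open>-|z|\<^sup>2\<close>, and that sum is a product over the coordinates.\<close>

lemma card_lattice_points:
  fixes d :: nat and K :: real
  assumes K: "K \<ge> 0"
  defines "Z \<equiv> {z \<in> {..<d} \<rightarrow>\<^sub>E (UNIV :: int set). (\<Sum>i<d. (real_of_int (z i))\<^sup>2) \<le> K * real d}"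
  shows "finite Z" and "real (card Z) \<le> exp (real d * (K + 2))"
proof -
  define m where "m = nat \<lceil>K * real d\<rceil>"
  have sub: "Z \<subseteq> {..<d} \<rightarrow>\<^sub>E {-int m..int m}"
  proof
    fix z assume z: "z \<in> Z"
    have "z i \<in> {-int m..int m}" if "i < d" for i
    proof -
      have "(real_of_int (z i))\<^sup>2 \<le> (\<Sum>i<d. (real_of_int (z i))\<^sup>2)" using that by (intro member_le_sum) auto
      also have "\<dots> \<le> K * real d" using z by (simp add: Z_def)
      also have "\<dots> \<le> real m" unfolding m_def by linarith
      finally have "(z i)\<^sup>2 \<le> int m" by (metis of_int_le_iff of_int_of_nat_eq of_int_power)
      moreover have "\<bar>z i\<bar> \<le> (z i)\<^sup>2"
        using mult_left_mono[of 1 "\<bar>z i\<bar>" "\<bar>z i\<bar>"] by (cases "z i = 0") (auto simp: power2_eq_square)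
      ultimately show ?thesis by (simp add: abs_le_iff)
    qed
    then show "z \<in> {..<d} \<rightarrow>\<^sub>E {-int m..int m}" using z by (auto simp: Z_def PiE_def Pi_def)
  qed
  have fin: "finite ({..<d} \<rightarrow>\<^sub>E {-int m..int m})" by (intro finite_PiE) auto
  show "finite Z" using finite_subset[OF sub fin] .
  have "real (card Z) = (\<Sum>z\<in>Z. 1)" by simp
  also have "\<dots> \<le> (\<Sum>z\<in>Z. exp (K * real d) * (\<Prod>i<d. exp (- (real_of_int (z i))\<^sup>2)))"
  proof (intro sum_mono)
    fix z assume "z \<in> Z"
    then have "0 \<le> K * real d + (\<Sum>i<d. - (real_of_int (z i))\<^sup>2)" by (simp add: Z_def sum_negf)
    then have "1 \<le> exp (K * real d + (\<Sum>i<d. - (real_of_int (z i))\<^sup>2))" by simp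
    then show "1 \<le> exp (K * real d) * (\<Prod>i<d. exp (- (real_of_int (z i))\<^sup>2))" by (simp add: exp_add exp_sum)
  qed
  also have "\<dots> \<le> (\<Sum>z\<in>{..<d} \<rightarrow>\<^sub>E {-int m..int m}. exp (K * real d) * (\<Prod>i<d. exp (- (real_of_int (z i))\<^sup>2)))"
    using sub fin by (intro sum_mono2) (auto intro!: mult_nonneg_nonneg prod_nonneg)
  also have "\<dots> = exp (K * real d) * (\<Prod>i<d. \<Sum>k\<in>{-int m..int m}. exp (- (real_of_int k)\<^sup>2))"
    by (subst prod_sum_PiE) (auto simp: sum_distrib_left)
  also have "\<dots> \<le> exp (K * real d) * (\<Prod>i<d. exp 2)"
  proof (intro mult_left_mono prod_mono conjI)
    have "(3::real) \<le> exp 2" using exp_ge_add_one_self[of "2::real"] by simp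
    then show "(\<Sum>k\<in>{-int m..int m}. exp (- (real_of_int k)\<^sup>2)) \<le> exp 2" using sum_exp_neg_square[of m] by linarith
  qed (auto intro!: sum_nonneg)
  also have "\<dots> = exp (real d * (K + 2))" by (simp add: exp_of_nat_mult[symmetric] exp_add[symmetric] algebra_simps)
  finally show "real (card Z) \<le> exp (real d * (K + 2))" .
qed

text \<open>Grid cells of side \<open>\<epsilon> / sqrt d\<close> have diameter
  \<open>\<epsilon>\<close>, and in grid units the squared radius of the ball is
  \<open>R\<^sup>2 * d\<close>, linear in \<open>d\<close>, so the number of cells is exponential in
  \<open>d\<close>. The result is a labelling rather than a set of centres: centres of a covering
  must belong to the covered class and are picked later, one per cell.\<close>

lemma euclidean_cells:
  fixes w0 :: "nat \<Rightarrow> real" and R \<epsilon> :: real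
  assumes d: "d \<ge> 1" and \<epsilon>: "\<epsilon> > 0"
    and W: "\<And>w. w \<in> W \<Longrightarrow> L2_set (\<lambda>i. w i - w0 i) {..<d} \<le> R * \<epsilon>"
  shows "\<exists>c :: (nat \<Rightarrow> real) \<Rightarrow> nat \<Rightarrow> int. finite (c ` W) \<and> real (card (c ` W)) \<le> exp (real d * (2 * R\<^sup>2 + 4)) \<and>
    (\<forall>w\<in>W. \<forall>v\<in>W. c w = c v \<longrightarrow> L2_set (\<lambda>i. w i - v i) {..<d} \<le> \<epsilon>)"
proof -
  define y where "y w i = (w i - w0 i) * sqrt (real d) / \<epsilon>" for w i
  define c where "c w = (\<lambda>i\<in>{..<d}. \<lfloor>y w i\<rfloor>)" for w
  define Z where "Z = {z \<in> {..<d} \<rightarrow>\<^sub>E (UNIV :: int set). (\<Sum>i<d. (real_of_int (z i))\<^sup>2) \<le> (2 * R\<^sup>2 + 2) * real d}"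
  have Z: "finite Z" "real (card Z) \<le> exp (real d * (2 * R\<^sup>2 + 2 + 2))"
    unfolding Z_def by (rule card_lattice_points; simp)+
  have sub: "c ` W \<subseteq> Z"
  proof (rule image_subsetI)
    fix w assume w: "w \<in> W"
    have "(\<Sum>i<d. (w i - w0 i)\<^sup>2) = (L2_set (\<lambda>i. w i - w0 i) {..<d})\<^sup>2"
      unfolding L2_set_def by (intro real_sqrt_pow2[symmetric] sum_nonneg) auto
    also have "\<dots> \<le> (R * \<epsilon>)\<^sup>2" using W[OF w] by (intro power_mono) (auto simp: L2_set_nonneg)
    finally have 1: "(\<Sum>i<d. (w i - w0 i)\<^sup>2) \<le> (R * \<epsilon>)\<^sup>2" .
    have "(\<Sum>i<d. (y w i)\<^sup>2) = (\<Sum>i<d. (w i - w0 i)\<^sup>2) * (real d / \<epsilon>\<^sup>2)"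
      by (simp add: y_def power_mult_distrib power_divide sum_distrib_right sum_divide_distrib)
    also have "\<dots> \<le> (R * \<epsilon>)\<^sup>2 * (real d / \<epsilon>\<^sup>2)" using 1 by (intro mult_right_mono) auto
    also have "\<dots> = R\<^sup>2 * real d" using \<epsilon> by (simp add: power_mult_distrib)
    finally have 2: "(\<Sum>i<d. (y w i)\<^sup>2) \<le> R\<^sup>2 * real d" .
    have "(\<Sum>i<d. (real_of_int (c w i))\<^sup>2) \<le> (\<Sum>i<d. 2 * (y w i)\<^sup>2 + 2)"
    proof (intro sum_mono)
      fix i assume i: "i \<in> {..<d}"
      have "\<bar>real_of_int \<lfloor>y w i\<rfloor>\<bar> \<le> \<bar>\<bar>y w i\<bar> + 1\<bar>" by linarith
      then have "(real_of_int \<lfloor>y w i\<rfloor>)\<^sup>2 \<le> (\<bar>y w i\<bar> + 1)\<^sup>2" by (rule abs_le_square_iff[THEN iffD1])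
      also have "\<dots> \<le> 2 * (y w i)\<^sup>2 + 2"
        using zero_le_power2[of "\<bar>y w i\<bar> - 1"] by (simp add: power2_eq_square algebra_simps)
      finally show "(real_of_int (c w i))\<^sup>2 \<le> 2 * (y w i)\<^sup>2 + 2" using i by (simp add: c_def)
    qed
    also have "\<dots> = 2 * (\<Sum>i<d. (y w i)\<^sup>2) + 2 * real d" by (simp add: sum.distrib sum_distrib_left)
    also have "\<dots> \<le> (2 * R\<^sup>2 + 2) * real d" using 2 by (simp add: algebra_simps)
    finally show "c w \<in> Z" by (auto simp: Z_def c_def)
  qed
  have "L2_set (\<lambda>i. w i - v i) {..<d} \<le> \<epsilon>" if "c w = c v" for w v
  proof -
    have "(\<Sum>i<d. (w i - v i)\<^sup>2) \<le> (\<Sum>i<d. \<epsilon>\<^sup>2 / real d)"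
    proof (intro sum_mono)
      fix i assume i: "i \<in> {..<d}"
      have "\<lfloor>y w i\<rfloor> = \<lfloor>y v i\<rfloor>" using fun_cong[OF that, of i] i by (simp add: c_def)
      then have "\<bar>y w i - y v i\<bar> \<le> \<bar>1\<bar>" by linarith
      then have "(y w i - y v i)\<^sup>2 \<le> 1\<^sup>2" by (rule abs_le_square_iff[THEN iffD1])
      moreover have "y w i - y v i = (w i - v i) * (sqrt (real d) / \<epsilon>)" by (simp add: y_def algebra_simps diff_divide_distrib[symmetric])
      ultimately have "(w i - v i)\<^sup>2 * (real d / \<epsilon>\<^sup>2) \<le> 1" by (simp add: power_mult_distrib power_divide)
      then show "(w i - v i)\<^sup>2 \<le> \<epsilon>\<^sup>2 / real d" using d \<epsilon> by (simp add: field_simps)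
    qed
    also have "\<dots> = \<epsilon>\<^sup>2" using d by simp
    finally show ?thesis unfolding L2_set_def using \<epsilon> by (intro real_le_lsqrt) (auto intro: sum_nonneg)
  qed
  moreover have "real (card (c ` W)) \<le> exp (real d * (2 * R\<^sup>2 + 4))"
    using card_mono[OF Z(1) sub] Z(2) by (simp add: add.assoc)
  ultimately show ?thesis using finite_subset[OF sub Z(1)] by blast
qed

text \<open>Centres may lie anywhere in \<open>G\<close>, whereas \<open>covering_number\<close>
  wants them in the covered set. This makes the notion monotone in \<open>H\<close> and lets
  coverings be composed.\<close>

definition covered_within :: "'z measure \<Rightarrow> ('z \<Rightarrow> real) set \<Rightarrow> ('z \<Rightarrow> real) set \<Rightarrow> real \<Rightarrow> real \<Rightarrow> bool" where
  "covered_within P G H \<epsilon> n \<longleftrightarrow>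
    (\<exists>S. finite S \<and> S \<subseteq> G \<and> real (card S) \<le> n \<and> (\<forall>h\<in>H. \<exists>s\<in>S. L1_dist P h s \<le> \<epsilon>))"

lemma L1_dist_commute: "L1_dist P g h = L1_dist P h g"
  unfolding L1_dist_def by (intro Bochner_Integration.integral_cong refl abs_minus_commute)

lemma L1_dist_triangle:
  assumes "integrable P f" "integrable P g" "integrable P h"
  shows "L1_dist P f h \<le> L1_dist P f g + L1_dist P g h"
proof -
  have "L1_dist P f h \<le> (\<integral>z. \<bar>f z - g z\<bar> + \<bar>g z - h z\<bar> \<partial>P)"
    unfolding L1_dist_def using assms by (intro integral_mono) auto
  also have "\<dots> = L1_dist P f g + L1_dist P g h"
    unfolding L1_dist_def using assms by (intro Bochner_Integration.integral_add) auto
  finally show ?thesis .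
qed

lemma covering_number_le_card:
  assumes "finite S" "S \<subseteq> H" "\<And>h. h \<in> H \<Longrightarrow> \<exists>s\<in>S. L1_dist P h s \<le> \<epsilon>"
  shows "covering_number P H \<epsilon> \<le> enat (card S)"
proof -
  obtain b where b: "bij_betw b {1..card S} S" using ex_bij_betw_nat_finite_1[OF assms(1)] by blast
  have "\<exists>j\<in>{1..card S}. L1_dist P h (b j) \<le> \<epsilon>" if h: "h \<in> H" for h
  proof -
    obtain s where s: "s \<in> S" "L1_dist P h s \<le> \<epsilon>" using assms(3)[OF h] by blast
    then obtain j where "j \<in> {1..card S}" "s = b j" using b by (metis bij_betw_def imageE)
    then show ?thesis using s by auto
  qed
  moreover have "b j \<in> H" if "j \<in> {1..card S}" for j using bij_betwE[OF b] that assms(2) by blast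
  ultimately have "is_covering P H \<epsilon> (card S) b" unfolding is_covering_def by simp
  then show ?thesis unfolding covering_number_def by (intro Inf_lower) blast
qed

lemma covering_of_covering_number:
  assumes "covering_number P H \<epsilon> = enat n"
  shows "\<exists>S. finite S \<and> S \<subseteq> H \<and> card S \<le> n \<and> (\<forall>h\<in>H. \<exists>s\<in>S. L1_dist P h s \<le> \<epsilon>)"
proof -
  let ?A = "{enat N | N. \<exists>h. is_covering P H \<epsilon> N h}"
  have "?A \<noteq> {}"
  proof
    assume "?A = {}"
    then have "covering_number P H \<epsilon> = \<infinity>" unfolding covering_number_def by (simp only: Inf_empty top_enat_def)
    then show False using assms by simp
  qed
  then obtain x where "x \<in> ?A" by blast
  then have "Inf ?A \<in> ?A" by (rule wellorder_InfI)
  then obtain h where h: "is_covering P H \<epsilon> n h" using assms by (auto simp: covering_number_def)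
  show ?thesis
    using h card_image_le[of "{1..n}" h] by (intro exI[of _ "h ` {1..n}"]) (auto simp: is_covering_def)
qed

lemma covered_within_mono:
  "covered_within P G H \<epsilon> n \<Longrightarrow> H' \<subseteq> H \<Longrightarrow> n \<le> n' \<Longrightarrow> covered_within P G H' \<epsilon> n'"
  unfolding covered_within_def by (meson order_trans subset_iff)

lemma covered_within_compose:
  assumes "covered_within P G H \<gamma> m" "H \<subseteq> G" and "n \<ge> 0"
    and cov: "\<And>g. g \<in> G \<Longrightarrow> covered_within P G (G \<inter> L1_ball P g \<gamma>) \<epsilon> n"
  shows "covered_within P G H \<epsilon> (m * n)"
proof -
  obtain S where S: "finite S" "S \<subseteq> G" "real (card S) \<le> m" "\<And>h. h \<in> H \<Longrightarrow> \<exists>s\<in>S. L1_dist P h s \<le> \<gamma>"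
    using assms(1) unfolding covered_within_def by blast
  have "\<forall>g\<in>S. \<exists>T. finite T \<and> T \<subseteq> G \<and> real (card T) \<le> n \<and> (\<forall>h\<in>G \<inter> L1_ball P g \<gamma>. \<exists>s\<in>T. L1_dist P h s \<le> \<epsilon>)"
    using cov S(2) unfolding covered_within_def by blast
  then obtain T where T: "\<And>g. g \<in> S \<Longrightarrow> finite (T g)" "\<And>g. g \<in> S \<Longrightarrow> T g \<subseteq> G" "\<And>g. g \<in> S \<Longrightarrow> real (card (T g)) \<le> n"
    "\<And>g h. g \<in> S \<Longrightarrow> h \<in> G \<inter> L1_ball P g \<gamma> \<Longrightarrow> \<exists>s\<in>T g. L1_dist P h s \<le> \<epsilon>"
    by metis
  show ?thesis unfolding covered_within_def
  proof (intro exI[of _ "\<Union>g\<in>S. T g"] conjI ballI)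
    have "real (card (\<Union>g\<in>S. T g)) \<le> (\<Sum>g\<in>S. real (card (T g)))"
      using card_UN_le[OF S(1), of T] by (metis of_nat_le_iff of_nat_sum)
    also have "\<dots> \<le> (\<Sum>g\<in>S. n)" using T(3) by (intro sum_mono)
    also have "\<dots> \<le> m * n" using S(3) assms(3) by (auto intro!: mult_right_mono)
    finally show "real (card (\<Union>g\<in>S. T g)) \<le> m * n" .
  next
    fix h assume h: "h \<in> H"
    obtain s where s: "s \<in> S" "L1_dist P h s \<le> \<gamma>" using S(4)[OF h] by blast
    have "h \<in> G \<inter> L1_ball P s \<gamma>" using h s assms(2) by (auto simp: L1_ball_def L1_dist_commute)
    then show "\<exists>t\<in>(\<Union>g\<in>S. T g). L1_dist P h t \<le> \<epsilon>" using T(4)[OF s(1)] s(1) by blast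
  next
    show "finite (\<Union>g\<in>S. T g)" using S(1) T(1) by blast
    show "(\<Union>g\<in>S. T g) \<subseteq> G" using T(2) by blast
  qed
qed

lemma real_le_exp_of_tlog:
  assumes "tlog_enat N \<le> ereal D"
  shows "\<exists>n. N = enat n \<and> real n \<le> exp D"
proof (cases N)
  case (enat n)
  then have "ln (max (real n) (exp 1)) \<le> D" using assms by (simp add: tlog_enat_def tlog_def)
  moreover have "0 < max (real n) (exp 1)" by (simp add: less_max_iff_disj)
  ultimately have "max (real n) (exp 1) \<le> exp D" by (metis exp_le_cancel_iff exp_ln)
  then show ?thesis using enat by simp
qed (use assms in \<open>simp add: tlog_enat_def\<close>)

lemma local_entropy_covering:
  assumes "local_entropy P G \<epsilon> 1 1 \<le> ereal D" "\<epsilon> \<le> \<gamma>" "0 < \<gamma>" "g \<in> G"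
  shows "covered_within P G (G \<inter> L1_ball P g (2 * \<gamma>)) \<gamma> (exp D)"
proof -
  have "tlog_enat (covering_number P (G \<inter> L1_ball P g (2 * 1 * rpow \<gamma> 1)) \<gamma>) \<le> local_entropy P G \<epsilon> 1 1"
    unfolding local_entropy_def using assms by (intro SUP_upper2[of \<gamma>] SUP_upper2[of g]) auto
  then have "tlog_enat (covering_number P (G \<inter> L1_ball P g (2 * \<gamma>)) \<gamma>) \<le> ereal D"
    using assms by (simp add: rpow_def)
  then obtain n where n: "covering_number P (G \<inter> L1_ball P g (2 * \<gamma>)) \<gamma> = enat n" "real n \<le> exp D"
    using real_le_exp_of_tlog by blast
  obtain S where S: "finite S" "S \<subseteq> G \<inter> L1_ball P g (2 * \<gamma>)" "card S \<le> n" "\<forall>h\<in>G \<inter> L1_ball P g (2 * \<gamma>). \<exists>s\<in>S. L1_dist P h s \<le> \<gamma>"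
    using covering_of_covering_number[OF n(1)] by blast
  have "real (card S) \<le> exp D" using S(3) n(2) by linarith
  then show ?thesis unfolding covered_within_def using S by blast
qed

text \<open>Every halving of the radius costs a factor \<open>exp D\<close>; all intermediate scales
  stay above \<open>\<epsilon>\<close>, so one entropy bound serves them all.\<close>

lemma local_entropy_covering_dyadic:
  assumes "local_entropy P G \<epsilon> 1 1 \<le> ereal D" "\<epsilon> \<le> \<gamma>" "0 < \<gamma>" "g \<in> G"
  shows "covered_within P G (G \<inter> L1_ball P g (2 ^ m * \<gamma>)) \<gamma> (exp (real m * D))"
  using assms(4)
proof (induction m arbitrary: g)
  case 0
  have "\<forall>h\<in>G \<inter> L1_ball P g (2 ^ 0 * \<gamma>). \<exists>s\<in>{g}. L1_dist P h s \<le> \<gamma>"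
    by (auto simp: L1_ball_def L1_dist_commute)
  then show ?case unfolding covered_within_def using 0 by (intro exI[of _ "{g}"]) auto
next
  case (Suc m)
  have "1 * \<gamma> \<le> 2 ^ m * \<gamma>" using assms(3) by (intro mult_right_mono) auto
  then have "\<epsilon> \<le> 2 ^ m * \<gamma>" using assms(2) by simp
  then have "covered_within P G (G \<inter> L1_ball P g (2 * (2 ^ m * \<gamma>))) (2 ^ m * \<gamma>) (exp D)"
    using assms Suc.prems by (intro local_entropy_covering[of P G \<epsilon>]) auto
  from covered_within_compose[OF this _ _ Suc.IH]
  show ?case by (simp add: exp_add[symmetric] algebra_simps)
qed

text \<open>An exchange argument: the net points in the ball serve only functions within
  \<open>r + \<eta>\<close> of \<open>g\<close>, so the given covering of that larger ball can
  replace them, and minimality forbids a gain. Indices are counted, so repeated functions count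
  separately.\<close>

lemma minimal_covering_local_count:
  assumes min: "is_minimal_covering P G \<eta> N h" and int: "\<And>g. g \<in> G \<Longrightarrow> integrable P g" and g: "g \<in> G"
    and cov: "covered_within P G (G \<inter> L1_ball P g (r + \<eta>)) \<eta> n"
  shows "real (card {j \<in> {1..N}. L1_dist P g (h j) \<le> r}) \<le> n"
proof -
  define J where "J = {j \<in> {1..N}. L1_dist P g (h j) \<le> r}"
  obtain S where S: "finite S" "S \<subseteq> G" "real (card S) \<le> n" "\<And>u. u \<in> G \<inter> L1_ball P g (r + \<eta>) \<Longrightarrow> \<exists>s\<in>S. L1_dist P u s \<le> \<eta>"
    using cov unfolding covered_within_def by blast
  have h: "\<And>j. j \<in> {1..N} \<Longrightarrow> h j \<in> G" "\<And>u. u \<in> G \<Longrightarrow> \<exists>j\<in>{1..N}. L1_dist P u (h j) \<le> \<eta>"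
    using min by (auto simp: is_minimal_covering_def is_covering_def)
  define S' where "S' = h ` ({1..N} - J) \<union> S"
  have "enat N = covering_number P G \<eta>" using min by (simp add: is_minimal_covering_def)
  also have "\<dots> \<le> enat (card S')"
  proof (rule covering_number_le_card)
    show "finite S'" "S' \<subseteq> G" using S h by (auto simp: S'_def)
    fix u assume u: "u \<in> G"
    obtain j where j: "j \<in> {1..N}" "L1_dist P u (h j) \<le> \<eta>" using h(2)[OF u] by blast
    show "\<exists>s\<in>S'. L1_dist P u s \<le> \<eta>"
    proof (cases "j \<in> J")
      case True
      have "L1_dist P g u \<le> L1_dist P g (h j) + L1_dist P (h j) u"
        using int u g h(1)[OF j(1)] by (intro L1_dist_triangle) auto
      then have "u \<in> G \<inter> L1_ball P g (r + \<eta>)"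
        using True j u by (auto simp: J_def L1_ball_def L1_dist_commute[of P "h j"])
      then show ?thesis using S(4) by (auto simp: S'_def)
    qed (use j in \<open>auto simp: S'_def\<close>)
  qed
  finally have "N \<le> card S'" by simp
  also have "\<dots> \<le> card (h ` ({1..N} - J)) + card S" unfolding S'_def by (rule card_Un_le)
  also have "\<dots> \<le> card ({1..N} - J) + card S" by (intro add_right_mono card_image_le) auto
  also have "card ({1..N} - J) = N - card J" by (subst card_Diff_subset) (auto simp: J_def)
  finally have "N \<le> N - card J + card S" .
  moreover have sub: "J \<subseteq> {1..N}" unfolding J_def by blast
  moreover have "card J \<le> N" using card_mono[OF _ sub] by simp
  ultimately have "card J \<le> card S" by linarith
  then show ?thesis using S(3) unfolding J_def by linarith
qed

section \<open>Deviation and peeling\<close>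

lemma exp_le_quadratic:
  fixes x :: real
  assumes "\<bar>x\<bar> \<le> 1"
  shows "exp x \<le> 1 + x + x\<^sup>2"
proof (cases "x \<ge> 0")
  case True
  then show ?thesis using exp_bound[of x] assms by simp
next
  case False
  define y where "y = - x"
  have y: "0 < y" "y \<le> 1" using False assms by (auto simp: y_def)
  have "exp x \<le> 1 / (1 + y)"
    using exp_ge_add_one_self[of y] y by (simp add: y_def exp_minus field_simps)
  \<comment> \<open>The product equals \<open>1 + y ^ 3\<close>.\<close>
  also have "1 \<le> (1 - y + y\<^sup>2) * (1 + y)"
    using y by (simp add: power2_eq_square algebra_simps)
  then have "1 / (1 + y) \<le> 1 - y + y\<^sup>2" using y by (simp add: field_simps)
  finally show ?thesis by (simp add: y_def)
qed

text \<open>Chernoff's method with the exponent \<open>\<lambda> = \<mu>/(2v)\<close>, which minimises \<open>-\<lambda>\<mu> + \<lambda>\<^sup>2v\<close>.\<close>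

lemma iid_sum_nonpos_prob:
  fixes Z :: "'z \<Rightarrow> real"
  assumes P: "prob_space P" and [measurable]: "Z \<in> borel_measurable P" and bd: "\<And>z. z \<in> space P \<Longrightarrow> \<bar>Z z\<bar> \<le> 1"
    and pos: "0 < (\<integral>z. Z z \<partial>P)"
  shows "measure (Pi\<^sub>M {..<n} (\<lambda>_. P)) {s \<in> space (Pi\<^sub>M {..<n} (\<lambda>_. P)). (\<Sum>i<n. Z (s i)) \<le> 0}
    \<le> exp (- (real n * ((\<integral>z. Z z \<partial>P)\<^sup>2 / (4 * (\<integral>z. \<bar>Z z\<bar> \<partial>P)))))"
proof -
  interpret sample: prob_space P by fact
  interpret product_prob_space "\<lambda>_::nat. P" "{..<n}" by standard
  define \<mu> where "\<mu> = (\<integral>z. Z z \<partial>P)"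
  define v where "v = (\<integral>z. \<bar>Z z\<bar> \<partial>P)"
  define l where "l = \<mu> / (2 * v)"
  have iZ: "integrable P Z" by (rule sample.integrable_const_bound[where B=1]) (use bd in auto)
  have "\<mu> \<le> v" unfolding \<mu>_def v_def using iZ by (intro integral_mono) auto
  then have v: "v > 0" using pos by (simp add: \<mu>_def)
  have l: "0 < l" "l \<le> 1" using pos v \<open>\<mu> \<le> v\<close> by (auto simp: l_def \<mu>_def field_simps)
  have "(\<integral>\<^sup>+z. ennreal (exp (- l * Z z)) \<partial>P) \<le> (\<integral>\<^sup>+z. ennreal (1 - l * Z z + l\<^sup>2 * \<bar>Z z\<bar>) \<partial>P)"
  proof (intro nn_integral_mono ennreal_leI)
    fix z assume z: "z \<in> space P"
    have "\<bar>- l * Z z\<bar> \<le> 1" using l bd[OF z] by (simp add: abs_mult mult_le_one)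
    then have "exp (- l * Z z) \<le> 1 + (- l * Z z) + (- l * Z z)\<^sup>2" by (rule exp_le_quadratic)
    also have "(- l * Z z)\<^sup>2 = l\<^sup>2 * (\<bar>Z z\<bar> * \<bar>Z z\<bar>)" by (simp add: power2_eq_square mult_ac)
    \<comment> \<open>\<open>|Z| \<le> 1\<close> lets the first absolute moment replace the
      variance, which is why an \<open>L1\<close> version of the Bernstein condition
      suffices.\<close>
    also have "\<dots> \<le> l\<^sup>2 * \<bar>Z z\<bar>" using bd[OF z] by (intro mult_left_mono mult_left_le) auto
    finally show "exp (- l * Z z) \<le> 1 - l * Z z + l\<^sup>2 * \<bar>Z z\<bar>" by simp
  qed
  also have "\<dots> = ennreal (\<integral>z. 1 - l * Z z + l\<^sup>2 * \<bar>Z z\<bar> \<partial>P)"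
  proof (intro nn_integral_eq_integral AE_I2)
    fix z assume z: "z \<in> space P"
    have "\<bar>l * Z z\<bar> \<le> 1" using l bd[OF z] by (simp add: abs_mult mult_le_one)
    moreover have "0 \<le> l\<^sup>2 * \<bar>Z z\<bar>" by simp
    ultimately show "0 \<le> 1 - l * Z z + l\<^sup>2 * \<bar>Z z\<bar>" by linarith
  qed (use iZ in auto)
  also have "(\<integral>z. 1 - l * Z z + l\<^sup>2 * \<bar>Z z\<bar> \<partial>P) = 1 - l * \<mu> + l\<^sup>2 * v"
    using iZ by (simp add: \<mu>_def v_def sample.prob_space)
  also have "\<dots> = 1 + (- (\<mu>\<^sup>2 / (4 * v)))" using v by (simp add: l_def power2_eq_square field_simps)
  also have "ennreal \<dots> \<le> ennreal (exp (- (\<mu>\<^sup>2 / (4 * v))))" by (intro ennreal_leI exp_ge_add_one_self)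
  finally have mgf: "(\<integral>\<^sup>+z. ennreal (exp (- l * Z z)) \<partial>P) \<le> ennreal (exp (- (\<mu>\<^sup>2 / (4 * v))))" .
  let ?Pn = "Pi\<^sub>M {..<n} (\<lambda>_. P)"
  let ?A = "{s \<in> space ?Pn. (\<Sum>i<n. Z (s i)) \<le> 0}"
  have "emeasure ?Pn ?A = (\<integral>\<^sup>+s. indicator ?A s \<partial>?Pn)" by (intro nn_integral_indicator[symmetric]) measurable
  also have "\<dots> \<le> (\<integral>\<^sup>+s. (\<Prod>i<n. ennreal (exp (- l * Z (s i)))) \<partial>?Pn)"
  proof (intro nn_integral_mono)
    fix s
    have "1 \<le> (\<Prod>i<n. exp (- l * Z (s i)))" if "(\<Sum>i<n. Z (s i)) \<le> 0"
    proof -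
      have "0 \<le> (\<Sum>i<n. - l * Z (s i))" using l that by (simp add: sum_distrib_left[symmetric] mult_nonneg_nonpos sum_negf)
      then show ?thesis by (simp add: exp_sum[symmetric])
    qed
    then show "indicator ?A s \<le> (\<Prod>i<n. ennreal (exp (- l * Z (s i))))"
      by (auto simp: indicator_def prod_ennreal)
  qed
  also have "\<dots> = (\<Prod>i<n. \<integral>\<^sup>+z. ennreal (exp (- l * Z z)) \<partial>P)" by (intro product_nn_integral_prod) auto
  also have "\<dots> \<le> (\<Prod>i<n. ennreal (exp (- (\<mu>\<^sup>2 / (4 * v)))))" using mgf by (intro prod_mono_ennreal)
  also have "\<dots> = ennreal (exp (- (real n * (\<mu>\<^sup>2 / (4 * v)))))"
    by (simp add: ennreal_power exp_of_nat_mult[symmetric])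
  finally show ?thesis unfolding \<mu>_def[symmetric] v_def[symmetric] by (simp add: emeasure_eq_measure)
qed

text \<open>The indices are grouped into the shells \<open>2\<^sup>k t\<^sub>0 < t\<^sub>j \<le> 2\<^sup>k\<^sup>+\<^sup>1 t\<^sub>0\<close>.\<close>

lemma peeling_sum:
  fixes t q :: "'j \<Rightarrow> real" and a e :: "nat \<Rightarrow> real"
  assumes J: "finite J" and t0: "t0 > 0" and t: "\<And>j. j \<in> J \<Longrightarrow> t0 < t j"
    and count: "\<And>k. real (card {j \<in> J. t j \<le> 2 ^ Suc k * t0}) \<le> exp (a k)"
    and q: "\<And>j k. j \<in> J \<Longrightarrow> 2 ^ k * t0 < t j \<Longrightarrow> q j \<le> exp (- e k)"
    and ae: "\<And>k. a k - e k \<le> - L - real (Suc k)"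
  shows "(\<Sum>j\<in>J. q j) \<le> exp (- L)"
proof -
  have "\<exists>k. 2 ^ k * t0 < t j \<and> t j \<le> 2 ^ Suc k * t0" if j: "j \<in> J" for j
  proof -
    obtain m where "t j / t0 < 2 ^ m" using real_arch_pow[of 2 "t j / t0"] by auto
    then have ex: "t j \<le> 2 ^ m * t0" using t0 by (simp add: field_simps)
    define m0 where "m0 = (LEAST m. t j \<le> 2 ^ m * t0)"
    have m0: "t j \<le> 2 ^ m0 * t0" unfolding m0_def by (rule LeastI[of _ m]) (rule ex)
    show ?thesis
    proof (cases m0)
      case 0
      then show ?thesis using m0 t[OF j] by simp
    next
      case (Suc k)
      then have "\<not> t j \<le> 2 ^ k * t0" using not_less_Least[of k "\<lambda>m. t j \<le> 2 ^ m * t0"] by (simp add: m0_def)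
      then show ?thesis using m0 Suc by (intro exI[of _ k]) auto
    qed
  qed
  then obtain \<kappa> where \<kappa>: "\<And>j. j \<in> J \<Longrightarrow> 2 ^ \<kappa> j * t0 < t j" "\<And>j. j \<in> J \<Longrightarrow> t j \<le> 2 ^ Suc (\<kappa> j) * t0" by metis
  have half: "exp (-1) \<le> (1 / 2 :: real)"
    using exp_ge_add_one_self[of "1::real"] by (simp add: exp_minus field_simps)
  have "(\<Sum>j\<in>J. q j) = (\<Sum>k\<in>\<kappa> ` J. \<Sum>j\<in>{j\<in>J. \<kappa> j = k}. q j)" by (rule sum.image_gen[OF J])
  also have "\<dots> \<le> (\<Sum>k\<in>\<kappa> ` J. exp (- L) * (1 / 2) ^ Suc k)"
  proof (intro sum_mono)
    fix k
    have "(\<Sum>j\<in>{j\<in>J. \<kappa> j = k}. q j) \<le> (\<Sum>j\<in>{j\<in>J. \<kappa> j = k}. exp (- e k))"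
      using q \<kappa> by (intro sum_mono) auto
    also have "\<dots> = real (card {j\<in>J. \<kappa> j = k}) * exp (- e k)" by simp
    also have "\<dots> \<le> exp (a k) * exp (- e k)"
    proof (intro mult_right_mono)
      have "card {j\<in>J. \<kappa> j = k} \<le> card {j \<in> J. t j \<le> 2 ^ Suc k * t0}" using J \<kappa> by (intro card_mono) auto
      then show "real (card {j\<in>J. \<kappa> j = k}) \<le> exp (a k)" using count[of k] by linarith
    qed simp
    \<comment> \<open>The slack of \<open>k + 1\<close> becomes a factor at most
      \<open>(1 / 2) ^ Suc k\<close>; over all shells these factors sum to 1.\<close>
    also have "\<dots> \<le> exp (- L + real (Suc k) * (-1))" using ae[of k] by (simp add: exp_add[symmetric])
    also have "\<dots> = exp (- L) * exp (-1) ^ Suc k" by (simp only: exp_add exp_of_nat_mult)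
    also have "\<dots> \<le> exp (- L) * (1 / 2) ^ Suc k" using half by (intro mult_left_mono power_mono) auto
    finally show "(\<Sum>j\<in>{j\<in>J. \<kappa> j = k}. q j) \<le> exp (- L) * (1 / 2) ^ Suc k" .
  qed
  also have "\<dots> = exp (- L) * (\<Sum>k\<in>\<kappa> ` J. (1 / 2) ^ Suc k)" by (simp add: sum_distrib_left)
  also have "\<dots> \<le> exp (- L) * 1"
  proof (intro mult_left_mono)
    have "(\<Sum>k\<in>\<kappa> ` J. (1 / 2 :: real) ^ Suc k) \<le> (\<Sum>k. (1 / 2) ^ Suc k)"
      using J power_half_series by (intro sum_le_suminf) (auto simp: sums_iff)
    then show "(\<Sum>k\<in>\<kappa> ` J. (1 / 2 :: real) ^ Suc k) \<le> 1" using power_half_series by (simp add: sums_iff)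
  qed simp
  finally show ?thesis by simp
qed

section \<open>Local entropy of halfspaces\<close>

text \<open>Log-covering number per dimension at radius ratio \<open>R\<close>. Passing from
  disagreement to distance of normals and back multiplies the ratio by
  \<open>angle_high / angle_low\<close>; the rest is the exponent in
  \<open>euclidean_cells\<close>.\<close>

definition entropy_rate :: "real \<Rightarrow> real" where
  "entropy_rate R = 2 * (R * (angle_high / angle_low))\<^sup>2 + 4"

lemma entropy_rate_ge_4: "entropy_rate R \<ge> 4" by (simp add: entropy_rate_def)

lemma normalized_halfspace:
  assumes "f \<in> homogeneous_halfspaces d"
  shows "\<exists>w. (\<Sum>i<d. w i * w i) = 1 \<and> f = halfspace d w"
proof -
  obtain w i where w: "f = halfspace d w" "i < d" "w i \<noteq> 0"
    using assms by (auto simp: homogeneous_halfspaces_def)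
  define r where "r = sqrt (\<Sum>i<d. w i * w i)"
  have "0 < w i * w i" using w(3) by (metis not_real_square_gt_zero)
  also have "\<dots> \<le> (\<Sum>i<d. w i * w i)" using w(2) by (intro member_le_sum[where f="\<lambda>i. w i * w i"]) auto
  finally have r: "r > 0" "r * r = (\<Sum>i<d. w i * w i)" by (auto simp: r_def)
  have "(\<Sum>i<d. (w i / r) * (w i / r)) = (\<Sum>i<d. w i * w i) / (r * r)" by (simp add: sum_divide_distrib)
  also have "\<dots> = 1" unfolding r(2)[symmetric] using r(1) by simp
  finally have 1: "(\<Sum>i<d. (w i / r) * (w i / r)) = 1" .
  have "(\<Sum>i<d. w i / r * x i) = (\<Sum>i<d. w i * x i) / r" for x by (simp add: sum_divide_distrib)
  then have "halfspace d w = halfspace d (\<lambda>i. w i / r)"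
    using r(1) by (simp add: halfspace_def fun_eq_iff zero_le_divide_iff)
  with 1 w(1) show ?thesis by (intro exI[of _ "\<lambda>i. w i / r"]) simp
qed

lemma tlog_enat_le:
  assumes "N \<le> enat m" "real m \<le> exp D" "1 \<le> D"
  shows "tlog_enat N \<le> ereal D"
proof -
  obtain k where k: "N = enat k" "k \<le> m" using assms(1) by (cases N) auto
  have "ln (max (real k) (exp 1)) \<le> ln (exp D)"
    using k assms by (subst ln_le_cancel_iff) (auto simp: less_max_iff_disj)
  then show ?thesis using k by (simp add: tlog_enat_def tlog_def)
qed

lemma local_entropy_antimono:
  "\<epsilon> \<le> \<epsilon>' \<Longrightarrow> local_entropy P G \<epsilon>' \<beta> B \<le> local_entropy P G \<epsilon> \<beta> B"
  unfolding local_entropy_def by (intro SUP_subset_mono) auto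

locale halfspace_data = prob_space P for P :: "labelled measure" +
  fixes d :: nat
  assumes d: "d \<ge> 1" and sets_P [measurable_cong]: "sets P = sets (data_space d)"
    and ilc: "isotropic_log_concave d (marginal_X d P)"
begin

abbreviation HH :: "classifier set" where "HH \<equiv> homogeneous_halfspaces d"
abbreviation G :: "(labelled \<Rightarrow> real) set" where "G \<equiv> loss_class HH"

sublocale X: isotropic_log_concave d "marginal_X d P" by (rule ilc)

lemma space_P: "space P = space (lebesgue_R d) \<times> {1, -1}"
  using sets_eq_imp_space_eq[OF sets_P] by (simp add: data_space_def space_pair_measure)

lemma measurable_fst_P [measurable]: "fst \<in> P \<rightarrow>\<^sub>M lebesgue_R d"
  using measurable_cong_sets[OF sets_P refl] by (auto simp: data_space_def)

lemma measurable_snd_P [measurable]: "snd \<in> P \<rightarrow>\<^sub>M count_space (UNIV :: int set)"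
proof -
  have "snd \<in> data_space d \<rightarrow>\<^sub>M count_space {1, -1 :: int}" unfolding data_space_def by measurable
  then have "(\<lambda>z. snd z) \<in> data_space d \<rightarrow>\<^sub>M count_space UNIV"
    by (rule measurable_compose) simp
  then show ?thesis using measurable_cong_sets[OF sets_P refl] by auto
qed

lemma loss_eq: "loss f = (\<lambda>z. of_bool (f (fst z) \<noteq> snd z))"
  by (auto simp: loss_def)

lemma measurable_HH: "f \<in> HH \<Longrightarrow> f \<in> lebesgue_R d \<rightarrow>\<^sub>M count_space UNIV"
  by (auto simp: homogeneous_halfspaces_def)

lemma measurable_error [measurable]: "f \<in> HH \<Longrightarrow> {z \<in> space P. f (fst z) \<noteq> snd z} \<in> sets P"
proof -
  assume "f \<in> HH"
  note [measurable] = measurable_HH[OF this]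
  show ?thesis by measurable
qed

lemma measurable_loss: "f \<in> HH \<Longrightarrow> loss f \<in> borel_measurable P"
proof -
  assume "f \<in> HH"
  note [measurable] = measurable_HH[OF this]
  show ?thesis unfolding loss_eq by measurable
qed

lemma integrable_loss: "f \<in> HH \<Longrightarrow> integrable P (loss f)"
  by (rule integrable_const_bound[where B=1]) (auto intro: measurable_loss, auto simp: loss_eq)

lemma integrable_G: "g \<in> G \<Longrightarrow> integrable P g"
  by (auto simp: loss_class_def integrable_loss)

lemma risk_eq: "f \<in> HH \<Longrightarrow> risk P f = (\<integral>z. loss f z \<partial>P)"
proof -
  assume f: "f \<in> HH"
  have "(\<integral>z. loss f z \<partial>P) = (\<integral>z. indicator {z \<in> space P. f (fst z) \<noteq> snd z} z \<partial>P)"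
    by (intro Bochner_Integration.integral_cong) (auto simp: loss_eq)
  then show ?thesis using measurable_error[OF f] by (simp add: risk_def)
qed

text \<open>Labels and predictions both lie in \<open>{1, -1}\<close>, so two losses differ at
  \<open>(x, y)\<close> exactly when the predictions differ at \<open>x\<close>: the label drops out
  and only the marginal matters.\<close>

lemma L1_dist_loss:
  assumes f: "f \<in> HH" and g: "g \<in> HH"
  shows "L1_dist P (loss f) (loss g) = disagreement (marginal_X d P) f g"
proof -
  note [measurable] = measurable_HH[OF f] measurable_HH[OF g]
  have "h x \<in> {1, -1}" if h: "h \<in> HH" for h x
  proof -
    obtain w where "h = halfspace d w" using h unfolding homogeneous_halfspaces_def by blast
    then show ?thesis by (simp add: halfspace_def)
  qed
  note val = this[OF f] this[OF g]
  have "L1_dist P (loss f) (loss g) = (\<integral>z. indicator {z \<in> space P. f (fst z) \<noteq> g (fst z)} z \<partial>P)"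
    unfolding L1_dist_def
  proof (intro Bochner_Integration.integral_cong refl)
    fix z assume z: "z \<in> space P"
    then have "snd z \<in> {1, -1}" by (auto simp: space_P)
    then show "\<bar>loss f z - loss g z\<bar> = indicator {z \<in> space P. f (fst z) \<noteq> g (fst z)} z"
      using val(1)[of "fst z"] val(2)[of "fst z"] z by (auto simp: loss_eq)
  qed
  also have "\<dots> = prob {z \<in> space P. f (fst z) \<noteq> g (fst z)}" by simp
  also have "\<dots> = disagreement (marginal_X d P) f g"
    unfolding disagreement_def marginal_X_def
    by (subst measure_distr) (auto intro!: arg_cong[where f=prob] simp: space_P)
  finally show ?thesis .
qed

text \<open>The lower angle bound puts the normals of the ball into a Euclidean ball, and the upper
  one makes cells of diameter \<open>\<gamma> / angle_high\<close> small enough in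
  \<open>L1\<close>.\<close>

lemma local_covering:
  assumes g: "g \<in> G" and \<gamma>: "\<gamma> > 0"
  shows "\<exists>S. finite S \<and> S \<subseteq> G \<inter> L1_ball P g (R * \<gamma>) \<and> real (card S) \<le> exp (real d * entropy_rate R) \<and>
    (\<forall>h\<in>G \<inter> L1_ball P g (R * \<gamma>). \<exists>s\<in>S. L1_dist P h s \<le> \<gamma>)"
proof -
  define H where "H = G \<inter> L1_ball P g (R * \<gamma>)"
  have "\<forall>h\<in>G. \<exists>w. (\<Sum>i<d. w i * w i) = 1 \<and> h = loss (halfspace d w)"
    using normalized_halfspace unfolding loss_class_def by blast
  then obtain wt where wt: "\<And>h. h \<in> G \<Longrightarrow> (\<Sum>i<d. wt h i * wt h i) = 1" "\<And>h. h \<in> G \<Longrightarrow> h = loss (halfspace d (wt h))"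
    by metis
  have HHw: "halfspace d (wt h) \<in> HH" if "h \<in> G" for h
  proof -
    have "\<exists>i<d. wt h i \<noteq> 0"
    proof (rule ccontr)
      assume "\<not> ?thesis"
      then have "(\<Sum>i<d. wt h i * wt h i) = 0" by (intro sum.neutral) auto
      then show False using wt(1)[OF that] by simp
    qed
    then show ?thesis by (auto simp: homogeneous_halfspaces_def)
  qed
  have dist: "L1_dist P h h' = disagreement (marginal_X d P) (halfspace d (wt h)) (halfspace d (wt h'))" if "h \<in> G" "h' \<in> G" for h h'
    using L1_dist_loss[OF HHw HHw, OF that] unfolding wt(2)[OF that(1), symmetric] wt(2)[OF that(2), symmetric] .
  have ah: "angle_high > 0" using angle_high_ge_1 by linarith
  have W: "L2_set (\<lambda>i. w i - wt g i) {..<d} \<le> (R * (angle_high / angle_low)) * (\<gamma> / angle_high)" if w: "w \<in> wt ` H" for w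
  proof -
    obtain h where h: "h \<in> H" "w = wt h" using w by blast
    then have hG: "h \<in> G" by (simp add: H_def)
    have "angle_low * L2_set (\<lambda>i. w i - wt g i) {..<d} \<le> L1_dist P h g"
      unfolding dist[OF hG g] h(2) by (rule X.disagreement_angle(1)[OF wt(1)[OF hG] wt(1)[OF g]])
    also have "\<dots> \<le> R * \<gamma>" using h by (simp add: H_def L1_ball_def L1_dist_commute)
    finally show ?thesis using angle_low_pos ah by (simp add: field_simps)
  qed
  obtain c :: "(nat \<Rightarrow> real) \<Rightarrow> nat \<Rightarrow> int" where c: "finite (c ` wt ` H)"
    "real (card (c ` wt ` H)) \<le> exp (real d * (2 * (R * (angle_high / angle_low))\<^sup>2 + 4))"
    "\<forall>w\<in>wt ` H. \<forall>v\<in>wt ` H. c w = c v \<longrightarrow> L2_set (\<lambda>i. w i - v i) {..<d} \<le> \<gamma> / angle_high"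
    using euclidean_cells[OF d divide_pos_pos[OF \<gamma> ah] W] by blast
  define e where "e = (\<lambda>h. c (wt h))"
  have eH: "e ` H = c ` wt ` H" by (simp add: e_def image_image)
  \<comment> \<open>One representative per nonempty cell, taken from \<open>H\<close> itself as
    \<open>covering_number\<close> demands.\<close>
  define S where "S = inv_into H e ` e ` H"
  have SH: "S \<subseteq> H" unfolding S_def by (auto intro: inv_into_into)
  have "\<exists>s\<in>S. L1_dist P h s \<le> \<gamma>" if h: "h \<in> H" for h
  proof -
    define s where "s = inv_into H e (e h)"
    have s: "s \<in> H" "e s = e h" using h by (auto simp: s_def inv_into_into f_inv_into_f)
    have "L2_set (\<lambda>i. wt h i - wt s i) {..<d} \<le> \<gamma> / angle_high" using c(3) h s by (auto simp: e_def)
    then have "angle_high * L2_set (\<lambda>i. wt h i - wt s i) {..<d} \<le> \<gamma>" using ah by (simp add: field_simps)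
    moreover have "h \<in> G" "s \<in> G" using h s by (auto simp: H_def)
    ultimately have "L1_dist P h s \<le> \<gamma>"
      using X.disagreement_angle(2)[OF wt(1) wt(1), of h s] dist[of h s] by simp
    then show ?thesis using h by (auto simp: S_def s_def)
  qed
  moreover have "finite S" unfolding S_def eH by (intro finite_imageI c)
  moreover have "real (card S) \<le> exp (real d * entropy_rate R)"
  proof -
    have "card S \<le> card (e ` H)" unfolding S_def by (intro card_image_le) (simp add: eH c)
    then show ?thesis using c(2) unfolding eH entropy_rate_def by linarith
  qed
  ultimately show ?thesis using SH unfolding H_def by blast
qed

lemma entropy_ge_1: "real d * entropy_rate R \<ge> 1"
  using mult_mono[of 1 "real d" 1 "entropy_rate R"] d entropy_rate_ge_4[of R] by simp

lemma local_entropy_le: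
  assumes "\<epsilon> > 0"
  shows "local_entropy P G \<epsilon> 1 1 \<le> ereal (real d * entropy_rate 2)"
  unfolding local_entropy_def
proof (intro SUP_least)
  fix \<gamma> g assume "\<gamma> \<in> {\<epsilon>..}" and g: "g \<in> G"
  then have \<gamma>: "\<gamma> > 0" using assms by simp
  obtain S where S: "finite S" "S \<subseteq> G \<inter> L1_ball P g (2 * \<gamma>)" "real (card S) \<le> exp (real d * entropy_rate 2)"
    "\<forall>h\<in>G \<inter> L1_ball P g (2 * \<gamma>). \<exists>s\<in>S. L1_dist P h s \<le> \<gamma>"
    using local_covering[OF g \<gamma>, of 2] by blast
  have "covering_number P (G \<inter> L1_ball P g (2 * \<gamma>)) \<gamma> \<le> enat (card S)"
    using S by (intro covering_number_le_card) auto
  then show "tlog_enat (covering_number P (G \<inter> L1_ball P g (2 * 1 * rpow \<gamma> 1)) \<gamma>) \<le> ereal (real d * entropy_rate 2)"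
    using \<gamma> S(3) entropy_ge_1 by (intro tlog_enat_le[of _ "card S"]) (auto simp: rpow_def)
qed

section \<open>The fixed point \<open>gamma_star\<close> for halfspaces\<close>

context
  fixes \<beta> B :: real and n :: nat
  assumes \<beta>: "0 < \<beta>" "\<beta> \<le> 1" and B: "B > 1" and n: "n \<ge> 1"
begin

definition fixed_points :: "real set" where
  "fixed_points = {\<epsilon>. 0 < \<epsilon> \<and> ereal (B / real n) * local_entropy P G (B * rpow \<epsilon> (\<beta> / (2 - \<beta>))) 1 1 \<le> ereal \<epsilon>}"

lemma gamma_star_eq: "gamma_star P G (B / real n) \<beta> B = Inf fixed_points"
  by (simp add: gamma_star_def fixed_points_def)

lemma scale_pos: "\<epsilon> > 0 \<Longrightarrow> B * rpow \<epsilon> (\<beta> / (2 - \<beta>)) > 0"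
  using \<beta> B by (auto simp: rpow_def)

text \<open>The entropy bound is the same at every scale, so \<open>B / n\<close> times that bound
  satisfies the defining inequality whatever scale it determines.\<close>

lemma dimension_fixed_point: "B / real n * (real d * entropy_rate 2) \<in> fixed_points"
proof -
  have pos: "0 < B / real n * (real d * entropy_rate 2)"
    using B n less_le_trans[OF zero_less_one entropy_ge_1[of 2]] by (intro mult_pos_pos[of "B / real n"]) auto
  have "ereal (B / real n) * local_entropy P G (B * rpow (B / real n * (real d * entropy_rate 2)) (\<beta> / (2 - \<beta>))) 1 1
      \<le> ereal (B / real n) * ereal (real d * entropy_rate 2)"
    using B n by (intro ereal_mult_left_mono local_entropy_le scale_pos pos) auto
  then show ?thesis using pos by (simp add: fixed_points_def)
qed

lemma bdd_below_fixed_points: "bdd_below fixed_points"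
  by (rule bdd_belowI[of _ 0]) (auto simp: fixed_points_def)

lemma gamma_star_nonneg: "0 \<le> gamma_star P G (B / real n) \<beta> B"
  unfolding gamma_star_eq using dimension_fixed_point by (intro cInf_greatest) (auto simp: fixed_points_def)

lemma gamma_star_le: "gamma_star P G (B / real n) \<beta> B \<le> B / real n * (real d * entropy_rate 2)"
  unfolding gamma_star_eq by (intro cInf_lower dimension_fixed_point bdd_below_fixed_points)

text \<open>The infimum need not be attained; an admissible point strictly below \<open>Q\<close>
  and antitonicity of the entropy in its scale suffice.\<close>

lemma local_entropy_above_gamma_star:
  assumes "gamma_star P G (B / real n) \<beta> B < Q"
  shows "local_entropy P G (B * rpow Q (\<beta> / (2 - \<beta>))) 1 1 \<le> ereal (real n * Q / B)"
proof -
  have "fixed_points \<noteq> {}" using dimension_fixed_point by blast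
  from cInf_lessD[OF this assms[unfolded gamma_star_eq]]
  obtain \<epsilon> where \<epsilon>: "\<epsilon> \<in> fixed_points" "\<epsilon> < Q" by blast
  then have e0: "0 < \<epsilon>" and fp: "ereal (B / real n) * local_entropy P G (B * rpow \<epsilon> (\<beta> / (2 - \<beta>))) 1 1 \<le> ereal \<epsilon>"
    by (auto simp: fixed_points_def)
  have "B * rpow \<epsilon> (\<beta> / (2 - \<beta>)) \<le> B * rpow Q (\<beta> / (2 - \<beta>))"
    using \<beta> B e0 \<epsilon>(2) by (auto simp: rpow_def intro!: powr_mono2)
  then have "local_entropy P G (B * rpow Q (\<beta> / (2 - \<beta>))) 1 1 \<le> local_entropy P G (B * rpow \<epsilon> (\<beta> / (2 - \<beta>))) 1 1"
    by (rule local_entropy_antimono)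
  also have "\<dots> \<le> ereal (real n * Q / B)"
  proof (cases "local_entropy P G (B * rpow \<epsilon> (\<beta> / (2 - \<beta>))) 1 1")
    case (real l)
    then have "B / real n * l \<le> Q" using fp \<epsilon>(2) by simp
    then show ?thesis using real B n by (simp add: field_simps)
  qed (use local_entropy_le[OF scale_pos[OF e0]] in auto)
  finally show ?thesis .
qed

end

end

section \<open>The skeleton estimator\<close>

lemma tlog_ge_1: "tlog x \<ge> 1"
proof -
  have "ln (exp 1) \<le> ln (max x (exp 1))" by (subst ln_le_cancel_iff) (auto simp: less_max_iff_disj)
  then show ?thesis by (simp add: tlog_def)
qed

lemma exp_minus_tlog_inverse:
  assumes "0 < \<delta>"
  shows "exp (- tlog (1 / \<delta>)) \<le> \<delta>"
proof -
  have "0 < max (1 / \<delta>) (exp 1)" by (simp add: less_max_iff_disj)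
  then have "exp (tlog (1 / \<delta>)) = max (1 / \<delta>) (exp 1)" by (simp add: tlog_def)
  then have "1 / \<delta> \<le> exp (tlog (1 / \<delta>))" by simp
  then show ?thesis using assms by (simp add: exp_minus field_simps)
qed

lemma ge_one_powr_le_self:
  assumes "1 \<le> (x::real)" "p \<le> 1"
  shows "x powr p \<le> x"
  using powr_mono[OF assms(2,1)] assms(1) by simp

context halfspace_data begin

lemma excess_integral:
  assumes "f \<in> HH" "fstar \<in> HH"
  shows "(\<integral>z. excess_loss fstar f z \<partial>P) = risk P f - risk P fstar"
  using assms by (simp add: excess_loss_def risk_eq integrable_loss)

lemma excess_abs_integral:
  "(\<integral>z. \<bar>excess_loss fstar f z\<bar> \<partial>P) = L1_dist P (loss f) (loss fstar)"
  by (simp add: excess_loss_def L1_dist_def)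

text \<open>Off an event of probability at most \<open>\<delta>\<close>, every net classifier of
  excess risk above \<open>t0\<close> has larger empirical risk than \<open>f j0\<close>. The first
  condition on \<open>K\<close> makes \<open>t0\<close> dominate \<open>Q powr \<alpha>\<close>; the
  second makes the Chernoff exponent beat the log-count in every shell.\<close>

lemma skeleton_erm_bound:
  assumes fstar: "is_arg_min (risk P) (\<lambda>f. f \<in> HH) fstar"
    and \<beta>: "0 < \<beta>" "\<beta> \<le> 1" and B: "B > 1" and n: "n \<ge> 1" and \<delta>: "0 < \<delta>"
    and bern: "L1_Bernstein P (excess_loss_class HH fstar) \<beta> B"
    and Q: "Q = gamma_star P G (B / real n) \<beta> B + B * tlog (1 / \<delta>) / real n"
    and a: "0 < a" "a \<le> 1" and \<eta>: "\<eta> = a * B * Q powr (\<beta> / (2 - \<beta>))"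
    and K: "entropy_rate 2 \<le> 2 ^ K" "(6 + real K) * (entropy_rate 2 + 1) + entropy_rate (1 / a) \<le> 2 ^ K / 32"
    and f: "\<And>j. j \<in> {1..N} \<Longrightarrow> f j \<in> HH"
    and cov: "is_minimal_covering P G \<eta> N (\<lambda>j. loss (f j))"
    and fhat: "\<And>s. s \<in> space (iid_sample n P) \<Longrightarrow> is_arg_min (emp_risk n s) (\<lambda>h. h \<in> f ` {1..N}) (fhat s)"
    and j0: "j0 \<in> {1..N}" and abs0: "(\<integral>z. \<bar>excess_loss fstar (f j0) z\<bar> \<partial>P) \<le> \<eta>"
    and exc0: "2 * (\<integral>z. excess_loss fstar (f j0) z \<partial>P) \<le> Q powr (1 / (2 - \<beta>))"
  shows "\<exists>A \<in> sets (iid_sample n P). measure (iid_sample n P) A \<ge> 1 - \<delta> \<and>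
      (\<forall>s\<in>A. risk P (fhat s) - risk P fstar
         \<le> 2 ^ K * (B * real d / real n + B * tlog (1 / \<delta>) / real n) powr (1 / (2 - \<beta>)))"
proof -
  define \<kappa> where "\<kappa> = entropy_rate 2"
  define L where "L = tlog (1 / \<delta>)"
  define X where "X = real d + L"
  define Q' where "Q' = B * real d / real n + B * L / real n"
  define \<theta> where "\<theta> = \<beta> / (2 - \<beta>)"
  define \<alpha> where "\<alpha> = 1 / (2 - \<beta>)"
  define t0 where "t0 = 2 ^ K * Q' powr \<alpha>"
  define s where "s = B * Q powr \<theta>"
  define t where "t j = risk P (f j) - risk P fstar" for j
  have \<kappa>: "\<kappa> \<ge> 1" using entropy_rate_ge_4[of 2] by (simp add: \<kappa>_def)
  have L: "L \<ge> 1" unfolding L_def by (rule tlog_ge_1)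
  have X: "X \<ge> 1" using L by (simp add: X_def)
  have \<theta>: "0 < \<theta>" "\<theta> \<le> 1" "\<alpha> * \<beta> = \<theta>" "0 < \<alpha>" "\<alpha> \<le> 1" "\<alpha> * (2 - \<beta>) = 1" using \<beta> by (auto simp: \<theta>_def \<alpha>_def field_simps)
  have Q'X: "Q' = B / real n * X" by (simp add: Q'_def X_def algebra_simps add_divide_distrib)
  have Q'0: "Q' > 0" unfolding Q'X using B n X by (intro mult_pos_pos) auto
  \<comment> \<open>The truncated logarithm is at least 1, so \<open>Q\<close> lies strictly above
    \<open>gamma_star\<close>.\<close>
  have gs: "gamma_star P G (B / real n) \<beta> B < Q" "0 < Q"
    using gamma_star_nonneg[OF \<beta> B n] L B n by (auto simp: Q L_def[symmetric] intro: add_nonneg_pos)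
  have QQ': "Q \<le> \<kappa> * Q'"
  proof -
    have "Q \<le> B / real n * (real d * \<kappa>) + B * L / real n"
      using gamma_star_le[OF \<beta> B n] by (simp add: Q L_def \<kappa>_def)
    also have "\<dots> \<le> B / real n * (real d * \<kappa>) + \<kappa> * (B * L / real n)"
      using \<kappa> B L by (intro add_left_mono) (simp add: divide_right_mono)
    also have "\<dots> = \<kappa> * Q'" by (simp add: Q'_def algebra_simps)
    finally show ?thesis .
  qed
  have s0: "s > 0" using B gs by (simp add: s_def)
  have \<eta>s: "\<eta> = a * s" by (simp add: \<eta> s_def \<theta>_def)
  have \<eta>0: "\<eta> > 0" using a s0 by (simp add: \<eta>s)
  have t0pos: "t0 > 0" using Q'0 by (simp add: t0_def)
  have Ut0: "Q powr \<alpha> \<le> t0"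
  proof -
    have "Q powr \<alpha> \<le> (\<kappa> * Q') powr \<alpha>" using QQ' gs \<theta> by (intro powr_mono2) auto
    also have "\<dots> = \<kappa> powr \<alpha> * Q' powr \<alpha>" using \<kappa> Q'0 by (simp add: powr_mult)
    also have "\<dots> \<le> 2 ^ K * Q' powr \<alpha>"
      using ge_one_powr_le_self[OF \<kappa> \<theta>(5)] K(1) by (intro mult_right_mono) (auto simp: \<kappa>_def)
    finally show ?thesis by (simp add: t0_def)
  qed
  \<comment> \<open>Consequently \<open>\<eta> \<le> B * t0 powr \<beta>\<close>:
    \<open>f j0\<close> is no farther from \<open>fstar\<close> than the Bernstein radius at excess
    \<open>t0\<close>.\<close>
  have Qt0: "Q powr \<theta> \<le> t0 powr \<beta>"
    using powr_mono2[OF less_imp_le[OF \<beta>(1)] _ Ut0] \<theta>(3) by (simp add: powr_powr)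
  have fs: "fstar \<in> HH" and opt: "\<And>h. h \<in> HH \<Longrightarrow> risk P fstar \<le> risk P h"
    using fstar by (auto simp: is_arg_min_def not_less)
  have fG: "loss (f j) \<in> G" if "j \<in> {1..N}" for j using f[OF that] by (simp add: loss_class_def)
  have t_nonneg: "0 \<le> t j" if "j \<in> {1..N}" for j using opt[OF f[OF that]] by (simp add: t_def)
  have tj0: "2 * t j0 \<le> t0" using exc0 Ut0 unfolding excess_integral[OF f[OF j0] fs] by (simp add: t_def \<alpha>_def)
  have dist: "L1_dist P (loss (f j)) (loss (f j0)) \<le> 2 * B * T powr \<beta>"
    if j: "j \<in> {1..N}" and T: "t j \<le> T" "t0 \<le> T" for j T
  proof -
    have "L1_dist P (loss (f j)) (loss (f j0)) \<le> L1_dist P (loss (f j)) (loss fstar) + L1_dist P (loss fstar) (loss (f j0))"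
      using f j j0 fs by (intro L1_dist_triangle integrable_loss) auto
    also have "L1_dist P (loss (f j)) (loss fstar) \<le> B * t j powr \<beta>"
    proof -
      have "excess_loss fstar (f j) \<in> excess_loss_class HH fstar" using f[OF j] by (simp add: excess_loss_class_def)
      from bern[unfolded L1_Bernstein_def, rule_format, OF this]
      show ?thesis using f[OF j] fs \<beta> by (simp add: excess_abs_integral excess_integral t_def rpow_def)
    qed
    also have "L1_dist P (loss fstar) (loss (f j0)) \<le> B * t0 powr \<beta>"
    proof -
      have "L1_dist P (loss fstar) (loss (f j0)) \<le> a * s"
        using abs0 unfolding excess_abs_integral \<eta>s by (simp add: L1_dist_commute)
      also have "\<dots> \<le> 1 * s" using a(2) s0 by (intro mult_right_mono) auto
      also have "\<dots> = B * Q powr \<theta>" by (simp add: s_def)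
      also have "\<dots> \<le> B * t0 powr \<beta>" using Qt0 B by simp
      finally show ?thesis .
    qed
    also have "B * t j powr \<beta> + B * t0 powr \<beta> \<le> B * T powr \<beta> + B * T powr \<beta>"
      using T t_nonneg[OF j] t0pos \<beta> B by (intro add_mono mult_left_mono powr_mono2) auto
    finally show ?thesis by simp
  qed
  define J where "J = {j \<in> {1..N}. t0 < t j}"
  define Z where "Z j z = loss (f j) z - loss (f j0) z" for j z
  let ?Pn = "iid_sample n P"
  define bad where "bad j = {s \<in> space ?Pn. (\<Sum>i<n. Z j (s i)) \<le> 0}" for j
  have Zm: "Z j \<in> borel_measurable P" if "j \<in> {1..N}" for j
    using measurable_loss[OF f[OF that]] measurable_loss[OF f[OF j0]] unfolding Z_def by measurable
  have badm: "bad j \<in> sets ?Pn" if "j \<in> {1..N}" for j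
  proof -
    note [measurable] = Zm[OF that]
    show ?thesis unfolding bad_def iid_sample_def by measurable
  qed
  \<comment> \<open>\<open>l\<close> doublings bridge the gap from \<open>Q\<close> to
    \<open>Q'\<close>. A logarithm of the ratio would do, but the ratio itself is affordable, since
    each doubling costs only \<open>D\<close>, proportional to \<open>Q\<close>.\<close>
  define l where "l = nat \<lceil>Q' / Q\<rceil>"
  define D where "D = real n * Q / B"
  \<comment> \<open>\<open>k + 1 + K\<close> comes from the outer edge of the shell,
    \<open>l\<close> from replacing \<open>Q'\<close> by \<open>Q\<close>, and the remaining 2 from
    the factor 4 in the derivation of \<open>rad\<close>.\<close>
  define m where "m k = k + 3 + K + l" for k
  \<comment> \<open>\<open>m k\<close> halvings down to the scale \<open>s\<close> cost
    \<open>D\<close> each; the constant ratio \<open>1 / a\<close> from \<open>s\<close> to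
    \<open>\<eta>\<close> is charged to the dimension.\<close>
  define Ak where "Ak k = real (m k) * D + real d * entropy_rate (1 / a)" for k
  define Ek where "Ek k = 2 ^ k * (2 ^ K * X / 32)" for k :: nat
  have l: "Q' / Q \<le> 2 ^ l" "real l \<le> Q' / Q + 1"
  proof -
    have "Q' / Q \<le> real l" using Q'0 gs by (simp add: l_def)
    also have "\<dots> \<le> 2 ^ l" using less_exp[of l] by (metis less_imp_le of_nat_le_iff of_nat_numeral of_nat_power)
    finally show "Q' / Q \<le> 2 ^ l" .
    have "0 \<le> Q' / Q" using Q'0 gs by simp
    then show "real l \<le> Q' / Q + 1" unfolding l_def by linarith
  qed
  have count: "real (card {j \<in> J. t j \<le> 2 ^ Suc k * t0}) \<le> exp (Ak k)" for k
  proof -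
    define T where "T = 2 ^ Suc k * t0"
    have "1 * t0 \<le> T" unfolding T_def using t0pos by (intro mult_right_mono one_le_power) auto
    then have T: "t0 \<le> T" by simp
    have "Q' powr \<theta> \<le> (2 ^ l * Q) powr \<theta>" using l(1) gs Q'0 \<theta> by (intro powr_mono2) (auto simp: field_simps)
    also have "\<dots> = (2 ^ l) powr \<theta> * Q powr \<theta>" using gs by (simp add: powr_mult)
    also have "\<dots> \<le> 2 ^ l * Q powr \<theta>" using \<theta> by (intro mult_right_mono ge_one_powr_le_self) auto
    finally have Q'\<theta>: "Q' powr \<theta> \<le> 2 ^ l * Q powr \<theta>" .
    have "T powr \<beta> = (2 ^ Suc k * 2 ^ K) powr \<beta> * (Q' powr \<alpha>) powr \<beta>"
      using Q'0 by (simp add: T_def t0_def powr_mult mult_ac)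
    also have "\<dots> \<le> (2 ^ Suc k * 2 ^ K) * (2 ^ l * Q powr \<theta>)"
    proof (intro mult_mono)
      have "(1::real) \<le> 2 ^ Suc k * 2 ^ K" unfolding power_add[symmetric] by (rule one_le_power) simp
      then show "(2 ^ Suc k * 2 ^ K :: real) powr \<beta> \<le> 2 ^ Suc k * 2 ^ K" by (rule ge_one_powr_le_self) (rule \<beta>)
      show "(Q' powr \<alpha>) powr \<beta> \<le> 2 ^ l * Q powr \<theta>" using Q'\<theta> by (simp add: powr_powr \<theta>(3))
    qed auto
    finally have T\<beta>: "T powr \<beta> \<le> 2 ^ (k + 1 + K + l) * Q powr \<theta>" by (simp add: power_add mult_ac)
    have "\<eta> \<le> B * T powr \<beta>"
    proof -
      have "\<eta> \<le> 1 * s" unfolding \<eta>s using a s0 by (intro mult_right_mono) auto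
      also have "\<dots> \<le> B * t0 powr \<beta>" using Qt0 B by (simp add: s_def)
      also have "\<dots> \<le> B * T powr \<beta>" using T t0pos \<beta> B by (intro mult_left_mono powr_mono2) auto
      finally show ?thesis .
    qed
    moreover have "0 \<le> B * T powr \<beta>" using B by simp
    ultimately have "2 * B * T powr \<beta> + \<eta> \<le> 4 * (B * T powr \<beta>)" unfolding mult.assoc by linarith
    also have "\<dots> \<le> 4 * (B * (2 ^ (k + 1 + K + l) * Q powr \<theta>))" using T\<beta> B by (intro mult_left_mono) auto
    also have "\<dots> = 2 ^ m k * s" by (simp add: m_def s_def power_add)
    finally have rad: "2 * B * T powr \<beta> + \<eta> \<le> 2 ^ m k * s" .
    have ent: "local_entropy P G s 1 1 \<le> ereal D"
      using local_entropy_above_gamma_star[OF \<beta> B n gs(1)] \<beta> by (simp add: D_def s_def rpow_def \<theta>_def)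
    have "covered_within P G (G \<inter> L1_ball P (loss (f j0)) (2 ^ m k * s)) s (exp (real (m k) * D))"
      by (rule local_entropy_covering_dyadic[OF ent order_refl s0 fG[OF j0]])
    then have "covered_within P G (G \<inter> L1_ball P (loss (f j0)) (2 ^ m k * s)) \<eta>
        (exp (real (m k) * D) * exp (real d * entropy_rate (1 / a)))"
    proof (rule covered_within_compose)
      fix g assume g: "g \<in> G"
      have "1 / a * \<eta> = s" using a by (simp add: \<eta>s)
      then show "covered_within P G (G \<inter> L1_ball P g s) \<eta> (exp (real d * entropy_rate (1 / a)))"
        using local_covering[OF g \<eta>0, of "1 / a"] unfolding covered_within_def by auto
    qed auto
    then have "covered_within P G (G \<inter> L1_ball P (loss (f j0)) (2 * B * T powr \<beta> + \<eta>)) \<eta> (exp (Ak k))"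
      using rad by (auto simp: Ak_def exp_add L1_ball_def elim!: covered_within_mono)
    from minimal_covering_local_count[OF cov integrable_G fG[OF j0] this]
    have "real (card {j \<in> {1..N}. L1_dist P (loss (f j0)) (loss (f j)) \<le> 2 * B * T powr \<beta>}) \<le> exp (Ak k)" .
    moreover have "{j \<in> J. t j \<le> T} \<subseteq> {j \<in> {1..N}. L1_dist P (loss (f j0)) (loss (f j)) \<le> 2 * B * T powr \<beta>}"
      using dist[OF _ _ T] by (auto simp: J_def L1_dist_commute[of P "loss (f j0)"])
    then have "card {j \<in> J. t j \<le> T} \<le> card {j \<in> {1..N}. L1_dist P (loss (f j0)) (loss (f j)) \<le> 2 * B * T powr \<beta>}"
      by (intro card_mono) auto
    ultimately show ?thesis unfolding T_def[symmetric] by linarith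
  qed
  have badp: "measure ?Pn (bad j) \<le> exp (- Ek k)" if j: "j \<in> J" and k: "2 ^ k * t0 < t j" for j k
  proof -
    have jN: "j \<in> {1..N}" and tj: "t0 < t j" using j by (auto simp: J_def)
    have iZ: "(\<integral>z. Z j z \<partial>P) = t j - t j0"
      unfolding Z_def using f[OF jN] f[OF j0] by (simp add: t_def risk_eq integrable_loss)
    have aZ: "(\<integral>z. \<bar>Z j z\<bar> \<partial>P) = L1_dist P (loss (f j)) (loss (f j0))" by (simp add: Z_def L1_dist_def)
    have half: "t j / 2 \<le> t j - t j0" using tj tj0 by simp
    have pos: "0 < (\<integral>z. Z j z \<partial>P)" unfolding iZ using half tj t0pos by linarith
    have Zi: "integrable P (Z j)" unfolding Z_def using f[OF jN] f[OF j0] by (simp add: integrable_loss)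
    have "(\<integral>z. Z j z \<partial>P) \<le> (\<integral>z. \<bar>Z j z\<bar> \<partial>P)" using Zi by (intro integral_mono) auto
    then have v0: "0 < L1_dist P (loss (f j)) (loss (f j0))" using pos aZ by simp
    have vle: "L1_dist P (loss (f j)) (loss (f j0)) \<le> 2 * B * t j powr \<beta>" using dist[OF jN order_refl] tj by simp
    have "measure ?Pn (bad j) \<le> exp (- (real n * ((\<integral>z. Z j z \<partial>P)\<^sup>2 / (4 * (\<integral>z. \<bar>Z j z\<bar> \<partial>P)))))"
      unfolding bad_def iid_sample_def
      by (rule iid_sum_nonpos_prob[OF prob_space_axioms Zm[OF jN] _ pos]) (auto simp: Z_def loss_eq)
    also have "\<dots> \<le> exp (- Ek k)"
    proof -
      have tjpos: "0 < t j" using tj t0pos by linarith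
      \<comment> \<open>Since \<open>2 - \<beta> \<ge> 1\<close>, powers of two survive the
        exponent: \<open>Ek\<close> doubles with each shell, while \<open>Ak\<close> grows only
        linearly in \<open>k\<close>.\<close>
      have "2 ^ k * 2 ^ K * Q' \<le> (2 ^ k * 2 ^ K) powr (2 - \<beta>) * (Q' powr \<alpha>) powr (2 - \<beta>)"
      proof (intro mult_mono)
        have one: "(1::real) \<le> 2 ^ k * 2 ^ K" unfolding power_add[symmetric] by (rule one_le_power) simp
        show "(2 ^ k * 2 ^ K :: real) \<le> (2 ^ k * 2 ^ K) powr (2 - \<beta>)"
          using powr_mono[OF _ one, of 1 "2 - \<beta>"] \<beta> one by simp
        show "Q' \<le> (Q' powr \<alpha>) powr (2 - \<beta>)" using Q'0 by (simp add: powr_powr \<theta>)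
      qed (use Q'0 in auto)
      also have "\<dots> = (2 ^ k * t0) powr (2 - \<beta>)" using Q'0 by (simp add: t0_def powr_mult mult.assoc)
      also have "\<dots> \<le> t j powr (2 - \<beta>)" using k t0pos \<beta> by (intro powr_mono2) auto
      finally have grow: "2 ^ k * 2 ^ K * Q' \<le> t j powr (2 - \<beta>)" .
      have "Ek k = real n * (2 ^ k * 2 ^ K * Q' / (32 * B))" using B n by (simp add: Ek_def Q'X)
      also have "\<dots> \<le> real n * (t j powr (2 - \<beta>) / (32 * B))"
        using grow B by (intro mult_left_mono divide_right_mono) auto
      \<comment> \<open>Source of the 32: the mean is at least \<open>t j / 2\<close>, the
        \<open>L1\<close> distance at most \<open>2 * B * t j powr \<beta>\<close>, and Chernoff
        contributes a 4.\<close>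
      also have "t j powr (2 - \<beta>) / (32 * B) = (t j / 2)\<^sup>2 / (4 * (2 * B * t j powr \<beta>))"
        using tjpos by (simp add: powr_diff power_divide field_simps)
      also have "\<dots> \<le> (t j - t j0)\<^sup>2 / (4 * L1_dist P (loss (f j)) (loss (f j0)))"
        using half vle v0 tjpos by (intro frac_le power_mono mult_left_mono) auto
      finally show ?thesis unfolding iZ aZ by (simp add: mult_left_mono)
    qed
    finally show ?thesis .
  qed
  have AE: "Ak k - Ek k \<le> - L - real (Suc k)" for k
  proof -
    have D0: "0 \<le> D" using gs B by (simp add: D_def)
    have D\<kappa>: "D \<le> \<kappa> * X"
    proof -
      have "D \<le> real n * (\<kappa> * Q') / B" unfolding D_def using QQ' B by (intro divide_right_mono mult_left_mono) auto
      also have "\<dots> = \<kappa> * X" using B n by (simp add: Q'X)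
      finally show ?thesis .
    qed
    \<comment> \<open>The extra halvings times their price amount to \<open>X + D\<close>, free of
      any logarithm.\<close>
    have "real l * D \<le> (Q' / Q + 1) * D" using l D0 by (intro mult_right_mono) auto
    also have "\<dots> = X + D" using gs B n by (simp add: D_def Q'X field_simps)
    finally have "real (m k) * D \<le> (real k + 4 + real K) * D + X" by (simp add: m_def algebra_simps)
    also have "\<dots> \<le> (real k + 4 + real K) * (\<kappa> * X) + X" using D\<kappa> by (intro add_right_mono mult_left_mono) auto
    finally have mk: "real (m k) * D \<le> ((real k + 4 + real K) * \<kappa> + 1) * X" by (simp add: algebra_simps)
    define \<rho> where "\<rho> = entropy_rate (1 / a)"
    have \<rho>: "\<rho> \<ge> 0" using entropy_rate_ge_4[of "1 / a"] by (simp add: \<rho>_def)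
    have "real d * \<rho> \<le> X * \<rho>" using L \<rho> by (intro mult_right_mono) (auto simp: X_def)
    then have A: "Ak k \<le> ((real k + 4 + real K) * \<kappa> + 1 + \<rho>) * X" using mk by (simp add: Ak_def \<rho>_def algebra_simps)
    have "((real k + 4 + real K) * \<kappa> + 1 + \<rho>) + (real k + 1) \<le> (real k + 1) * ((6 + real K) * (\<kappa> + 1) + \<rho>)"
    proof -
      have "0 \<le> real k * real K * \<kappa>" "0 \<le> real k * real K" "0 \<le> real k * \<kappa>" "0 \<le> real k * \<rho>" "0 \<le> real K" using \<kappa> \<rho> by auto
      then show ?thesis using \<kappa> by (simp add: algebra_simps)
    qed
    also have "\<dots> \<le> 2 ^ k * (2 ^ K / 32)"
    proof (intro mult_mono)
      have "Suc k \<le> 2 ^ k" using less_exp[of k] by (simp only: Suc_le_eq)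
      then have "real (Suc k) \<le> real (2 ^ k)" by (simp only: of_nat_le_iff)
      then show "real k + 1 \<le> 2 ^ k" by simp
      show "(6 + real K) * (\<kappa> + 1) + \<rho> \<le> 2 ^ K / 32" using K(2) by (simp add: \<kappa>_def \<rho>_def)
    qed (use \<kappa> \<rho> in auto)
    finally have "(((real k + 4 + real K) * \<kappa> + 1 + \<rho>) + (real k + 1)) * X \<le> 2 ^ k * (2 ^ K / 32) * X"
      using X by (intro mult_right_mono) auto
    then have "Ak k + (real k + 1) * X \<le> Ek k" using A by (simp add: Ek_def algebra_simps)
    moreover have "L + real (Suc k) \<le> (real k + 1) * X"
    proof -
      have d1: "1 \<le> real d" using d by simp
      have "0 \<le> real k * (real d - 1)" "0 \<le> real k * L" using d1 L by auto
      then show ?thesis using d1 by (simp add: X_def algebra_simps)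
    qed
    ultimately show ?thesis by linarith
  qed
  have total: "(\<Sum>j\<in>J. measure ?Pn (bad j)) \<le> exp (- L)"
    by (rule peeling_sum[where t=t and ?t0.0=t0 and a=Ak and e=Ek])
      (use count badp AE t0pos in \<open>auto simp: J_def\<close>)
  interpret S: prob_space ?Pn unfolding iid_sample_def by (intro prob_space_PiM prob_space_axioms)
  define A where "A = space ?Pn - (\<Union>j\<in>J. bad j)"
  have JN: "J \<subseteq> {1..N}" "finite J" by (auto simp: J_def)
  have Um: "(\<Union>j\<in>J. bad j) \<in> sets ?Pn" using JN badm by (intro sets.finite_UN) auto
  have "measure ?Pn (\<Union>j\<in>J. bad j) \<le> (\<Sum>j\<in>J. measure ?Pn (bad j))"
    using JN badm by (intro S.finite_measure_subadditive_finite) auto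
  also have "\<dots> \<le> \<delta>" using total exp_minus_tlog_inverse[OF \<delta>] by (simp add: L_def)
  finally have "measure ?Pn A \<ge> 1 - \<delta>" unfolding A_def using Um by (simp add: S.prob_compl)
  moreover have "A \<in> sets ?Pn" unfolding A_def using Um by auto
  moreover have "risk P (fhat s) - risk P fstar \<le> 2 ^ K * Q' powr \<alpha>" if s: "s \<in> A" for s
  proof -
    have sp: "s \<in> space ?Pn" using s by (simp add: A_def)
    obtain j where j: "j \<in> {1..N}" "fhat s = f j" using fhat[OF sp] by (auto simp: is_arg_min_def)
    have "f j0 \<in> f ` {1..N}" using j0 by simp
    then have "emp_risk n s (f j) \<le> emp_risk n s (f j0)" using fhat[OF sp] j(2) by (auto simp: is_arg_min_def not_less)
    \<comment> \<open>The empirical minimiser does no worse than \<open>f j0\<close> on the sample,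
      which is the event \<open>bad j\<close>; outside these events its index cannot belong to
      \<open>J\<close>.\<close>
    then have "(\<Sum>i<n. Z j (s i)) \<le> 0" using n by (simp add: emp_risk_def Z_def sum_subtractf divide_le_cancel)
    then have "s \<in> bad j" using sp by (simp add: bad_def)
    then have "j \<notin> J" using s by (auto simp: A_def)
    then show ?thesis using j by (simp add: J_def t_def t0_def)
  qed
  ultimately show ?thesis unfolding Q'_def \<alpha>_def L_def by blast
qed

end

text \<open>Supplies \<open>K\<close>, which depends only on the entropy rates at 2 and at
  \<open>1 / a\<close>, hence only on \<open>c0\<close>.\<close>

lemma exponential_dominates:
  fixes A E :: real
  assumes "A > 0"
  shows "\<exists>K. A \<le> 2 ^ K \<and> (6 + real K) * (A + 1) + E \<le> 2 ^ K / 32"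
proof -
  have l1: "(\<lambda>K. real K * (1 / 2) ^ K) \<longlonglongrightarrow> 0"
    using powser_times_n_limit_0[of "1 / 2 :: real"] by simp
  have l2: "(\<lambda>K. (1 / 2 :: real) ^ K) \<longlonglongrightarrow> 0" by (intro LIMSEQ_power_zero) simp
  have "(\<lambda>K. real K * (1 / 2) ^ K * (A + 1) + (1 / 2) ^ K * (6 * (A + 1) + E + A)) \<longlonglongrightarrow> 0 * (A + 1) + 0 * (6 * (A + 1) + E + A)"
    by (intro tendsto_add tendsto_mult_right l1 l2)
  then have "eventually (\<lambda>K. real K * (1 / 2) ^ K * (A + 1) + (1 / 2) ^ K * (6 * (A + 1) + E + A) < 1 / 32) sequentially"
    by (rule order_tendstoD) simp
  moreover have "eventually (\<lambda>K. (1 / 2 :: real) ^ K < 1 / A) sequentially"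
    using LIMSEQ_power_zero[of "1 / 2 :: real"] assms by (intro order_tendstoD) auto
  ultimately have "eventually (\<lambda>K. real K * (1 / 2) ^ K * (A + 1) + (1 / 2) ^ K * (6 * (A + 1) + E + A) < 1 / 32 \<and> (1 / 2 :: real) ^ K < 1 / A) sequentially"
    by eventually_elim simp
  from eventually_happens'[OF sequentially_bot this] obtain K where K: "real K * (1 / 2) ^ K * (A + 1) + (1 / 2) ^ K * (6 * (A + 1) + E + A) < 1 / 32" "(1 / 2 :: real) ^ K < 1 / A"
    by blast
  have "(real K * (1 / 2) ^ K * (A + 1) + (1 / 2) ^ K * (6 * (A + 1) + E + A)) * 2 ^ K = real K * (A + 1) + (6 * (A + 1) + E + A)"
    by (simp add: power_one_over field_simps)
  then have "real K * (A + 1) + (6 * (A + 1) + E + A) < 1 / 32 * 2 ^ K"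
    using mult_strict_right_mono[OF K(1), of "2 ^ K"] by simp
  moreover have "A < 2 ^ K" using K(2) assms by (simp add: power_one_over field_simps)
  ultimately show ?thesis using assms by (intro exI[of _ K]) (simp add: algebra_simps)
qed

theorem mainTheorem11:
  fixes c0 :: real
  assumes "c0 > 0"
  shows "\<exists>a b C :: real. 0 < a \<and> a \<le> b \<and> 0 < C \<and>
    (\<forall>(d::nat) (P :: labelled measure) (fstar :: classifier) (\<beta>::real) (B::real)
       (n::nat) (\<delta>::real) (Q::real) (\<eta>::real) (N::nat) (f :: nat \<Rightarrow> classifier)
       (fhat :: (nat \<Rightarrow> labelled) \<Rightarrow> classifier).
       d \<ge> 1 \<longrightarrow>
       prob_space P \<longrightarrow> sets P = sets (data_space d) \<longrightarrow>
       zero_mean d (marginal_X d P) \<longrightarrow>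
       isotropic d (marginal_X d P) \<longrightarrow>
       log_concave_distribution d (marginal_X d P) \<longrightarrow>
       is_arg_min (risk P) (\<lambda>f. f \<in> homogeneous_halfspaces d) fstar \<longrightarrow>
       0 \<le> \<beta> \<longrightarrow> \<beta> \<le> 1 \<longrightarrow> B > 1 \<longrightarrow>
       L1_Bernstein P (excess_loss_class (homogeneous_halfspaces d) fstar) \<beta> B \<longrightarrow>
       n \<ge> 1 \<longrightarrow> 0 < \<delta> \<longrightarrow> \<delta> < 1 \<longrightarrow>
       Q = gamma_star P (loss_class (homogeneous_halfspaces d)) (B / real n) \<beta> B
             + B * tlog (1 / \<delta>) / real n \<longrightarrow>
       0 \<le> \<eta> \<longrightarrow> \<eta> \<le> 1 \<longrightarrow>
       a * B * rpow Q (\<beta> / (2 - \<beta>)) \<le> \<eta> \<longrightarrow>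
       \<eta> \<le> b * B * rpow Q (\<beta> / (2 - \<beta>)) \<longrightarrow>
       (\<forall>j\<in>{1..N}. f j \<in> homogeneous_halfspaces d) \<longrightarrow>
       is_minimal_covering P (loss_class (homogeneous_halfspaces d)) \<eta> N (\<lambda>j. loss (f j)) \<longrightarrow>
       (\<forall>s\<in>space (iid_sample n P). is_arg_min (emp_risk n s) (\<lambda>h. h \<in> f ` {1..N}) (fhat s)) \<longrightarrow>
       (\<exists>feta \<in> f ` {1..N}.
          (\<integral>z. \<bar>excess_loss fstar feta z\<bar> \<partial>P) \<le> \<eta> \<and>
          (\<integral>z. \<bar>excess_loss fstar feta z\<bar> \<partial>P)
            \<ge> c0 * B * rpow (\<integral>z. excess_loss fstar feta z \<partial>P) \<beta>) \<longrightarrow>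
       (\<exists>A \<in> sets (iid_sample n P). measure (iid_sample n P) A \<ge> 1 - \<delta> \<and>
          (\<forall>s\<in>A. risk P (fhat s) - risk P fstar
             \<le> C * rpow (B * real d / real n + B * tlog (1 / \<delta>) / real n) (1 / (2 - \<beta>)))))"
proof -
  \<comment> \<open>\<open>2 * a \<le> c0\<close> yields the factor 2 in \<open>two\<close>, and
    \<open>a \<le> 1\<close> keeps \<open>\<eta>\<close> below the entropy scale.\<close>
  define a where "a = min c0 1 / 2"
  have a: "0 < a" "a \<le> 1" "2 * a \<le> c0" using assms by (auto simp: a_def)
  obtain K where K: "entropy_rate 2 \<le> 2 ^ K" "(6 + real K) * (entropy_rate 2 + 1) + entropy_rate (1 / a) \<le> 2 ^ K / 32"
    using exponential_dominates[of "entropy_rate 2" "entropy_rate (1 / a)"] entropy_rate_ge_4[of 2] by auto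
  show ?thesis
  proof (rule exI[of _ a], rule exI[of _ a], rule exI[of _ "2 ^ K"], intro conjI allI impI)
    fix d :: nat and P :: "labelled measure" and fstar :: classifier and \<beta> B :: real
      and n :: nat and \<delta> Q \<eta> :: real and N :: nat and f :: "nat \<Rightarrow> classifier"
      and fhat :: "(nat \<Rightarrow> labelled) \<Rightarrow> classifier"
    assume d: "d \<ge> 1" and P: "prob_space P" "sets P = sets (data_space d)"
      and X: "zero_mean d (marginal_X d P)" "isotropic d (marginal_X d P)" "log_concave_distribution d (marginal_X d P)"
      and fstar: "is_arg_min (risk P) (\<lambda>f. f \<in> homogeneous_halfspaces d) fstar"
      and \<beta>: "0 \<le> \<beta>" "\<beta> \<le> 1" and B: "B > 1"
      and bern: "L1_Bernstein P (excess_loss_class (homogeneous_halfspaces d) fstar) \<beta> B"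
      and n: "n \<ge> 1" and \<delta>: "0 < \<delta>" "\<delta> < 1"
      and Q: "Q = gamma_star P (loss_class (homogeneous_halfspaces d)) (B / real n) \<beta> B + B * tlog (1 / \<delta>) / real n"
      and \<eta>: "a * B * rpow Q (\<beta> / (2 - \<beta>)) \<le> \<eta>" "\<eta> \<le> a * B * rpow Q (\<beta> / (2 - \<beta>))"
      and f: "\<forall>j\<in>{1..N}. f j \<in> homogeneous_halfspaces d"
      and cov: "is_minimal_covering P (loss_class (homogeneous_halfspaces d)) \<eta> N (\<lambda>j. loss (f j))"
      and fhat: "\<forall>s\<in>space (iid_sample n P). is_arg_min (emp_risk n s) (\<lambda>h. h \<in> f ` {1..N}) (fhat s)"
      and ex: "\<exists>feta \<in> f ` {1..N}. (\<integral>z. \<bar>excess_loss fstar feta z\<bar> \<partial>P) \<le> \<eta> \<and>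
          (\<integral>z. \<bar>excess_loss fstar feta z\<bar> \<partial>P) \<ge> c0 * B * rpow (\<integral>z. excess_loss fstar feta z \<partial>P) \<beta>"
    interpret halfspace_data P d
      using d P X by (intro halfspace_data.intro halfspace_data_axioms.intro isotropic_log_concave.intro)
    obtain j0 where j0: "j0 \<in> {1..N}" "(\<integral>z. \<bar>excess_loss fstar (f j0) z\<bar> \<partial>P) \<le> \<eta>"
      "c0 * B * rpow (\<integral>z. excess_loss fstar (f j0) z \<partial>P) \<beta> \<le> (\<integral>z. \<bar>excess_loss fstar (f j0) z\<bar> \<partial>P)"
      using ex by blast
    define t where "t = (\<integral>z. excess_loss fstar (f j0) z \<partial>P)"
    have fs: "fstar \<in> HH" "\<And>h. h \<in> HH \<Longrightarrow> risk P fstar \<le> risk P h" using fstar by (auto simp: is_arg_min_def not_less)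
    have t: "0 \<le> t" using fs f j0(1) by (simp add: t_def excess_integral)
    have "c0 * B * rpow t \<beta> \<le> a * B * rpow Q (\<beta> / (2 - \<beta>))" using j0(2,3) \<eta>(2) by (simp add: t_def)
    moreover have "2 * a * B * rpow t \<beta> \<le> c0 * B * rpow t \<beta>" using a B by (intro mult_right_mono) (auto simp: rpow_def)
    ultimately have "(a * B) * (2 * rpow t \<beta>) \<le> (a * B) * rpow Q (\<beta> / (2 - \<beta>))" by simp
    then have two: "2 * rpow t \<beta> \<le> rpow Q (\<beta> / (2 - \<beta>))"
      using a B by (subst (asm) mult_le_cancel_left_pos) auto
    \<comment> \<open>At exponent 0 both \<open>rpow\<close> terms equal 1, so \<open>two\<close>
      would read \<open>2 \<le> 1\<close>.\<close>
    have \<beta>0: "0 < \<beta>"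
    proof (rule ccontr)
      assume "\<not> 0 < \<beta>"
      then show False using \<beta> two by (simp add: rpow_def)
    qed
    have Q0: "0 \<le> Q"
      using gamma_star_nonneg[OF \<beta>0 \<beta>(2) B n] tlog_ge_1[of "1 / \<delta>"] B by (simp add: Q)
    have "2 * t \<le> Q powr (1 / (2 - \<beta>))"
    proof -
      \<comment> \<open>Moving the factor 2 inside the power before taking the root of order
        \<open>\<beta>\<close> avoids any constant that depends on \<open>\<beta>\<close>.\<close>
      have "2 powr \<beta> \<le> 2 powr 1" using \<beta> by (intro powr_mono) auto
      then have "(2 * t) powr \<beta> \<le> 2 * t powr \<beta>" using t by (simp add: powr_mult mult_right_mono)
      also have "\<dots> \<le> Q powr (\<beta> / (2 - \<beta>))" using two \<beta>0 \<beta> by (simp add: rpow_def)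
      finally have "((2 * t) powr \<beta>) powr (1 / \<beta>) \<le> (Q powr (\<beta> / (2 - \<beta>))) powr (1 / \<beta>)"
        using \<beta>0 by (intro powr_mono2) auto
      then show ?thesis using \<beta>0 t by (simp add: powr_powr)
    qed
    moreover have "\<eta> = a * B * Q powr (\<beta> / (2 - \<beta>))" using \<eta> \<beta>0 \<beta> by (simp add: rpow_def)
    ultimately have "\<exists>A \<in> sets (iid_sample n P). measure (iid_sample n P) A \<ge> 1 - \<delta> \<and>
      (\<forall>s\<in>A. risk P (fhat s) - risk P fstar
         \<le> 2 ^ K * (B * real d / real n + B * tlog (1 / \<delta>) / real n) powr (1 / (2 - \<beta>)))"
      using f fhat j0 by (intro skeleton_erm_bound[OF fstar \<beta>0 \<beta>(2) B n \<delta>(1) bern Q a(1,2) _ K _ cov]) (auto simp: t_def)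
    then show "\<exists>A \<in> sets (iid_sample n P). measure (iid_sample n P) A \<ge> 1 - \<delta> \<and>
      (\<forall>s\<in>A. risk P (fhat s) - risk P fstar
         \<le> 2 ^ K * rpow (B * real d / real n + B * tlog (1 / \<delta>) / real n) (1 / (2 - \<beta>)))"
      using \<beta> by (simp add: rpow_def)
  qed (use a in auto)
qed

end
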